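(* Let $A$ be a finite dimensional commutative $\mathbb{Q}$-algebra with unit element $1_A$. Let $\Lambda_1$ and $\Lambda_2$ be two orders in $A$ with $\Lambda_2\subsetneqq\Lambda_1$. Let $C:=\Lambda_2:\Lambda_1$ (a full lattice, the conductor of the pair $(\Lambda_1,\Lambda_2)$). The set $P_0:=\{p\in\mathbb{P}\mid(\Lambda_1)_{(p)}\neq(\Lambda_2)_{(p)}\}$ is finite. (a) $\mathcal{O}(C)\supset\Lambda_1$. The conductor $C$ is the biggest $\Lambda_1$-ideal contained in $\Lambda_2$. (b) The following sequence is exact: $$1\to\prod_{p\in P_0}(\Lambda_2)_{(p)}^{unit}\to\prod_{p\in P_0}(\Lambda_1)_{(p)}^{unit}\to G(\Lambda_2)\to G(\Lambda_1)\to1 .$$ Here $G(\Lambda_2)\to G(\Lambda_1)$ is $L\mapsto\Lambda_1L$; especially, this group homomorphism is surjective. The image $L\in G(\Lambda_2)$ of a tuple $(a_p)_{p\in P_0}\in\prod_{p\in P_0}(\Lambda_1)_{(p)}^{unit}$ is given as follows: define $a_p:=1_A$ for $p\in\mathbb{P}-P_0$; then $L$ is the unique full lattice in $A$ with $L_{(p)}=a_p(\Lambda_2)_{(p)}$ for each $p\in\mathbb{P}$, namely $L=\bigcap_{p\in\mathbb{P}}a_p(\Lambda_2)_{(p)}$. (c) There is a natural isomorphism of groups $$(\Lambda_1/C)^{unit}/(\Lambda_2/C)^{unit}\to\bigoplus_{p\in P_0}(\Lambda_1)_{(p)}^{unit}/(\Lambda_2)_{(p)}^{unit}.$$ (d)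 The isomorphism of groups $$(\Lambda_1/C)^{unit}/(\Lambda_2/C)^{unit}\to\ker\bigl(G(\Lambda_2)\to G(\Lambda_1)\bigr)$$ which results from (b) and (c) is given by $$\bigl((a+C)\bmod(\Lambda_2/C)^{unit}\bigr)\mapsto C+a\Lambda_2,$$ where $a\in\Lambda_1$ with $a+C\in(\Lambda_1/C)^{unit}\subset\Lambda_1/C$. (e) The following sequence, whose maps are the natural ones, is exact: $$1\to\Lambda_2^{unit}\to\Lambda_1^{unit}\to\prod_{p\in P_0}\frac{(\Lambda_1)_{(p)}^{unit}}{(\Lambda_2)_{(p)}^{unit}}\to G([\Lambda_2]_\varepsilon)\to G([\Lambda_1]_\varepsilon)\to1 .$$ Especially, the group homomorphism $G([\Lambda_2]_\varepsilon)\to G([\Lambda_1]_\varepsilon)$, $[L]_\varepsilon\mapsto[\Lambda_1L]_\varepsilon$, is surjective. (f) The group $\Lambda_2^{unit}$ has finite index in the group $\Lambda_1^{unit}$. The groups $G([\Lambda_2]_\varepsilon)$ and $G([\Lambda_1]_\varepsilon)$ are finite, and $$\frac{|G([\Lambda_2]_\varepsilon)|}{|G([\Lambda_1]_\varepsilon)|}=\frac{|(\Lambda_1/C)^{unit}|}{|(\Lambda_2/C)^{unit}|}\cdot\frac{1}{[\Lambda_1^{unit}:\Lambda_2^{unit}]}.$$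
   Context: A full lattice in $A$ is a finitely generated $\mathbb{Z}$-submodule of $A$ which generates $A$ over $\mathbb{Q}$; $\mathcal{L}(A)$ is the set of full lattices. For $L_1,L_2\in\mathcal{L}(A)$, $L_1L_2$ is the set of finite sums $\sum_i a_ib_i$ with $a_i\in L_1,b_i\in L_2$, and $L_1:L_2:=\{a\in A\mid aL_2\subset L_1\}$; both are full lattices, and $\mathcal{L}(A)$ is a commutative semigroup under multiplication. An order in $A$ is a full lattice $\Lambda$ with $1_A\in\Lambda$, $\Lambda\Lambda\subset\Lambda$. The order of $L$ is $\mathcal{O}(L):=L:L$. A $\Lambda$-ideal is a full lattice $L$ with $\mathcal{O}(L)\supset\Lambda$. $L_1\sim_\varepsilon L_2$ iff $aL_1=L_2$ for some unit $a$ of $A$; $[L]_\varepsilon$ denotes the class and $\mathcal{E}(A):=\mathcal{L}(A)/\sim_\varepsilon$ is a commutative semigroup with the induced multiplication. In a commutative semigroup $S$: $a\in S$ is invertible if there are $b,c\in S$ with $ab=c$, $ac=a$; then $c$ is unique, idempotent, and denoted $e_a$. For $c$ idempotent, $G(c):=\{a\in S\mid a\text{ invertible},e_a=c\}$, a group with unit $c$. Orders are the idempotents of $\mathcal{L}(A)$ and their classes the idempotents of $\mathcal{E}(A)$; $G(\Lambda)$ is formed in $\mathcal{L}(A)$, $G([\Lambda]_\varepsilon)$ in $\mathcal{E}(A)$. $\mathbb{P}$ is the set of prime numbers. For $p\in\mathbb{P}$, $\mathbb{Z}_{(p)}\subset\mathbb{Q}$ is the ring of fractions with denominator prime to $p$,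 and $L_{(p)}:=\mathbb{Z}_{(p)}\cdot L\subset A$ for $L\in\mathcal{L}(A)$. $B^{unit}$ is the group of units of a commutative ring $B$ with unit, and $\Lambda_{(p)}^{unit}:=(\Lambda_{(p)})^{unit}$. Natural maps: the isomorphism in (c) is the one induced by the ring isomorphisms $\Lambda_i/C\cong\prod_{p\in P_0}(\Lambda_i)_{(p)}/C_{(p)}$ ($i=1,2$; $a+C\mapsto(a+C_{(p)})_p$) and the reduction maps $(\Lambda_i)_{(p)}^{unit}\to((\Lambda_i)_{(p)}/C_{(p)})^{unit}$. In (e), $\Lambda_2^{unit}\to\Lambda_1^{unit}$ is the inclusion, $\Lambda_1^{unit}\to\prod_{p\in P_0}(\Lambda_1)_{(p)}^{unit}/(\Lambda_2)_{(p)}^{unit}$ is the diagonal map, the next map is induced by $\prod_{p\in P_0}(\Lambda_1)_{(p)}^{unit}\to G(\Lambda_2)$ from (b) followed by $L\mapsto[L]_\varepsilon$, and the last map is $[L]_\varepsilon\mapsto[\Lambda_1L]_\varepsilon$. *)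

theory Defs
  imports
    Complex_Main
    "HOL-Algebra.Product_Groups"
    "HOL-Algebra.QuotRing"
    "HOL-Computational_Algebra.Primes"
begin

section \<open>Finite dimensional commutative algebras over the rationals\<close>

text \<open>The ring structure of the algebra is that of the type; \<open>scale\<close> is its rational scalar
  multiplication.\<close>

locale fin_dim_comm_rat_algebra = vector_space scale
  for scale :: "rat \<Rightarrow> 'a::comm_ring_1 \<Rightarrow> 'a" +
  assumes scale_mult_left: "scale r x * y = scale r (x * y)"
    and finite_dimensional: "\<exists>B. finite B \<and> span B = UNIV"

section \<open>Full lattices, orders and localizations\<close>

abbreviation int_span :: "'a::comm_ring_1 set \<Rightarrow> 'a set" where
  "int_span \<equiv> Modules.module.span (\<lambda>(k::int) x. of_int k * x)"

definition full_lattice :: "(rat \<Rightarrow> 'a::comm_ring_1 \<Rightarrow> 'a) \<Rightarrow> 'a set \<Rightarrow> bool" where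
  "full_lattice scale L \<longleftrightarrow>
     (\<exists>S. finite S \<and> L = int_span S) \<and> Modules.module.span scale L = UNIV"

definition lat_mult :: "'a::comm_ring_1 set \<Rightarrow> 'a set \<Rightarrow> 'a set" where
  "lat_mult L M = {\<Sum>i<n. a i * b i | (n::nat) a b. \<forall>i<n. a i \<in> L \<and> b i \<in> M}"

definition colon :: "'a::comm_ring_1 set \<Rightarrow> 'a set \<Rightarrow> 'a set" where
  "colon L M = {a. \<forall>x\<in>M. a * x \<in> L}"

definition is_order :: "(rat \<Rightarrow> 'a::comm_ring_1 \<Rightarrow> 'a) \<Rightarrow> 'a set \<Rightarrow> bool" where
  "is_order scale \<Lambda> \<longleftrightarrow> full_lattice scale \<Lambda> \<and> 1 \<in> \<Lambda> \<and> lat_mult \<Lambda> \<Lambda> \<subseteq> \<Lambda>"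

definition order_of :: "'a::comm_ring_1 set \<Rightarrow> 'a set" where
  "order_of L = colon L L"

definition lat_ideal :: "(rat \<Rightarrow> 'a::comm_ring_1 \<Rightarrow> 'a) \<Rightarrow> 'a set \<Rightarrow> 'a set \<Rightarrow> bool" where
  "lat_ideal scale \<Lambda> L \<longleftrightarrow> full_lattice scale L \<and> \<Lambda> \<subseteq> order_of L"

definition Z_loc :: "nat \<Rightarrow> rat set" where
  "Z_loc p = {of_int m / of_int n | m n. \<not> int p dvd n}"

definition loc :: "(rat \<Rightarrow> 'a::comm_ring_1 \<Rightarrow> 'a) \<Rightarrow> nat \<Rightarrow> 'a set \<Rightarrow> 'a set" where
  "loc scale p L =
     {\<Sum>i<n. scale (r i) (x i) | (n::nat) r x. \<forall>i<n. r i \<in> Z_loc p \<and> x i \<in> L}"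

text \<open>A subset of the algebra as a ring record (a ring if the subset is a subring), so that its
  unit group and its quotient rings can be formed with the library operations.\<close>

definition subring_of :: "'a::comm_ring_1 set \<Rightarrow> 'a ring" where
  "subring_of S = \<lparr>carrier = S, monoid.mult = (*), one = 1, ring.zero = 0, add = (+)\<rparr>"

abbreviation unit_group :: "'a::comm_ring_1 set \<Rightarrow> 'a monoid" where
  "unit_group S \<equiv> units_of (subring_of S)"

abbreviation quot_unit_group :: "'a::comm_ring_1 set \<Rightarrow> 'a set \<Rightarrow> 'a set monoid" where
  "quot_unit_group S I \<equiv> units_of (subring_of S Quot I)"

section \<open>Invertible elements of commutative semigroups\<close>

text \<open>A semigroup is given by its carrier and its multiplication.\<close>

definition sg_invertible :: "'s set \<Rightarrow> ('s \<Rightarrow> 's \<Rightarrow> 's) \<Rightarrow> 's \<Rightarrow> bool" where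
  "sg_invertible S m a \<longleftrightarrow> a \<in> S \<and> (\<exists>b\<in>S. \<exists>c\<in>S. m a b = c \<and> m a c = a)"

definition sg_unit :: "'s set \<Rightarrow> ('s \<Rightarrow> 's \<Rightarrow> 's) \<Rightarrow> 's \<Rightarrow> 's" where
  "sg_unit S m a = (THE c. c \<in> S \<and> (\<exists>b\<in>S. m a b = c \<and> m a c = a))"

definition sg_group :: "'s set \<Rightarrow> ('s \<Rightarrow> 's \<Rightarrow> 's) \<Rightarrow> 's \<Rightarrow> 's monoid" where
  "sg_group S m c =
     \<lparr>carrier = {a \<in> S. sg_invertible S m a \<and> sg_unit S m a = c}, monoid.mult = m, one = c\<rparr>"

section \<open>Lattice classes\<close>

definition eps_rel :: "(rat \<Rightarrow> 'a::comm_ring_1 \<Rightarrow> 'a) \<Rightarrow> ('a set \<times> 'a set) set" where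
  "eps_rel scale =
     {(L, M). full_lattice scale L \<and> full_lattice scale M \<and> (\<exists>a. a dvd 1 \<and> (*) a ` L = M)}"

definition eps_class :: "(rat \<Rightarrow> 'a::comm_ring_1 \<Rightarrow> 'a) \<Rightarrow> 'a set \<Rightarrow> 'a set set" where
  "eps_class scale L = eps_rel scale `` {L}"

text \<open>The multiplication induced on classes: since the relation is compatible with the
  multiplication of lattices, all members of the union coincide.\<close>

definition class_mult ::
    "(rat \<Rightarrow> 'a::comm_ring_1 \<Rightarrow> 'a) \<Rightarrow> 'a set set \<Rightarrow> 'a set set \<Rightarrow> 'a set set" where
  "class_mult scale X Y = (\<Union>L\<in>X. \<Union>M\<in>Y. eps_class scale (lat_mult L M))"

definition lat_group :: "(rat \<Rightarrow> 'a::comm_ring_1 \<Rightarrow> 'a) \<Rightarrow> 'a set \<Rightarrow> 'a set monoid" where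
  "lat_group scale \<Lambda> = sg_group {L. full_lattice scale L} lat_mult \<Lambda>"

definition class_group :: "(rat \<Rightarrow> 'a::comm_ring_1 \<Rightarrow> 'a) \<Rightarrow> 'a set \<Rightarrow> 'a set set monoid" where
  "class_group scale \<Lambda> =
     sg_group ({L. full_lattice scale L} // eps_rel scale) (class_mult scale) (eps_class scale \<Lambda>)"

section \<open>Gluing local data\<close>

text \<open>Tuples indexed by \<open>P\<close> are extensional functions, so the convention that the remaining
  components are \<open>1\<close> has to be made explicit.\<close>

definition ext_one :: "nat set \<Rightarrow> (nat \<Rightarrow> 'a::comm_ring_1) \<Rightarrow> nat \<Rightarrow> 'a" where
  "ext_one P a p = (if p \<in> P then a p else 1)"

definition glue ::
    "(rat \<Rightarrow> 'a::comm_ring_1 \<Rightarrow> 'a) \<Rightarrow> nat set \<Rightarrow> 'a set \<Rightarrow> (nat \<Rightarrow> 'a) \<Rightarrow> 'a set" where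
  "glue scale P \<Lambda> a = (\<Inter>p\<in>{p. prime p}. (*) (ext_one P a p) ` loc scale p \<Lambda>)"

section \<open>Exactness\<close>

text \<open>The library's \<open>exact_seq\<close> requires all groups of a sequence to have the same element type.
  Here exactness of \<open>F \<rightarrow> G \<rightarrow> H\<close> at \<open>G\<close> is stated for groups over different types; the outer
  trivial groups are \<open>singleton_group ()\<close>.\<close>

definition exact_at ::
    "('a, 'm) monoid_scheme \<Rightarrow> ('a \<Rightarrow> 'b) \<Rightarrow> ('b, 'n) monoid_scheme \<Rightarrow> ('b \<Rightarrow> 'c)
       \<Rightarrow> ('c, 'k) monoid_scheme \<Rightarrow> bool" where
  "exact_at F f G g H \<longleftrightarrow>
     group_hom F G f \<and> group_hom G H g \<and> f ` carrier F = kernel G H g"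

end

theory Submission
  imports Defs "Jordan_Normal_Form.Determinant" "HOL-Analysis.Kronecker_Approximation_Theorem"
begin

text \<open>Everything that distinguishes the two orders happens between the conductor \<open>C\<close> and \<open>\<Lambda>1\<close>,
  and it is described by the lattices \<open>K b = C + b \<Lambda>2\<close>, where \<open>b \<in> \<Lambda>1\<close> is a unit modulo \<open>C\<close>.
  The map \<open>K\<close> is multiplicative, depends only on the residue class of \<open>b\<close>, and takes the value
  \<open>\<Lambda>2\<close> exactly on the units of \<open>\<Lambda>2\<close> modulo \<open>C\<close> (\<open>K_mult\<close>, \<open>K_cong\<close>, \<open>K_eq_order_iff\<close>).
  Conversely, if \<open>L\<close> is an invertible \<open>\<Lambda>2\<close>-lattice with \<open>\<Lambda>1 L = \<Lambda>1\<close>, then \<open>C \<subseteq> L \<subseteq> \<Lambda>1\<close>, and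
  \<open>L\<close> is some \<open>K b\<close> because invertible lattices are principal modulo every positive integer
  \<open>N\<close> (\<open>invertible_generator_mod\<close>, \<open>kernel_is_K\<close>): an element of \<open>L\<close> has to avoid the
  submodules \<open>I L\<close> for the finitely many maximal ideals \<open>I\<close> that contain \<open>N\<close>. So
  \<open>a + C \<mapsto> C + a \<Lambda>2\<close> identifies the quotient of the unit groups of the two residue rings with
  the kernel of \<open>L \<mapsto> \<Lambda>1 L\<close>.

  The same kernel has a local description. A tuple of local units is approximated by one
  element \<open>b \<in> \<Lambda>1\<close>, by the Chinese remainder theorem, and a comparison of localizations shows
  that the lattice glued from the tuple is \<open>K b\<close> (\<open>strong_approximation\<close>, \<open>loc_K\<close>,
  \<open>glue_eq_K\<close>). Conversely, a unit modulo \<open>C\<close> can be changed by an element of \<open>C\<close> so that it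
  becomes a unit at every prime of \<open>P0\<close> (\<open>unit_lift_mod\<close>, \<open>unit_mod_has_local_units\<close>). Hence
  the product of the local quotients is isomorphic to the kernel as well, and the natural
  isomorphism between the residue ring side and the local side is obtained by composing one
  identification with the inverse of the other (\<open>local_classes\<close>).

  Surjectivity of \<open>L \<mapsto> \<Lambda>1 L\<close> is shown by an explicit preimage. After multiplication by a unit
  of the algebra, \<open>L \<subseteq> \<Lambda>1\<close> contains an element \<open>l\<close> with \<open>1 - l \<in> C\<close>; then \<open>l \<Lambda>2 + L C\<close> is an
  invertible \<open>\<Lambda>2\<close>-lattice which extends to \<open>L\<close> (\<open>extension_surj_coprime\<close>, \<open>extension_surj\<close>).
  The sequence of class groups follows from that of lattices: an invertible class is the class
  of an invertible lattice (\<open>carrier_class_group\<close>), and if \<open>u \<Lambda>2\<close> extends to \<open>\<Lambda>1\<close>, then \<open>u\<close> is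
  a unit of \<open>\<Lambda>1\<close>.

  The index formula is a count along these sequences, once the class groups are known to be
  finite (\<open>finite_class_group\<close>). The algebra may contain nilpotent elements, so this is more
  than the theorem for orders in number fields. The algebra is split by idempotents into parts
  in which every element is nilpotent or invertible; in each part the determinant of
  multiplication serves as a norm, and Dirichlet approximation shows that an element of least
  norm among the non-nilpotent elements of \<open>L\<close> generates \<open>L\<close> up to an index that does not
  depend on \<open>L\<close> and up to nilpotents (\<open>idempotent_generator\<close>). This leaves finitely many
  lattices modulo the nilradical, and invertible lattices which agree modulo the nilradical
  differ by a unipotent unit (\<open>lattices_equal_mod_nilradical\<close>).\<close>

hide_const (open) Polynomial.order

section \<open>Additive subgroups and lattices\<close>

text \<open>Lattices are spans for the action of the integers, and with this interpretation the
  library's results on spans and submodules apply to them.\<close>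

interpretation zmod: Modules.module "\<lambda>(k::int) (x::'a::comm_ring_1). of_int k * x"
  by unfold_locales (auto simp: algebra_simps)

abbreviation add_subgroup :: "'a::comm_ring_1 set \<Rightarrow> bool" where
  "add_subgroup \<equiv> Modules.module.subspace (\<lambda>(k::int) x. of_int k * x)"

lemma add_subgroupI:
  assumes "0 \<in> L" "\<And>x y. x \<in> L \<Longrightarrow> y \<in> L \<Longrightarrow> x - y \<in> L"
  shows "add_subgroup L"
proof -
  have neg: "- x \<in> L" if "x \<in> L" for x
    using assms(2)[OF assms(1) that] by simp
  have add: "x + y \<in> L" if "x \<in> L" "y \<in> L" for x y
    using assms(2)[OF that(1) neg[OF that(2)]] by simp
  have nat: "of_nat n * x \<in> L" if "x \<in> L" for n x
    by (induction n) (use assms(1) add that in \<open>auto simp: algebra_simps\<close>)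
  have "of_int k * x \<in> L" if "x \<in> L" for k x
    by (cases k rule: int_cases2) (use nat[OF that] neg in auto)
  then show ?thesis
    using assms(1) add by (auto simp: zmod.subspace_def)
qed

lemma of_nat_mult_mem: "add_subgroup L \<Longrightarrow> x \<in> L \<Longrightarrow> of_nat n * x \<in> L"
  using zmod.subspace_scale[of L x "int n"] by simp

lemma add_subgroup_image_mult:
  assumes "add_subgroup L"
  shows "add_subgroup ((*) a ` L)"
proof (rule add_subgroupI)
  show "0 \<in> (*) a ` L"
    using zmod.subspace_0[OF assms] by force
  fix x y assume "x \<in> (*) a ` L" "y \<in> (*) a ` L"
  then obtain u v where "x = a * u" "y = a * v" "u \<in> L" "v \<in> L" by auto
  then show "x - y \<in> (*) a ` L"
    using zmod.subspace_diff[OF assms, of u v] by (auto simp: right_diff_distrib[symmetric])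
qed

lemma add_subgroup_colon:
  assumes "add_subgroup N"
  shows "add_subgroup (colon N M)"
  unfolding colon_def
  by (rule add_subgroupI)
    (auto simp: zmod.subspace_0[OF assms] left_diff_distrib intro: zmod.subspace_diff[OF assms])

lemma colon_iff: "a \<in> colon N M \<longleftrightarrow> (\<forall>x\<in>M. a * x \<in> N)"
  by (simp add: colon_def)

lemma add_subgroup_vimage_mult: "add_subgroup N \<Longrightarrow> add_subgroup {x. a * x \<in> N}"
  using add_subgroup_colon[of N "{a}"] by (simp add: colon_def mult.commute)

lemma int_span_image_mult: "(*) (a::'a::comm_ring_1) ` int_span S = int_span ((*) a ` S)"
proof
  have "int_span S \<subseteq> {x. a * x \<in> int_span ((*) a ` S)}"
    by (intro zmod.span_minimal add_subgroup_vimage_mult zmod.subspace_span)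
      (auto intro: zmod.span_base)
  then show "(*) a ` int_span S \<subseteq> int_span ((*) a ` S)" by auto
  show "int_span ((*) a ` S) \<subseteq> (*) a ` int_span S"
    by (intro zmod.span_minimal add_subgroup_image_mult zmod.subspace_span)
      (auto intro: zmod.span_base)
qed

subsection \<open>Products of subgroups\<close>

lemma lat_mult_mem: "a \<in> L \<Longrightarrow> b \<in> M \<Longrightarrow> a * b \<in> lat_mult L M"
  unfolding lat_mult_def
  by (rule CollectI, rule exI[of _ 1], rule exI[of _ "\<lambda>_. a"], rule exI[of _ "\<lambda>_. b"]) auto

text \<open>The universal property of the product. Through it, inclusions between products are
  checked on products of elements, and the defining sums need not be handled.\<close>

lemma lat_mult_subset:
  assumes "add_subgroup N" "\<And>a b. a \<in> L \<Longrightarrow> b \<in> M \<Longrightarrow> a * b \<in> N"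
  shows "lat_mult L M \<subseteq> N"
  unfolding lat_mult_def using assms by (auto intro!: zmod.subspace_sum)

text \<open>Two sums of products are subtracted by concatenating their index ranges and negating the
  left factors of the second sum.\<close>

lemma add_subgroup_lat_mult:
  fixes L :: "'a::comm_ring_1 set"
  assumes "add_subgroup L"
  shows "add_subgroup (lat_mult L M)"
proof (rule add_subgroupI)
  show "0 \<in> lat_mult L M"
    unfolding lat_mult_def by (rule CollectI, rule exI[of _ 0]) auto
  fix x y assume "x \<in> lat_mult L M" "y \<in> lat_mult L M"
  then obtain n m and a b c d :: "nat \<Rightarrow> 'a"
    where x: "x = (\<Sum>i<n. a i * b i)" "\<forall>i<n. a i \<in> L \<and> b i \<in> M"
      and y: "y = (\<Sum>i<m. c i * d i)" "\<forall>i<m. c i \<in> L \<and> d i \<in> M"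
    unfolding lat_mult_def by blast
  define e where "e = (\<lambda>i. if i < n then a i else - c (i - n))"
  define f where "f = (\<lambda>i. if i < n then b i else d (i - n))"
  have "(\<Sum>i<n+m. e i * f i) = (\<Sum>i<n. e i * f i) + (\<Sum>i=n..<n+m. e i * f i)"
    using sum.atLeastLessThan_concat[of 0 n "n+m" "\<lambda>i. e i * f i"] by (simp add: atLeast0LessThan)
  also have "(\<Sum>i<n. e i * f i) = x"
    unfolding x e_def f_def by auto
  also have "(\<Sum>i=n..<n+m. e i * f i) = (\<Sum>i<m. e (i + n) * f (i + n))"
    using sum.shift_bounds_nat_ivl[of "\<lambda>i. e i * f i" 0 n m] by (simp add: atLeast0LessThan add.commute)
  also have "\<dots> = - y"
    unfolding y e_def f_def by (simp add: sum_negf)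
  finally have eq: "x - y = (\<Sum>i<n+m. e i * f i)" by simp
  moreover have "\<forall>i<n+m. e i \<in> L \<and> f i \<in> M"
    using x(2) y(2) zmod.subspace_neg[OF assms] unfolding e_def f_def by auto
  ultimately show "x - y \<in> lat_mult L M"
    unfolding lat_mult_def by blast
qed

lemma lat_mult_commute: "lat_mult L M = lat_mult M (L::'a::comm_ring_1 set)"
proof -
  have "lat_mult L M \<subseteq> lat_mult M L" for L M :: "'a set"
  proof
    fix x assume "x \<in> lat_mult L M"
    then obtain n and a b :: "nat \<Rightarrow> 'a"
      where "x = (\<Sum>i<n. a i * b i)" "\<forall>i<n. a i \<in> L \<and> b i \<in> M"
      unfolding lat_mult_def by blast
    then have "x = (\<Sum>i<n. b i * a i) \<and> (\<forall>i<n. b i \<in> M \<and> a i \<in> L)"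
      by (simp add: mult.commute)
    then show "x \<in> lat_mult M L"
      unfolding lat_mult_def by blast
  qed
  then show ?thesis by blast
qed

lemma lat_mult_mono: "L \<subseteq> L' \<Longrightarrow> M \<subseteq> M' \<Longrightarrow> lat_mult L M \<subseteq> lat_mult L' M'"
  unfolding lat_mult_def by blast

text \<open>A product with the last factor is moved across the inclusion by the colon, so that
  \<open>lat_mult_subset\<close> applies twice; commutativity gives the other inclusion.\<close>

lemma lat_mult_assoc:
  assumes L: "add_subgroup L" and M: "add_subgroup M" and N: "add_subgroup N"
  shows "lat_mult (lat_mult L M) N = lat_mult L (lat_mult M N)"
proof -
  have sub: "lat_mult (lat_mult L M) N \<subseteq> lat_mult L (lat_mult M N)" if "add_subgroup L"
    for L M N :: "'a set"
  proof -
    have "lat_mult L M \<subseteq> colon (lat_mult L (lat_mult M N)) N"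
      using that by (intro lat_mult_subset add_subgroup_colon add_subgroup_lat_mult)
        (auto simp: colon_iff mult.assoc intro: lat_mult_mem)
    then show ?thesis
      using that by (intro lat_mult_subset add_subgroup_lat_mult) (auto simp: colon_iff)
  qed
  have "lat_mult L (lat_mult M N) = lat_mult (lat_mult N M) L"
    unfolding lat_mult_commute[of N M] by (rule lat_mult_commute)
  also have "\<dots> \<subseteq> lat_mult N (lat_mult M L)"
    by (rule sub[OF N])
  also have "\<dots> = lat_mult (lat_mult L M) N"
    unfolding lat_mult_commute[of M L] by (rule lat_mult_commute)
  finally show ?thesis
    using sub[OF L, of M N] by blast
qed

lemma lat_mult_image_left:
  assumes "add_subgroup L"
  shows "lat_mult ((*) a ` L) M = (*) a ` lat_mult L M"
proof
  show "lat_mult ((*) a ` L) M \<subseteq> (*) a ` lat_mult L M"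
    using assms by (intro lat_mult_subset add_subgroup_image_mult add_subgroup_lat_mult)
      (auto simp: mult.assoc intro: lat_mult_mem)
  have "lat_mult L M \<subseteq> {x. a * x \<in> lat_mult ((*) a ` L) M}"
    using assms
    by (intro lat_mult_subset add_subgroup_vimage_mult add_subgroup_lat_mult add_subgroup_image_mult)
      (auto simp: mult.assoc[symmetric] intro: lat_mult_mem)
  then show "(*) a ` lat_mult L M \<subseteq> lat_mult ((*) a ` L) M" by auto
qed

lemma lat_mult_int_span: "lat_mult (int_span S) (int_span T) = int_span {s * t | s t. s \<in> S \<and> t \<in> T}"
  (is "?l = int_span ?P")
proof
  have 1: "int_span T \<subseteq> {y. s * y \<in> int_span ?P}" if "s \<in> S" for s
    using that by (intro zmod.span_minimal add_subgroup_vimage_mult zmod.subspace_span)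
      (auto intro: zmod.span_base)
  have "int_span S \<subseteq> colon (int_span ?P) (int_span T)"
    using 1 by (intro zmod.span_minimal add_subgroup_colon zmod.subspace_span) (fastforce simp: colon_iff)
  then show "?l \<subseteq> int_span ?P"
    by (intro lat_mult_subset zmod.subspace_span) (auto simp: colon_iff)
  show "int_span ?P \<subseteq> ?l"
    by (intro zmod.span_minimal add_subgroup_lat_mult zmod.subspace_span)
      (auto intro: lat_mult_mem zmod.span_base)
qed

lemma image_mult_unit_inverse:
  assumes "a * b = (1::'a::comm_ring_1)"
  shows "(*) a ` (*) b ` L = L"
  using assms by (auto simp: image_image mult.assoc[symmetric])

lemma unit_inverse_exists:
  assumes "(a::'a::comm_ring_1) dvd 1"
  obtains b where "a * b = 1" "b dvd 1"
  using assms by (metis dvd_def dvd_triv_right)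

subsection \<open>Full lattices\<close>

context fin_dim_comm_rat_algebra
begin

lemma scale_mult_right: "x * scale r y = scale r (x * y)"
  using scale_mult_left[of r y x] by (simp add: mult.commute)

lemma scale_of_nat: "scale (of_nat n) x = of_nat n * x"
  by (induction n) (auto simp: algebra_simps)

lemma scale_of_int: "scale (of_int k) x = of_int k * x"
  by (cases k rule: int_cases2) (auto simp: scale_of_nat)

lemma of_nat_mult_scale_inverse: "n > 0 \<Longrightarrow> of_nat n * scale (1 / of_nat n) x = x"
  by (simp add: scale_of_nat[symmetric])

lemma of_nat_mult_cancel: "n > 0 \<Longrightarrow> of_nat n * x = of_nat n * (y::'a) \<Longrightarrow> x = y"
  by (metis scale_of_nat of_nat_eq_0_iff less_irrefl scale_left_imp_eq)

lemma full_add_subgroup: "full_lattice scale L \<Longrightarrow> add_subgroup L"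
  unfolding full_lattice_def by auto

text \<open>The elements with a positive multiple in \<open>L\<close> form a rational subspace, and \<open>L\<close> spans the
  algebra.\<close>

lemma full_multiple:
  assumes "full_lattice scale L"
  shows "\<exists>n>0. of_nat n * x \<in> L"
proof -
  note L = full_add_subgroup[OF assms]
  let ?P = "\<lambda>x. \<exists>n>0. of_nat n * x \<in> L"
  have sub: "subspace {x. ?P x}"
  proof (rule subspaceI)
    show "0 \<in> {x. ?P x}"
      using zmod.subspace_0[OF L] by (auto intro: exI[of _ 1])
    fix x y assume "x \<in> {x. ?P x}" "y \<in> {x. ?P x}"
    then obtain n m where n: "n > 0" "of_nat n * x \<in> L" and m: "m > 0" "of_nat m * y \<in> L" by auto
    have "of_nat (n * m) * (x + y) = of_nat m * (of_nat n * x) + of_nat n * (of_nat m * y)"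
      by (simp add: algebra_simps)
    also have "\<dots> \<in> L"
      by (intro zmod.subspace_add[OF L] of_nat_mult_mem[OF L] n m)
    finally show "x + y \<in> {x. ?P x}"
      using n m by (auto intro!: exI[of _ "n * m"])
  next
    fix q x assume "x \<in> {x. ?P x}"
    then obtain n where n: "n > 0" "of_nat n * x \<in> L" by auto
    obtain a b where "quotient_of q = (a, b)" by fastforce
    then have q: "q = of_int a / of_int b" "b > 0"
      by (auto simp: quotient_of_div quotient_of_denom_pos)
    have "of_nat (nat b) * scale q x = of_int a * x"
      using q by (simp add: scale_of_nat[symmetric] scale_of_int[symmetric])
    then have "of_nat (n * nat b) * scale q x = of_nat n * (of_int a * x)"
      by (simp add: mult.assoc)
    then have "of_nat (n * nat b) * scale q x = of_int a * (of_nat n * x)"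
      by (simp only: ac_simps)
    also have "\<dots> \<in> L"
      by (rule zmod.subspace_scale[OF L n(2)])
    finally show "scale q x \<in> {x. ?P x}"
      using n q by (auto intro!: exI[of _ "n * nat b"])
  qed
  have "L \<subseteq> {x. ?P x}"
    by (auto intro: exI[of _ 1])
  with sub have "span L \<subseteq> {x. ?P x}"
    by (rule span_minimal[rotated])
  then show ?thesis
    using assms unfolding full_lattice_def by auto
qed

text \<open>Finite generation turns multipliers that depend on the element into a common one. The
  condition \<open>Q\<close> on multipliers is a parameter, since the lemma serves for positive multipliers
  and for those prime to \<open>p\<close>.\<close>

lemma full_uniform_multiple:
  assumes F: "full_lattice scale F" and L: "add_subgroup L"
    and Q: "Q 1" "\<And>m n. Q m \<Longrightarrow> Q n \<Longrightarrow> Q (m * n)"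
    and ex: "\<And>x. x \<in> F \<Longrightarrow> \<exists>n. Q n \<and> of_nat n * x \<in> L"
  obtains n where "Q n" "\<And>x. x \<in> F \<Longrightarrow> of_nat n * x \<in> L"
proof -
  obtain S where S: "finite S" "F = int_span S"
    using F unfolding full_lattice_def by auto
  have "\<forall>s\<in>S. \<exists>n. Q n \<and> of_nat n * s \<in> L"
    using ex zmod.span_base[of _ S] unfolding S(2) by blast
  with S(1) have "\<exists>n. Q n \<and> (\<forall>s\<in>S. of_nat n * s \<in> L)"
  proof (induction S rule: finite_induct)
    case empty
    show ?case using Q(1) by blast
  next
    case (insert s S)
    then obtain n m where n: "Q n" "\<forall>s\<in>S. of_nat n * s \<in> L" and m: "Q m" "of_nat m * s \<in> L"
      by auto
    have "of_nat (m * n) * t \<in> L" if "t \<in> S" for t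
      using of_nat_mult_mem[OF L, of "of_nat n * t" m] n(2) that by (simp add: mult.assoc)
    moreover have "of_nat (m * n) * s \<in> L"
      using of_nat_mult_mem[OF L m(2), of n] by (simp add: mult_ac)
    ultimately show ?case
      using Q(2)[OF m(1) n(1)] by blast
  qed
  then obtain n where n: "Q n" "\<forall>s\<in>S. of_nat n * s \<in> L" by blast
  have "F \<subseteq> {x. of_nat n * x \<in> L}"
    unfolding S(2) using n(2) by (intro zmod.span_minimal add_subgroup_vimage_mult L(1)) auto
  then show ?thesis
    using that n(1) by blast
qed

lemma full_common_multiple:
  assumes "full_lattice scale F" "full_lattice scale L"
  obtains n where "n > 0" "\<And>x. x \<in> F \<Longrightarrow> of_nat n * x \<in> L"
proof (rule full_uniform_multiple[OF assms(1) full_add_subgroup[OF assms(2)], of "\<lambda>n. n > 0"])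
  show "\<exists>n>0. of_nat n * x \<in> L" for x by (rule full_multiple[OF assms(2)])
qed (use that in auto)

text \<open>The generators are treated one at a time: the coefficient of the new generator matters
  only modulo \<open>n\<close>.\<close>

lemma finite_residues:
  assumes F: "full_lattice scale F" and n: "n > 0"
  obtains T where "finite T" "T \<subseteq> F" "\<And>x. x \<in> F \<Longrightarrow> \<exists>t\<in>T. \<exists>y\<in>F. x = t + of_nat n * y"
proof -
  obtain S where S: "finite S" "F = int_span S"
    using F unfolding full_lattice_def by auto
  have "\<exists>T. finite T \<and> T \<subseteq> int_span S \<and> (\<forall>x\<in>int_span S. \<exists>t\<in>T. \<exists>y\<in>int_span S. x = t + of_nat n * y)"
    using S(1)
  proof (induction S rule: finite_induct)
    case empty
    show ?case by (rule exI[of _ "{0}"]) auto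
  next
    case (insert s S)
    then obtain T where T: "finite T" "T \<subseteq> int_span S"
      "\<forall>x\<in>int_span S. \<exists>t\<in>T. \<exists>y\<in>int_span S. x = t + of_nat n * y" by blast
    have mono: "int_span S \<subseteq> int_span (insert s S)"
      by (rule zmod.span_mono) auto
    have s: "s \<in> int_span (insert s S)"
      by (rule zmod.span_base) auto
    let ?T = "(\<lambda>(k, t). of_int k * s + t) ` ({0..<int n} \<times> T)"
    have "\<exists>t\<in>?T. \<exists>y\<in>int_span (insert s S). x = t + of_nat n * y" if x: "x \<in> int_span (insert s S)" for x
    proof -
      obtain k where "x - of_int k * s \<in> int_span S"
        using x by (auto simp: zmod.span_insert)
      then obtain t y where t: "t \<in> T" "y \<in> int_span S" "x - of_int k * s = t + of_nat n * y"
        using T(3) by blast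
      have "of_int k = (of_int (k mod int n + int n * (k div int n)) :: 'a)"
        by simp
      then have "of_int k = of_int (k mod int n) + of_nat n * (of_int (k div int n) :: 'a)"
        by (simp only: of_int_add of_int_mult of_int_of_nat_eq)
      then have "x = (of_int (k mod int n) * s + t) + of_nat n * (of_int (k div int n) * s + y)"
        using t(3) by (simp add: algebra_simps)
      moreover have "of_int (k div int n) * s + y \<in> int_span (insert s S)"
        using t(2) s mono by (intro zmod.span_add zmod.span_scale) auto
      moreover have "of_int (k mod int n) * s + t \<in> ?T"
        using t(1) n by force
      ultimately show ?thesis by blast
    qed
    moreover have "?T \<subseteq> int_span (insert s S)"
      using T(2) mono s by (auto intro!: zmod.span_add zmod.span_scale)
    ultimately show ?case
      using T(1) by (intro exI[of _ ?T]) auto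
  qed
  then show ?thesis
    using that S(2) by blast
qed

lemma full_latticeI:
  assumes S: "finite S" "L = int_span S" and m: "\<And>x. \<exists>n>0. of_nat n * x \<in> L"
  shows "full_lattice scale L"
proof -
  have "x \<in> span L" for x
  proof -
    obtain n where n: "n > 0" "of_nat n * x \<in> L" using m by blast
    then have "scale (1 / of_nat n) (of_nat n * x) \<in> span L"
      by (intro span_scale span_base)
    then show ?thesis
      using n(1) by (simp add: scale_mult_right[symmetric] of_nat_mult_scale_inverse)
  qed
  then show ?thesis
    unfolding full_lattice_def using S by blast
qed

lemma full_image:
  assumes a: "a dvd 1" and L: "full_lattice scale L"
  shows "full_lattice scale ((*) a ` L)"
proof -
  obtain S where S: "finite S" "L = int_span S"
    using L unfolding full_lattice_def by auto
  obtain b where b: "a * b = 1" using unit_inverse_exists[OF a] by blast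
  show ?thesis
  proof (rule full_latticeI)
    show "(*) a ` L = int_span ((*) a ` S)"
      unfolding S int_span_image_mult ..
    fix x
    obtain n where n: "n > 0" "of_nat n * (b * x) \<in> L" using full_multiple[OF L] by blast
    have "a * (of_nat n * (b * x)) = (a * b) * (of_nat n * x)"
      by (simp only: ac_simps)
    then have "of_nat n * x = a * (of_nat n * (b * x))"
      using b by simp
    then show "\<exists>n>0. of_nat n * x \<in> (*) a ` L"
      using n by blast
  qed (use S in auto)
qed

text \<open>A group \<open>L\<close> between \<open>n F\<close> and \<open>F / m\<close> is finitely generated: modulo \<open>n m (F / m) = n F\<close>
  \<open>F / m\<close> has only finitely many classes, so generators of \<open>n F\<close> together with representatives
  of the classes met by \<open>L\<close> generate \<open>L\<close>.\<close>

lemma full_commensurable: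
  assumes F: "full_lattice scale F" and L: "add_subgroup L"
    and n: "n > 0" "\<And>x. x \<in> F \<Longrightarrow> of_nat n * x \<in> L"
    and m: "m > 0" "\<And>x. x \<in> L \<Longrightarrow> of_nat m * x \<in> F"
  shows "full_lattice scale L"
proof -
  define F' where "F' = (*) (scale (1 / of_nat m) 1) ` F"
  have inv: "scale (1 / of_nat m) 1 * of_nat m = (1::'a)"
    using of_nat_mult_scale_inverse[OF m(1), of 1] by (simp add: mult.commute)
  have F': "full_lattice scale F'"
    unfolding F'_def by (rule full_image[OF _ F]) (use inv in \<open>metis dvd_triv_left\<close>)
  have sub: "L \<subseteq> F'"
  proof
    fix x assume "x \<in> L"
    then have "scale (1 / of_nat m) 1 * (of_nat m * x) \<in> F'"
      unfolding F'_def using m(2) by blast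
    then show "x \<in> F'"
      using inv by (simp add: mult.assoc[symmetric])
  qed
  have nm: "of_nat (n * m) * x \<in> L" if x: "x \<in> F'" for x
  proof -
    obtain y where y: "y \<in> F" "x = scale (1 / of_nat m) 1 * y"
      using x unfolding F'_def by blast
    have "of_nat (n * m) * x = of_nat n * y"
    proof -
      have "of_nat (n * m) * x = of_nat n * ((scale (1 / of_nat m) 1 * of_nat m) * y)"
        unfolding y(2) by (simp only: of_nat_mult ac_simps)
      then show ?thesis unfolding inv by simp
    qed
    then show ?thesis using n(2)[OF y(1)] by simp
  qed
  obtain S where S: "finite S" "F' = int_span S"
    using F' unfolding full_lattice_def by auto
  obtain T where T: "finite T" "T \<subseteq> F'" "\<And>x. x \<in> F' \<Longrightarrow> \<exists>t\<in>T. \<exists>y\<in>F'. x = t + of_nat (n * m) * y"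
    using finite_residues[OF F', of "n * m"] n(1) m(1) by auto
  let ?G = "(T \<inter> L) \<union> (*) (of_nat (n * m)) ` S"
  have "L = int_span ?G"
  proof
    show "int_span ?G \<subseteq> L"
      by (rule zmod.span_minimal) (use L nm S in \<open>auto intro: zmod.span_base\<close>)
    show "L \<subseteq> int_span ?G"
    proof
      fix x assume x: "x \<in> L"
      then obtain t y where ty: "t \<in> T" "y \<in> F'" "x = t + of_nat (n * m) * y"
        using T(3) sub by blast
      have "t = x - of_nat (n * m) * y" using ty(3) by (simp add: algebra_simps)
      then have "t \<in> L" using zmod.subspace_diff[OF L x nm[OF ty(2)]] by (simp del: of_nat_mult)
      then have "t \<in> int_span ?G" using ty(1) by (intro zmod.span_base) auto
      moreover have "of_nat (n * m) * y \<in> int_span ?G"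
      proof -
        have "of_nat (n * m) * y \<in> (*) (of_nat (n * m)) ` int_span S"
          using ty(2) S(2) by blast
        also have "\<dots> = int_span ((*) (of_nat (n * m)) ` S)"
          by (rule int_span_image_mult)
        also have "\<dots> \<subseteq> int_span ?G" by (rule zmod.span_mono) auto
        finally show ?thesis .
      qed
      ultimately show "x \<in> int_span ?G"
        unfolding ty(3) by (rule zmod.span_add)
    qed
  qed
  then show ?thesis
  proof (rule full_latticeI[rotated])
    show "finite ?G" using T(1) S(1) by auto
    fix x
    obtain k where k: "k > 0" "of_nat k * x \<in> F" using full_multiple[OF F] by blast
    then have "of_nat (n * k) * x \<in> L" using n(2)[OF k(2)] by (simp add: mult.assoc)
    then show "\<exists>n>0. of_nat n * x \<in> L" using n(1) k(1) by (intro exI[of _ "n * k"]) auto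
  qed
qed

lemma full_lat_mult:
  assumes L: "full_lattice scale L" and M: "full_lattice scale M"
  shows "full_lattice scale (lat_mult L M)"
proof -
  obtain S T where S: "finite S" "L = int_span S" and T: "finite T" "M = int_span T"
    using L M unfolding full_lattice_def by auto
  show ?thesis
  proof (rule full_latticeI)
    show "lat_mult L M = int_span {s * t | s t. s \<in> S \<and> t \<in> T}"
      unfolding S T by (rule lat_mult_int_span)
    show "finite {s * t | s t. s \<in> S \<and> t \<in> T}"
      using finite_image_set2[of "\<lambda>s. s \<in> S" "\<lambda>t. t \<in> T" "(*)"] S T by simp
    fix x
    obtain n where n: "n > 0" "of_nat n * x \<in> L" using full_multiple[OF L] by blast
    obtain m where m: "m > 0" "of_nat m * 1 \<in> M" using full_multiple[OF M] by blast
    have "of_nat (n * m) * x = (of_nat n * x) * (of_nat m * 1)" by (simp add: mult_ac)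
    also have "\<dots> \<in> lat_mult L M" by (rule lat_mult_mem) (use n m in auto)
    finally show "\<exists>n>0. of_nat n * x \<in> lat_mult L M" using n m by (intro exI[of _ "n * m"]) auto
  qed
qed

end

section \<open>Groups inside commutative semigroups\<close>

locale comm_sg =
  fixes S :: "'s set" and m :: "'s \<Rightarrow> 's \<Rightarrow> 's"
  assumes closed: "a \<in> S \<Longrightarrow> b \<in> S \<Longrightarrow> m a b \<in> S"
    and assoc: "a \<in> S \<Longrightarrow> b \<in> S \<Longrightarrow> c \<in> S \<Longrightarrow> m (m a b) c = m a (m b c)"
    and commute: "a \<in> S \<Longrightarrow> b \<in> S \<Longrightarrow> m a b = m b a"
begin

lemma left_commute: "a \<in> S \<Longrightarrow> b \<in> S \<Longrightarrow> c \<in> S \<Longrightarrow> m a (m b c) = m b (m a c)"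
  by (metis assoc commute)

text \<open>If \<open>a b = c\<close>, \<open>a c = a\<close> and likewise \<open>a b' = c'\<close>, \<open>a c' = a\<close>, then
  \<open>c c' = b a c' = b a = c\<close> and, by symmetry, \<open>c c' = c'\<close>. This is the uniqueness that the
  definite description needs.\<close>

lemma sg_unit_eq:
  assumes "a \<in> S" "b \<in> S" "c \<in> S" "m a b = c" "m a c = a"
  shows "sg_unit S m a = c"
  unfolding sg_unit_def
proof (rule the_equality)
  show "c \<in> S \<and> (\<exists>b\<in>S. m a b = c \<and> m a c = a)" using assms by blast
  fix c' assume "c' \<in> S \<and> (\<exists>b\<in>S. m a b = c' \<and> m a c' = a)"
  then obtain b' where b': "b' \<in> S" "c' \<in> S" "m a b' = c'" "m a c' = a" by blast
  have "m c c' = c"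
    using assms b' by (metis assoc commute)
  moreover have "m c c' = c'"
    using assms b' by (metis assoc commute)
  ultimately show "c' = c" by simp
qed

lemma carrier_sg_group:
  assumes "c \<in> S"
  shows "carrier (sg_group S m c) = {a \<in> S. m a c = a \<and> (\<exists>b\<in>S. m a b = c)}"
  using assms sg_unit_eq by (fastforce simp: sg_group_def sg_invertible_def)

lemma mult_sg_group [simp]: "monoid.mult (sg_group S m c) = m"
  and one_sg_group [simp]: "\<one>\<^bsub>sg_group S m c\<^esub> = c"
  by (simp_all add: sg_group_def)

text \<open>If \<open>x b = c\<close>, the inverse of \<open>x\<close> is \<open>b c\<close>; the factor \<open>c\<close> makes it absorb the unit.\<close>

lemma comm_group_sg_group:
  assumes c: "c \<in> S" "m c c = c"
  shows "comm_group (sg_group S m c)"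
proof (rule comm_groupI)
  let ?G = "sg_group S m c"
  fix x y
  assume x: "x \<in> carrier ?G" and y: "y \<in> carrier ?G"
  obtain b where b: "b \<in> S" "m x b = c" and x': "x \<in> S" "m x c = x"
    using x carrier_sg_group[OF c(1)] by auto
  obtain d where d: "d \<in> S" "m y d = c" and y': "y \<in> S" "m y c = y"
    using y carrier_sg_group[OF c(1)] by auto
  have "m (m x y) (m b d) = c"
    using b d x' y' c by (metis assoc closed left_commute)
  moreover have "m (m x y) c = m x y"
    using x' y' c by (metis assoc)
  ultimately show "x \<otimes>\<^bsub>?G\<^esub> y \<in> carrier ?G"
    using b d x' y' by (auto simp: carrier_sg_group[OF c(1)] closed)
  show "x \<otimes>\<^bsub>?G\<^esub> y = y \<otimes>\<^bsub>?G\<^esub> x"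
    using x' y' commute by simp
  show "\<one>\<^bsub>?G\<^esub> \<otimes>\<^bsub>?G\<^esub> x = x"
    using x' c commute by simp
  have "m (m b c) x = c" "m (m b c) c = m b c" "m b c \<in> S"
    using b x' c by (metis assoc commute, metis assoc, metis closed)
  then show "\<exists>y\<in>carrier ?G. y \<otimes>\<^bsub>?G\<^esub> x = \<one>\<^bsub>?G\<^esub>"
    using x'(1) by (intro bexI[of _ "m b c"]) (auto simp: carrier_sg_group[OF c(1)])
  fix z assume "z \<in> carrier ?G"
  then show "x \<otimes>\<^bsub>?G\<^esub> y \<otimes>\<^bsub>?G\<^esub> z = x \<otimes>\<^bsub>?G\<^esub> (y \<otimes>\<^bsub>?G\<^esub> z)"
    using x' y' assoc carrier_sg_group[OF c(1)] by simp
qed (use c carrier_sg_group in auto)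

text \<open>From \<open>x b = c\<close> follows \<open>(d x) (d b) = d c = d\<close>, so multiplication by \<open>d\<close> preserves
  invertibility. For an order \<open>d\<close> containing an order \<open>c\<close>, this is the extension of lattices.\<close>

lemma group_hom_sg_group:
  assumes c: "c \<in> S" "m c c = c" and d: "d \<in> S" "m d d = d" and dc: "m d c = d"
  shows "group_hom (sg_group S m c) (sg_group S m d) (m d)"
proof -
  have "m d \<in> hom (sg_group S m c) (sg_group S m d)"
  proof (rule homI)
    fix x assume "x \<in> carrier (sg_group S m c)"
    then obtain b where b: "b \<in> S" "m x b = c" and x: "x \<in> S" "m x c = x"
      using carrier_sg_group[OF c(1)] by auto
    have "m (m d x) (m d b) = d"
      using b x c d dc by (metis assoc closed left_commute)
    moreover have "m (m d x) d = m d x"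
      using x d by (metis assoc commute)
    ultimately show "m d x \<in> carrier (sg_group S m d)"
      using b x d by (auto simp: carrier_sg_group[OF d(1)] closed)
    fix y assume "y \<in> carrier (sg_group S m c)"
    then have "y \<in> S"
      using carrier_sg_group[OF c(1)] by auto
    then show "m d (x \<otimes>\<^bsub>sg_group S m c\<^esub> y) = m d x \<otimes>\<^bsub>sg_group S m d\<^esub> m d y"
      using x d by simp (metis assoc closed left_commute)
  qed
  then show ?thesis
    using comm_group_sg_group[OF c] comm_group_sg_group[OF d]
    by (intro group_hom.intro group_hom_axioms.intro comm_group.axioms(2))
qed

end

section \<open>The groups of invertible lattices and of their classes\<close>

context fin_dim_comm_rat_algebra
begin

abbreviation lattices :: "'a set set" where
  "lattices \<equiv> {L. full_lattice scale L}"

sublocale lat: comm_sg lattices lat_mult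
proof
  fix L M N assume "L \<in> lattices" "M \<in> lattices"
  then show "lat_mult L M \<in> lattices" by (simp add: full_lat_mult)
  assume "N \<in> lattices"
  then show "lat_mult (lat_mult L M) N = lat_mult L (lat_mult M N)"
    using \<open>L \<in> lattices\<close> \<open>M \<in> lattices\<close> by (simp add: lat_mult_assoc full_add_subgroup)
qed (rule lat_mult_commute)

lemma image_mult_compose: "(*) (a::'a) ` (*) b ` L = (*) (a * b) ` L"
  by (auto simp: image_image mult.assoc)

lemma image_mult_one: "(*) (1::'a) ` L = L"
  by auto

lemma lat_mult_image_right: "add_subgroup M \<Longrightarrow> lat_mult L ((*) a ` M) = (*) (a::'a) ` lat_mult L M"
  by (metis lat_mult_commute lat_mult_image_left)

lemma equiv_eps_rel: "equiv lattices (eps_rel scale)"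
proof (rule equivI)
  show "eps_rel scale \<subseteq> lattices \<times> lattices"
    unfolding eps_rel_def by auto
  show "refl_on lattices (eps_rel scale)"
    unfolding eps_rel_def by (auto intro!: refl_onI exI[of _ 1])
  show "sym (eps_rel scale)"
  proof (rule symI)
    fix L M assume "(L, M) \<in> eps_rel scale"
    then obtain a where a: "a dvd 1" "(*) a ` L = M" "L \<in> lattices" "M \<in> lattices"
      unfolding eps_rel_def by auto
    obtain b where b: "a * b = 1" "b dvd 1" using unit_inverse_exists[OF a(1)] .
    have "(*) b ` M = L"
      using image_mult_compose[of b a L] a(2) b(1) image_mult_one by (simp add: mult.commute)
    with a b show "(M, L) \<in> eps_rel scale"
      unfolding eps_rel_def by auto
  qed
  show "trans (eps_rel scale)"
  proof (rule transI)
    fix L M N assume "(L, M) \<in> eps_rel scale" "(M, N) \<in> eps_rel scale"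
    then obtain a b where "a dvd 1" "(*) a ` L = M" "b dvd 1" "(*) b ` M = N" "L \<in> lattices" "N \<in> lattices"
      unfolding eps_rel_def by auto
    moreover from this have "b * a dvd 1"
      by (metis mult_dvd_mono mult_1)
    ultimately show "(L, N) \<in> eps_rel scale"
      unfolding eps_rel_def using image_mult_compose[of b a L] by auto
  qed
qed

lemma eps_class_eq_iff:
  assumes "full_lattice scale L" "full_lattice scale M"
  shows "eps_class scale L = eps_class scale M \<longleftrightarrow> (\<exists>a. a dvd 1 \<and> (*) a ` L = M)"
proof -
  have "eps_class scale L = eps_class scale M \<longleftrightarrow> (L, M) \<in> eps_rel scale"
    unfolding eps_class_def using eq_equiv_class_iff[OF equiv_eps_rel] assms by simp
  then show ?thesis
    using assms unfolding eps_rel_def by auto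
qed

lemma mem_eps_class:
  "M \<in> eps_class scale L \<longleftrightarrow> full_lattice scale L \<and> full_lattice scale M \<and> (\<exists>a. a dvd 1 \<and> (*) a ` L = M)"
  unfolding eps_class_def eps_rel_def by auto

text \<open>Units can be pulled out of products, so all members of the union in the definition
  coincide.\<close>

lemma class_mult_eps_class:
  assumes L: "full_lattice scale L" and M: "full_lattice scale M"
  shows "class_mult scale (eps_class scale L) (eps_class scale M) = eps_class scale (lat_mult L M)"
proof -
  have "eps_class scale (lat_mult L' M') = eps_class scale (lat_mult L M)"
    if L': "L' \<in> eps_class scale L" and M': "M' \<in> eps_class scale M" for L' M'
  proof -
    obtain a where a: "a dvd 1" "(*) a ` L = L'"
      using L' unfolding mem_eps_class by blast
    obtain b where b: "b dvd 1" "(*) b ` M = M'"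
      using M' unfolding mem_eps_class by blast
    have full: "full_lattice scale L'" "full_lattice scale M'"
      using L' M' unfolding mem_eps_class by auto
    have "lat_mult L' M' = (*) b ` (*) a ` lat_mult L M"
      unfolding a(2)[symmetric] b(2)[symmetric]
      using L M by (simp only: lat_mult_image_left lat_mult_image_right full_add_subgroup)
    then have "lat_mult L' M' = (*) (a * b) ` lat_mult L M"
      by (simp only: image_mult_compose mult.commute[of b a])
    moreover have "a * b dvd 1"
      using mult_dvd_mono[OF a(1) b(1)] by simp
    ultimately show ?thesis
      using eps_class_eq_iff[of "lat_mult L M" "lat_mult L' M'"] full_lat_mult[OF L M]
        full_lat_mult[OF full] by auto
  qed
  moreover have "L \<in> eps_class scale L" "M \<in> eps_class scale M"
    using L M unfolding mem_eps_class by (auto intro!: exI[of _ 1])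
  ultimately show ?thesis
    unfolding class_mult_def by blast
qed

abbreviation lat_classes :: "'a set set set" where
  "lat_classes \<equiv> lattices // eps_rel scale"

lemma mem_lat_classes: "X \<in> lat_classes \<longleftrightarrow> (\<exists>L. full_lattice scale L \<and> X = eps_class scale L)"
  by (auto simp: quotient_def eps_class_def)

lemma eps_class_mem: "full_lattice scale L \<Longrightarrow> eps_class scale L \<in> lat_classes"
  unfolding mem_lat_classes by blast

sublocale cls: comm_sg lat_classes "class_mult scale"
proof
  fix X Y Z assume X: "X \<in> lat_classes" and Y: "Y \<in> lat_classes"
  then obtain L M where L: "full_lattice scale L" "X = eps_class scale L"
    and M: "full_lattice scale M" "Y = eps_class scale M"
    unfolding mem_lat_classes by blast
  then show "class_mult scale X Y \<in> lat_classes"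
    by (simp add: class_mult_eps_class eps_class_mem full_lat_mult)
  show "class_mult scale X Y = class_mult scale Y X"
    using L M class_mult_eps_class lat_mult_commute[of L M] by simp
  assume "Z \<in> lat_classes"
  then obtain N where "full_lattice scale N" "Z = eps_class scale N"
    unfolding mem_lat_classes by blast
  with L M show "class_mult scale (class_mult scale X Y) Z = class_mult scale X (class_mult scale Y Z)"
    by (simp add: class_mult_eps_class full_lat_mult lat_mult_assoc full_add_subgroup)
qed

lemma order_full: "is_order scale \<Lambda> \<Longrightarrow> full_lattice scale \<Lambda>"
  and order_one: "is_order scale \<Lambda> \<Longrightarrow> 1 \<in> \<Lambda>"
  unfolding is_order_def by auto

lemma order_add_subgroup: "is_order scale \<Lambda> \<Longrightarrow> add_subgroup \<Lambda>"
  using order_full full_add_subgroup by blast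

lemma order_mult: "is_order scale \<Lambda> \<Longrightarrow> x \<in> \<Lambda> \<Longrightarrow> y \<in> \<Lambda> \<Longrightarrow> x * y \<in> \<Lambda>"
  unfolding is_order_def by (meson lat_mult_mem subsetD)

lemma order_idem: "is_order scale \<Lambda> \<Longrightarrow> lat_mult \<Lambda> \<Lambda> = \<Lambda>"
  using lat_mult_mem[of _ \<Lambda> 1 \<Lambda>] unfolding is_order_def by fastforce

lemma lat_group_carrier:
  assumes "is_order scale \<Lambda>"
  shows "L \<in> carrier (lat_group scale \<Lambda>) \<longleftrightarrow>
    full_lattice scale L \<and> lat_mult L \<Lambda> = L \<and> (\<exists>M. full_lattice scale M \<and> lat_mult L M = \<Lambda>)"
  unfolding lat_group_def using lat.carrier_sg_group[of \<Lambda>] order_full[OF assms] by auto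

lemma mult_lat_group [simp]: "monoid.mult (lat_group scale \<Lambda>) = lat_mult"
  and one_lat_group [simp]: "\<one>\<^bsub>lat_group scale \<Lambda>\<^esub> = \<Lambda>"
  and mult_class_group [simp]: "monoid.mult (class_group scale \<Lambda>) = class_mult scale"
  and one_class_group [simp]: "\<one>\<^bsub>class_group scale \<Lambda>\<^esub> = eps_class scale \<Lambda>"
  by (simp_all add: lat_group_def class_group_def sg_group_def)

lemma comm_group_lat_group: "is_order scale \<Lambda> \<Longrightarrow> comm_group (lat_group scale \<Lambda>)"
  unfolding lat_group_def by (rule lat.comm_group_sg_group) (auto simp: order_full order_idem)

lemma comm_group_class_group: "is_order scale \<Lambda> \<Longrightarrow> comm_group (class_group scale \<Lambda>)"
  unfolding class_group_def
  by (rule cls.comm_group_sg_group) (auto simp: order_full order_idem eps_class_mem class_mult_eps_class)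

lemma lat_group_full: "is_order scale \<Lambda> \<Longrightarrow> L \<in> carrier (lat_group scale \<Lambda>) \<Longrightarrow> full_lattice scale L"
  and lat_group_mult_order: "is_order scale \<Lambda> \<Longrightarrow> L \<in> carrier (lat_group scale \<Lambda>) \<Longrightarrow> lat_mult L \<Lambda> = L"
  using lat_group_carrier by auto

lemma lat_group_mult_mem:
  "is_order scale \<Lambda> \<Longrightarrow> L \<in> carrier (lat_group scale \<Lambda>) \<Longrightarrow> x \<in> L \<Longrightarrow> y \<in> \<Lambda> \<Longrightarrow> x * y \<in> L"
  using lat_group_mult_order[of \<Lambda> L] lat_mult_mem[of x L y \<Lambda>] by simp

lemma lat_group_inverse:
  assumes "is_order scale \<Lambda>" "L \<in> carrier (lat_group scale \<Lambda>)"
  obtains M where "M \<in> carrier (lat_group scale \<Lambda>)" "lat_mult L M = \<Lambda>" "lat_mult M L = \<Lambda>"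
proof -
  interpret comm_group "lat_group scale \<Lambda>" by (rule comm_group_lat_group) fact
  show ?thesis
    using that[of "inv\<^bsub>lat_group scale \<Lambda>\<^esub> L"] assms(2) r_inv[of L] l_inv[of L] by simp
qed

lemma image_in_lat_group:
  assumes \<Lambda>: "is_order scale \<Lambda>" and L: "L \<in> carrier (lat_group scale \<Lambda>)" and a: "a dvd 1"
  shows "(*) a ` L \<in> carrier (lat_group scale \<Lambda>)"
proof -
  obtain M where M: "full_lattice scale M" "lat_mult L M = \<Lambda>" and L': "full_lattice scale L" "lat_mult L \<Lambda> = L"
    using L lat_group_carrier[OF \<Lambda>] by auto
  obtain b where b: "a * b = 1" "b dvd 1" using unit_inverse_exists[OF a] .
  have "lat_mult ((*) a ` L) ((*) b ` M) = (*) b ` (*) a ` lat_mult L M"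
    using M(1) L'(1) by (simp only: lat_mult_image_left lat_mult_image_right full_add_subgroup)
  also have "\<dots> = \<Lambda>"
    unfolding M(2) by (rule image_mult_unit_inverse) (simp add: b(1) mult.commute)
  finally have "lat_mult ((*) a ` L) ((*) b ` M) = \<Lambda>" .
  moreover have "lat_mult ((*) a ` L) \<Lambda> = (*) a ` L"
    using L' by (simp only: lat_mult_image_left full_add_subgroup)
  ultimately show ?thesis
    unfolding lat_group_carrier[OF \<Lambda>]
    using full_image[OF a L'(1)] full_image[OF b(2) M(1)] by blast
qed

text \<open>If the class of \<open>L\<close> is invertible, then \<open>L \<Lambda>\<close> agrees with \<open>L\<close> up to a unit of the
  algebra. As \<open>\<Lambda>\<close> is idempotent, \<open>L \<Lambda> = L\<close> follows, so that every member of an invertible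
  class is invertible already as a lattice.\<close>

lemma carrier_class_group:
  assumes \<Lambda>: "is_order scale \<Lambda>"
  shows "carrier (class_group scale \<Lambda>) = eps_class scale ` carrier (lat_group scale \<Lambda>)"
proof -
  note \<Lambda>f = order_full[OF \<Lambda>]
  have c: "eps_class scale \<Lambda> \<in> lat_classes" using \<Lambda>f mem_lat_classes by blast
  show ?thesis
  proof (intro equalityI subsetI)
    fix X assume "X \<in> eps_class scale ` carrier (lat_group scale \<Lambda>)"
    then obtain L M where L: "X = eps_class scale L" "full_lattice scale L" "lat_mult L \<Lambda> = L"
      and M: "full_lattice scale M" "lat_mult L M = \<Lambda>"
      using lat_group_carrier[OF \<Lambda>] by auto
    have "class_mult scale X (eps_class scale M) = eps_class scale \<Lambda>"
      using class_mult_eps_class[OF L(2) M(1)] L M by simp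
    moreover have "class_mult scale X (eps_class scale \<Lambda>) = X"
      using class_mult_eps_class[OF L(2) \<Lambda>f] L by simp
    moreover have "X \<in> lat_classes" "eps_class scale M \<in> lat_classes"
      using L M mem_lat_classes by blast+
    ultimately show "X \<in> carrier (class_group scale \<Lambda>)"
      unfolding class_group_def cls.carrier_sg_group[OF c] by blast
  next
    fix X assume "X \<in> carrier (class_group scale \<Lambda>)"
    then obtain L M where L: "X = eps_class scale L" "full_lattice scale L" and M: "full_lattice scale M"
      and "class_mult scale X (eps_class scale \<Lambda>) = X"
      and "class_mult scale X (eps_class scale M) = eps_class scale \<Lambda>"
      unfolding class_group_def cls.carrier_sg_group[OF c] by (auto simp: mem_lat_classes)
    then have "eps_class scale (lat_mult L \<Lambda>) = eps_class scale L"
      and "eps_class scale (lat_mult L M) = eps_class scale \<Lambda>"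
      using class_mult_eps_class L(2) M \<Lambda>f by auto
    then obtain u v where u: "u dvd 1" "(*) u ` lat_mult L \<Lambda> = L" and v: "v dvd 1" "(*) v ` lat_mult L M = \<Lambda>"
      using eps_class_eq_iff[OF full_lat_mult[OF L(2) \<Lambda>f] L(2)]
        eps_class_eq_iff[OF full_lat_mult[OF L(2) M] \<Lambda>f] by (elim iffE) blast
    \<comment> \<open>a lattice that equals \<open>L \<Lambda>\<close> up to a unit equals \<open>L \<Lambda>\<close>, because \<open>\<Lambda>\<close> is idempotent\<close>
    have "lat_mult L \<Lambda> = lat_mult ((*) u ` lat_mult L \<Lambda>) \<Lambda>" using u(2) by simp
    also have "\<dots> = (*) u ` lat_mult L (lat_mult \<Lambda> \<Lambda>)"
      using L(2) \<Lambda>f by (simp add: lat_mult_image_left lat_mult_assoc full_add_subgroup add_subgroup_lat_mult)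
    also have "\<dots> = L" using u order_idem[OF \<Lambda>] by simp
    finally have "lat_mult L \<Lambda> = L" .
    moreover have "lat_mult L ((*) v ` M) = \<Lambda>"
      using v M by (simp add: lat_mult_image_right full_add_subgroup)
    ultimately have "L \<in> carrier (lat_group scale \<Lambda>)"
      unfolding lat_group_carrier[OF \<Lambda>] using L(2) full_image[OF v(1) M] by blast
    then show "X \<in> eps_class scale ` carrier (lat_group scale \<Lambda>)" using L by blast
  qed
qed

lemma lat_mult_suborder:
  assumes "is_order scale \<Lambda>1" "is_order scale \<Lambda>2" "\<Lambda>2 \<subseteq> \<Lambda>1"
  shows "lat_mult \<Lambda>1 \<Lambda>2 = \<Lambda>1"
proof
  show "lat_mult \<Lambda>1 \<Lambda>2 \<subseteq> \<Lambda>1"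
    using lat_mult_mono[of \<Lambda>1 \<Lambda>1 \<Lambda>2 \<Lambda>1] order_idem[OF assms(1)] assms(3) by auto
  show "\<Lambda>1 \<subseteq> lat_mult \<Lambda>1 \<Lambda>2"
    using lat_mult_mem[of _ \<Lambda>1 1 \<Lambda>2] order_one[OF assms(2)] by fastforce
qed

lemma group_hom_lat_group:
  assumes "is_order scale \<Lambda>1" "is_order scale \<Lambda>2" "\<Lambda>2 \<subseteq> \<Lambda>1"
  shows "group_hom (lat_group scale \<Lambda>2) (lat_group scale \<Lambda>1) (lat_mult \<Lambda>1)"
  unfolding lat_group_def
  using assms by (intro lat.group_hom_sg_group) (simp_all add: order_full order_idem lat_mult_suborder)

lemma group_hom_class_group:
  assumes "is_order scale \<Lambda>1" "is_order scale \<Lambda>2" "\<Lambda>2 \<subseteq> \<Lambda>1"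
  shows "group_hom (class_group scale \<Lambda>2) (class_group scale \<Lambda>1) (class_mult scale (eps_class scale \<Lambda>1))"
  unfolding class_group_def
  using assms by (intro cls.group_hom_sg_group)
    (simp_all add: order_full order_idem lat_mult_suborder class_mult_eps_class eps_class_mem)

lemma group_hom_eps_class:
  assumes "is_order scale \<Lambda>"
  shows "group_hom (lat_group scale \<Lambda>) (class_group scale \<Lambda>) (eps_class scale)"
proof -
  have "eps_class scale \<in> hom (lat_group scale \<Lambda>) (class_group scale \<Lambda>)"
    using carrier_class_group[OF assms]
    by (intro homI) (auto simp: class_mult_eps_class lat_group_full[OF assms])
  then show ?thesis
    using comm_group_lat_group[OF assms] comm_group_class_group[OF assms]
    by (intro group_hom.intro group_hom_axioms.intro comm_group.axioms(2))
qed

end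

section \<open>Maximal ideals of an order\<close>

lemma add_subgroup_sum:
  assumes "add_subgroup L" "add_subgroup M"
  shows "add_subgroup {x + y | x y. x \<in> L \<and> y \<in> M}"
proof (rule add_subgroupI)
  show "0 \<in> {x + y | x y. x \<in> L \<and> y \<in> M}"
    using assms zmod.subspace_0 by force
  fix u v assume "u \<in> {x + y | x y. x \<in> L \<and> y \<in> M}" "v \<in> {x + y | x y. x \<in> L \<and> y \<in> M}"
  then obtain x y x' y' where "u = x + y" "v = x' + y'" "x \<in> L" "y \<in> M" "x' \<in> L" "y' \<in> M" by blast
  moreover from this have "u - v = (x - x') + (y - y')" by simp
  ultimately show "u - v \<in> {x + y | x y. x \<in> L \<and> y \<in> M}"
    using zmod.subspace_diff[OF assms(1), of x x'] zmod.subspace_diff[OF assms(2), of y y'] by blast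
qed

text \<open>Such a group is determined by the representatives of \<open>F\<close> modulo \<open>F'\<close> that it contains.\<close>

lemma finite_intermediate_subgroups:
  assumes T: "finite T" "\<And>x. x \<in> F \<Longrightarrow> \<exists>t\<in>T. x - t \<in> F'"
  shows "finite {H. add_subgroup H \<and> F' \<subseteq> H \<and> H \<subseteq> F}"
proof (rule finite_subset)
  let ?f = "\<lambda>K. {x \<in> F. \<exists>t\<in>K. x - t \<in> F'}"
  show "{H. add_subgroup H \<and> F' \<subseteq> H \<and> H \<subseteq> F} \<subseteq> ?f ` Pow T"
  proof (rule subsetI)
    fix H assume "H \<in> {H. add_subgroup H \<and> F' \<subseteq> H \<and> H \<subseteq> F}"
    then have H: "add_subgroup H" "F' \<subseteq> H" "H \<subseteq> F" by simp_all
    have "x \<in> ?f (H \<inter> T)" if x: "x \<in> H" for x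
    proof -
      obtain t where t: "t \<in> T" "x - t \<in> F'" using T(2) H(3) x by blast
      have "x - (x - t) \<in> H"
        by (rule zmod.subspace_diff[OF H(1) x]) (use H(2) t(2) in blast)
      then have "t \<in> H \<inter> T" using t(1) by simp
      then show ?thesis using t(2) H(3) x by blast
    qed
    moreover have "x \<in> H" if x: "x \<in> ?f (H \<inter> T)" for x
    proof -
      obtain t where t: "t \<in> H" "x - t \<in> F'" using x by blast
      have "(x - t) + t \<in> H"
        by (rule zmod.subspace_add[OF H(1) _ t(1)]) (use H(2) t(2) in blast)
      then show ?thesis by simp
    qed
    ultimately have "H = ?f (H \<inter> T)" by (intro subset_antisym subsetI)
    then show "H \<in> ?f ` Pow T" by (rule image_eqI) simp
  qed
qed (simp add: T(1))

definition ideal_in :: "'a::comm_ring_1 set \<Rightarrow> 'a set \<Rightarrow> bool" where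
  "ideal_in \<Lambda> I \<longleftrightarrow> add_subgroup I \<and> I \<subseteq> \<Lambda> \<and> (\<forall>x\<in>I. \<forall>y\<in>\<Lambda>. x * y \<in> I)"

text \<open>Maximality in the form that the residue ring is a field, which is how it enters the
  arguments.\<close>

definition maximal_ideal_in :: "'a::comm_ring_1 set \<Rightarrow> 'a set \<Rightarrow> bool" where
  "maximal_ideal_in \<Lambda> I \<longleftrightarrow> ideal_in \<Lambda> I \<and> 1 \<notin> I \<and> (\<forall>d\<in>\<Lambda> - I. \<exists>d'\<in>\<Lambda>. d * d' - 1 \<in> I)"

lemma ideal_inD:
  assumes "ideal_in \<Lambda> I"
  shows "add_subgroup I" "I \<subseteq> \<Lambda>" "\<And>x y. x \<in> I \<Longrightarrow> y \<in> \<Lambda> \<Longrightarrow> x * y \<in> I"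
    "\<And>x y. x \<in> I \<Longrightarrow> y \<in> \<Lambda> \<Longrightarrow> y * x \<in> I"
  using assms by (auto simp: ideal_in_def mult.commute)

lemma maximal_ideal_in_prime:
  assumes m: "maximal_ideal_in \<Lambda> I" and c: "c \<in> \<Lambda> - I" and d: "d \<in> \<Lambda> - I"
  shows "c * d \<notin> I"
proof
  assume cd: "c * d \<in> I"
  have I: "ideal_in \<Lambda> I" using m by (simp add: maximal_ideal_in_def)
  obtain d' where d': "d' \<in> \<Lambda>" "d * d' - 1 \<in> I" using m d by (auto simp: maximal_ideal_in_def)
  have "c * d * d' - c * (d * d' - 1) \<in> I"
    by (rule zmod.subspace_diff[OF ideal_inD(1)[OF I] ideal_inD(3)[OF I cd d'(1)] ideal_inD(4)[OF I d'(2)]])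
      (use c in simp)
  then show False using c by (simp add: algebra_simps)
qed

text \<open>For each \<open>I\<close> there is an element of \<open>I - J\<close>; the product of these elements lies in every
  \<open>I\<close>, and outside \<open>J\<close> because \<open>J\<close> is prime.\<close>

lemma maximal_ideals_independent:
  assumes "finite \<M>" "\<And>I. I \<in> \<M> \<Longrightarrow> maximal_ideal_in \<Lambda> I" "maximal_ideal_in \<Lambda> J" "J \<notin> \<M>" "1 \<in> \<Lambda>"
  shows "\<exists>d\<in>\<Lambda> - J. \<forall>I\<in>\<M>. d \<in> I"
  using assms
proof (induction \<M> rule: finite_induct)
  case empty
  then show ?case by (auto simp: maximal_ideal_in_def)
next
  case (insert I \<M>)
  then obtain d where d: "d \<in> \<Lambda> - J" "\<forall>I\<in>\<M>. d \<in> I" by auto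
  have I: "maximal_ideal_in \<Lambda> I" and J: "maximal_ideal_in \<Lambda> J" using insert.prems by auto
  then have Ii: "ideal_in \<Lambda> I" and Ji: "ideal_in \<Lambda> J" by (auto simp: maximal_ideal_in_def)
  have "\<not> I \<subseteq> J"
  proof
    assume sub: "I \<subseteq> J"
    then obtain x where x: "x \<in> J" "x \<notin> I" using insert.prems by auto
    then have "x \<in> \<Lambda> - I" using ideal_inD(2)[OF Ji] by auto
    then obtain x' where x': "x' \<in> \<Lambda>" "x * x' - 1 \<in> I"
      using I by (auto simp: maximal_ideal_in_def)
    have "x * x' - (x * x' - 1) \<in> J"
      by (rule zmod.subspace_diff[OF ideal_inD(1)[OF Ji] ideal_inD(3)[OF Ji x(1) x'(1)]])
        (use sub x' in blast)
    then show False using J by (simp add: maximal_ideal_in_def)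
  qed
  then obtain c where c: "c \<in> I" "c \<notin> J" by auto
  then have "c \<in> \<Lambda> - J" using ideal_inD(2)[OF Ii] by auto
  then have "c * d \<notin> J" using maximal_ideal_in_prime[OF J _ d(1)] by auto
  moreover have "c * d \<in> I" "c * d \<in> \<Lambda>"
    using ideal_inD(3)[OF Ii c(1), of d] d(1) ideal_inD(2)[OF Ii] by auto
  moreover have "c * d \<in> I'" if I': "I' \<in> \<M>" for I'
  proof -
    have "ideal_in \<Lambda> I'" using insert.prems(1) I' by (simp add: maximal_ideal_in_def)
    then show ?thesis using ideal_inD(4)[of \<Lambda> I' d c] d(2) I' c(1) ideal_inD(2)[OF Ii] by auto
  qed
  ultimately show ?case by (intro bexI[of _ "c * d"]) auto
qed

text \<open>The ideals are treated one at a time. If \<open>x + w\<close> avoids the earlier \<open>V I\<close> but lies in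
  \<open>V J\<close>, and \<open>x + w0\<close> avoids \<open>V J\<close>, take \<open>d\<close> outside \<open>J\<close> and inside all earlier \<open>I\<close> and
  replace \<open>w\<close> by \<open>w + d (w0 - w)\<close>. This changes nothing modulo the earlier \<open>V I\<close>, since
  \<open>I W \<subseteq> V I\<close>; and it leaves \<open>V J\<close>, since \<open>d\<close> is invertible modulo \<open>J\<close> and \<open>J W \<subseteq> V J\<close>.\<close>

lemma avoid_submodules:
  assumes fin: "finite \<M>" and M: "\<And>I. I \<in> \<M> \<Longrightarrow> maximal_ideal_in \<Lambda> I" and one: "1 \<in> \<Lambda>"
    and W: "add_subgroup W" "\<And>d w. d \<in> \<Lambda> \<Longrightarrow> w \<in> W \<Longrightarrow> d * w \<in> W"
    and V: "\<And>I. I \<in> \<M> \<Longrightarrow> add_subgroup (V I)"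
      "\<And>I d v. I \<in> \<M> \<Longrightarrow> d \<in> \<Lambda> \<Longrightarrow> v \<in> V I \<Longrightarrow> d * v \<in> V I"
    and IW: "\<And>I d w. I \<in> \<M> \<Longrightarrow> d \<in> I \<Longrightarrow> w \<in> W \<Longrightarrow> d * w \<in> V I"
    and local: "\<And>I. I \<in> \<M> \<Longrightarrow> \<exists>w\<in>W. x + w \<notin> V I"
  shows "\<exists>w\<in>W. \<forall>I\<in>\<M>. x + w \<notin> V I"
  using fin M V IW local
proof (induction \<M> rule: finite_induct)
  case empty
  then show ?case using zmod.subspace_0[OF W(1)] by auto
next
  case (insert J \<M>)
  then obtain w where w: "w \<in> W" "\<forall>I\<in>\<M>. x + w \<notin> V I" by auto
  have J: "maximal_ideal_in \<Lambda> J" using insert.prems by auto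
  then have Ji: "ideal_in \<Lambda> J" by (simp add: maximal_ideal_in_def)
  have VJ: "add_subgroup (V J)" using insert.prems by auto
  show ?case
  proof (cases "x + w \<in> V J")
    case False
    then show ?thesis using w by auto
  next
    case True
    obtain w0 where w0: "w0 \<in> W" "x + w0 \<notin> V J" using insert.prems(5)[of J] by auto
    obtain d where d: "d \<in> \<Lambda> - J" "\<forall>I\<in>\<M>. d \<in> I"
      using maximal_ideals_independent[OF insert.hyps(1) _ J insert.hyps(2) one] insert.prems by blast
    obtain d' where d': "d' \<in> \<Lambda>" "d * d' - 1 \<in> J"
      using J d by (auto simp: maximal_ideal_in_def)
    have diff: "w0 - w \<in> W" using w0 w W(1) by (auto intro: zmod.subspace_diff)
    have "x + (w + d * (w0 - w)) \<notin> V I" if I: "I \<in> \<M>" for I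
    proof
      assume "x + (w + d * (w0 - w)) \<in> V I"
      moreover have "d * (w0 - w) \<in> V I"
        using insert.prems(4)[of I d "w0 - w"] d I diff by auto
      ultimately have "x + (w + d * (w0 - w)) - d * (w0 - w) \<in> V I"
        by (rule zmod.subspace_diff[rotated]) (use insert.prems(2)[of I] I in simp)
      then show False using w I by (simp add: algebra_simps)
    qed
    moreover have "x + (w + d * (w0 - w)) \<notin> V J"
    proof
      assume "x + (w + d * (w0 - w)) \<in> V J"
      then have "x + (w + d * (w0 - w)) - (x + w) \<in> V J"
        by (rule zmod.subspace_diff[OF VJ _ True])
      then have "d * (w0 - w) \<in> V J" by (simp add: algebra_simps)
      then have "d' * (d * (w0 - w)) \<in> V J" using insert.prems(3)[of J] d' by auto
      moreover have "(d * d' - 1) * (w0 - w) \<in> V J"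
        using insert.prems(4)[of J] d' diff by auto
      ultimately have "d' * (d * (w0 - w)) - (d * d' - 1) * (w0 - w) \<in> V J"
        by (rule zmod.subspace_diff[OF VJ])
      then have "x + w + (d' * (d * (w0 - w)) - (d * d' - 1) * (w0 - w)) \<in> V J"
        by (rule zmod.subspace_add[OF VJ True])
      then show False using w0 by (simp add: algebra_simps)
    qed
    moreover have "w + d * (w0 - w) \<in> W"
      by (rule zmod.subspace_add[OF W(1) w(1) W(2)[OF _ diff]]) (use d in simp)
    ultimately show ?thesis by (intro bexI[of _ "w + d * (w0 - w)"]) auto
  qed
qed

context fin_dim_comm_rat_algebra
begin

text \<open>Such an ideal lies between \<open>N \<Lambda>\<close> and \<open>\<Lambda>\<close>.\<close>

lemma finite_ideals_containing:
  assumes \<Lambda>: "is_order scale \<Lambda>" and N: "N > 0"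
  shows "finite {I. ideal_in \<Lambda> I \<and> of_nat N \<in> I}"
proof -
  obtain T where T: "finite T" "T \<subseteq> \<Lambda>" "\<And>x. x \<in> \<Lambda> \<Longrightarrow> \<exists>t\<in>T. \<exists>y\<in>\<Lambda>. x = t + of_nat N * y"
    by (rule finite_residues[OF order_full[OF \<Lambda>] N]) (rule that)
  have "finite {H. add_subgroup H \<and> (*) (of_nat N) ` \<Lambda> \<subseteq> H \<and> H \<subseteq> \<Lambda>}"
    using T(1)
  proof (rule finite_intermediate_subgroups)
    fix x assume "x \<in> \<Lambda>"
    then obtain t y where t: "t \<in> T" "y \<in> \<Lambda>" "x = t + of_nat N * y" using T(3) by blast
    then have "x - t = of_nat N * y" by simp
    then show "\<exists>t\<in>T. x - t \<in> (*) (of_nat N) ` \<Lambda>" using t(1,2) by blast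
  qed
  moreover have "{I. ideal_in \<Lambda> I \<and> of_nat N \<in> I}
      \<subseteq> {H. add_subgroup H \<and> (*) (of_nat N) ` \<Lambda> \<subseteq> H \<and> H \<subseteq> \<Lambda>}"
  proof (rule subsetI)
    fix I assume "I \<in> {I. ideal_in \<Lambda> I \<and> of_nat N \<in> I}"
    then have I: "ideal_in \<Lambda> I" "of_nat N \<in> I" by simp_all
    have "(*) (of_nat N) ` \<Lambda> \<subseteq> I"
      using ideal_inD(3)[OF I] by (rule image_subsetI)
    then show "I \<in> {H. add_subgroup H \<and> (*) (of_nat N) ` \<Lambda> \<subseteq> H \<and> H \<subseteq> \<Lambda>}"
      using ideal_inD(1,2)[OF I(1)] by (intro CollectI conjI)
  qed
  ultimately show ?thesis
    by (rule rev_finite_subset)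
qed

text \<open>Only finitely many ideals contain \<open>N\<close>, so a largest proper one above \<open>J\<close> exists by
  finiteness.\<close>

lemma maximal_ideal_exists:
  assumes \<Lambda>: "is_order scale \<Lambda>" and N: "N > 0"
    and J: "ideal_in \<Lambda> J" "of_nat N \<in> J" "1 \<notin> J"
  obtains I where "maximal_ideal_in \<Lambda> I" "J \<subseteq> I"
proof -
  define X where "X = {I. ideal_in \<Lambda> I \<and> of_nat N \<in> I \<and> 1 \<notin> I \<and> J \<subseteq> I}"
  have "finite X"
    unfolding X_def by (rule rev_finite_subset[OF finite_ideals_containing[OF \<Lambda> N]]) auto
  moreover have "J \<in> X" using J by (auto simp: X_def)
  ultimately have "\<exists>I\<in>X. J \<subseteq> I \<and> (\<forall>I'\<in>X. I \<subseteq> I' \<longrightarrow> I = I')"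
    by (rule finite_has_maximal2)
  then obtain I where "I \<in> X" and max: "\<forall>I'\<in>X. I \<subseteq> I' \<longrightarrow> I = I'"
    by (elim bexE conjE)
  then have I: "ideal_in \<Lambda> I" "of_nat N \<in> I" "1 \<notin> I" "J \<subseteq> I" by (auto simp: X_def)
  note Ii = I(1)
  have "\<exists>d'\<in>\<Lambda>. d * d' - 1 \<in> I" if d: "d \<in> \<Lambda> - I" for d
  proof -
    let ?K = "{x + y | x y. x \<in> I \<and> y \<in> (*) d ` \<Lambda>}"
    have sub: "add_subgroup ?K"
      by (intro add_subgroup_sum add_subgroup_image_mult ideal_inD(1)[OF Ii] order_add_subgroup[OF \<Lambda>])
    have 0: "0 \<in> I" "0 \<in> \<Lambda>"
      using zmod.subspace_0 ideal_inD(1)[OF Ii] order_add_subgroup[OF \<Lambda>] by auto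
    have IK: "I \<subseteq> ?K" using 0 by force
    have "d \<in> ?K" using 0 order_one[OF \<Lambda>] by force
    have "(x + d * y) * z \<in> ?K" if "x \<in> I" "y \<in> \<Lambda>" "z \<in> \<Lambda>" for x y z
      using that ideal_inD(3)[OF Ii, of x z] order_mult[OF \<Lambda>, of y z]
      by (auto simp: distrib_right mult.assoc)
    moreover have "?K \<subseteq> \<Lambda>"
      using d ideal_inD(2)[OF Ii] order_mult[OF \<Lambda>] zmod.subspace_add[OF order_add_subgroup[OF \<Lambda>]]
      by auto
    ultimately have "ideal_in \<Lambda> ?K" using sub by (auto simp: ideal_in_def)
    \<comment> \<open>\<open>I + d \<Lambda>\<close> is strictly larger than \<open>I\<close>, so it is not proper\<close>
    then have "1 \<in> ?K"
      using max[rule_format, of ?K] IK I d \<open>d \<in> ?K\<close> unfolding X_def by blast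
    then obtain x y where xy: "x \<in> I" "y \<in> \<Lambda>" "1 = x + d * y" by auto
    then have "d * y - 1 = - x" by (simp add: algebra_simps)
    also have "- x \<in> I"
      by (rule zmod.subspace_neg[OF ideal_inD(1)[OF Ii] xy(1)])
    finally show ?thesis
      using xy(2) by blast
  qed
  then have "maximal_ideal_in \<Lambda> I" using I by (simp add: maximal_ideal_in_def)
  then show ?thesis using that I by blast
qed

text \<open>Invertible lattices are principal modulo \<open>N\<close>. For a maximal ideal \<open>I\<close> containing \<open>N\<close>,
  \<open>L\<close> is not contained in \<open>I L\<close>, because \<open>L M = \<Lambda>\<close> while \<open>I L M = I\<close> is proper. Hence some
  \<open>a \<in> L\<close> avoids \<open>I L\<close> for all these \<open>I\<close> at once. If \<open>a M + N \<Lambda>\<close> were proper, it would lie in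
  such an \<open>I\<close>, and then \<open>a \<in> a M L \<subseteq> I L\<close>.\<close>

lemma invertible_generator_mod:
  assumes \<Lambda>: "is_order scale \<Lambda>" and N: "N > 0"
    and L: "L \<in> carrier (lat_group scale \<Lambda>)" and M: "M \<in> carrier (lat_group scale \<Lambda>)"
    and LM: "lat_mult L M = \<Lambda>"
  obtains a \<mu> l where "a \<in> L" "\<mu> \<in> M" "l \<in> \<Lambda>" "a * \<mu> + of_nat N * l = 1"
proof -
  define \<M> where "\<M> = {I. maximal_ideal_in \<Lambda> I \<and> of_nat N \<in> I}"
  have fin: "finite \<M>"
    unfolding \<M>_def by (rule rev_finite_subset[OF finite_ideals_containing[OF \<Lambda> N]])
      (auto simp: maximal_ideal_in_def)
  note sub = full_add_subgroup[OF lat_group_full[OF \<Lambda> L]] full_add_subgroup[OF lat_group_full[OF \<Lambda> M]]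
  have ideal: "ideal_in \<Lambda> I" "1 \<notin> I" if "I \<in> \<M>" for I
    using that by (auto simp: \<M>_def maximal_ideal_in_def)
  have IL: "lat_mult (lat_mult I L) M \<subseteq> I" if I: "I \<in> \<M>" for I
  proof -
    have "lat_mult (lat_mult I L) M = lat_mult I \<Lambda>"
      using lat_mult_assoc[OF ideal_inD(1)[OF ideal(1)[OF I]] sub] LM by simp
    also have "\<dots> \<subseteq> I"
      using ideal_inD(1,3)[OF ideal(1)[OF I]] by (rule lat_mult_subset)
    finally show ?thesis .
  qed
  have "\<exists>w\<in>L. \<forall>I\<in>\<M>. 0 + w \<notin> lat_mult I L"
  proof (rule avoid_submodules[OF fin, where \<Lambda> = \<Lambda>])
    fix I assume I: "I \<in> \<M>"
    note Ii = ideal(1)[OF I]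
    show "add_subgroup (lat_mult I L)" by (rule add_subgroup_lat_mult[OF ideal_inD(1)[OF Ii]])
    show "d * w \<in> lat_mult I L" if "d \<in> I" "w \<in> L" for d w
      using that by (rule lat_mult_mem)
    show "d * v \<in> lat_mult I L" if d: "d \<in> \<Lambda>" and v: "v \<in> lat_mult I L" for d v
    proof -
      have "lat_mult I L \<subseteq> {v. d * v \<in> lat_mult I L}"
        using ideal_inD(4)[OF Ii _ d]
        by (intro lat_mult_subset add_subgroup_vimage_mult add_subgroup_lat_mult ideal_inD(1)[OF Ii])
          (auto simp: mult.assoc[symmetric] intro: lat_mult_mem)
      then show ?thesis using v by auto
    qed
    show "\<exists>w\<in>L. 0 + w \<notin> lat_mult I L"
    proof (rule ccontr)
      assume "\<not> ?thesis"
      then have "L \<subseteq> lat_mult I L" by auto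
      then have "lat_mult L M \<subseteq> lat_mult (lat_mult I L) M" by (intro lat_mult_mono) auto
      then show False using LM IL[OF I] order_one[OF \<Lambda>] ideal(2)[OF I] by auto
    qed
  next
    show "d * w \<in> L" if "d \<in> \<Lambda>" "w \<in> L" for d w
      using lat_group_mult_mem[OF \<Lambda> L, of w d] that by (simp add: mult.commute)
  qed (use sub order_one[OF \<Lambda>] in \<open>auto simp: \<M>_def\<close>)
  then obtain a where a: "a \<in> L" "\<And>I. I \<in> \<M> \<Longrightarrow> a \<notin> lat_mult I L" by auto
  define J where "J = {x + y | x y. x \<in> (*) a ` M \<and> y \<in> (*) (of_nat N) ` \<Lambda>}"
  have Jsub: "add_subgroup J"
    unfolding J_def by (intro add_subgroup_sum add_subgroup_image_mult sub order_add_subgroup[OF \<Lambda>])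
  have aM: "a * \<mu> \<in> \<Lambda>" if "\<mu> \<in> M" for \<mu>
    using lat_mult_mem[OF a(1) that] LM by simp
  have "J \<subseteq> \<Lambda>"
    unfolding J_def using aM of_nat_mult_mem zmod.subspace_add order_add_subgroup[OF \<Lambda>] by fastforce
  moreover have "(a * \<mu> + of_nat N * l) * z \<in> J" if "\<mu> \<in> M" "l \<in> \<Lambda>" "z \<in> \<Lambda>" for \<mu> l z
    unfolding J_def using that lat_group_mult_mem[OF \<Lambda> M, of \<mu> z] order_mult[OF \<Lambda>, of l z]
    by (auto simp: distrib_right mult.assoc)
  ultimately have J: "ideal_in \<Lambda> J"
    using Jsub by (auto simp: ideal_in_def J_def)
  have 0: "0 \<in> M" "0 \<in> \<Lambda>" using zmod.subspace_0 sub order_add_subgroup[OF \<Lambda>] by auto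
  have NJ: "of_nat N \<in> J"
    unfolding J_def using 0 order_one[OF \<Lambda>] by force
  have "1 \<in> J"
  proof (rule ccontr)
    assume "1 \<notin> J"
    then obtain I where I: "maximal_ideal_in \<Lambda> I" "J \<subseteq> I"
      by (rule maximal_ideal_exists[OF \<Lambda> N J NJ]) (rule that)
    then have IM: "I \<in> \<M>" using NJ by (auto simp: \<M>_def)
    have aI: "a * \<mu> \<in> I" if "\<mu> \<in> M" for \<mu>
      using I(2) 0 that unfolding J_def by force
    note Isub = add_subgroup_lat_mult[OF ideal_inD(1)[OF ideal(1)[OF IM]]]
    \<comment> \<open>\<open>a \<in> a \<Lambda> = a M L \<subseteq> I L\<close>\<close>
    have "lat_mult M L \<subseteq> {x. a * x \<in> lat_mult I L}"
      using aI by (intro lat_mult_subset add_subgroup_vimage_mult Isub)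
        (auto simp: mult.assoc[symmetric] intro: lat_mult_mem)
    then have "a * 1 \<in> lat_mult I L"
      using LM order_one[OF \<Lambda>] lat_mult_commute[of L M] by auto
    then show False using a(2)[OF IM] by simp
  qed
  then obtain \<mu> l where "\<mu> \<in> M" "l \<in> \<Lambda>" "1 = a * \<mu> + of_nat N * l" unfolding J_def by auto
  then show ?thesis using that a(1) by metis
qed

text \<open>A unit modulo \<open>C\<close> becomes a unit modulo \<open>N\<close> after a change by an element of \<open>C\<close>: a
  maximal ideal that contains \<open>b + C\<close> contains \<open>b\<close> and \<open>C\<close>, hence \<open>1\<close>, so the coset \<open>b + C\<close>
  can avoid all maximal ideals containing \<open>N\<close>.\<close>

lemma unit_lift_mod:
  assumes \<Lambda>: "is_order scale \<Lambda>" and N: "N > 0" and C: "ideal_in \<Lambda> C"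
    and b: "b \<in> \<Lambda>" "b' \<in> \<Lambda>" "b * b' - 1 \<in> C"
  obtains c y l where "c \<in> C" "y \<in> \<Lambda>" "l \<in> \<Lambda>" "(b + c) * y + of_nat N * l = 1"
proof -
  define \<M> where "\<M> = {I. maximal_ideal_in \<Lambda> I \<and> of_nat N \<in> I}"
  have fin: "finite \<M>"
    unfolding \<M>_def by (rule rev_finite_subset[OF finite_ideals_containing[OF \<Lambda> N]])
      (auto simp: maximal_ideal_in_def)
  have ideal: "ideal_in \<Lambda> I" "1 \<notin> I" if "I \<in> \<M>" for I
    using that by (auto simp: \<M>_def maximal_ideal_in_def)
  have "\<exists>w\<in>C. \<forall>I\<in>\<M>. b + w \<notin> I"
  proof (rule avoid_submodules[OF fin, where \<Lambda> = \<Lambda>])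
    fix I assume I: "I \<in> \<M>"
    note Ii = ideal(1)[OF I]
    show "\<exists>w\<in>C. b + w \<notin> I"
    proof (rule ccontr)
      assume contra: "\<not> ?thesis"
      then have bI: "b \<in> I" using zmod.subspace_0[OF ideal_inD(1)[OF C]] by force
      have "b + (b * b' - 1) \<in> I" using contra b by auto
      then have "b + (b * b' - 1) - b \<in> I" 
        by (rule zmod.subspace_diff[OF ideal_inD(1)[OF Ii] _ bI])
      then have "b * b' - (b + (b * b' - 1) - b) \<in> I"
        by (rule zmod.subspace_diff[OF ideal_inD(1)[OF Ii] ideal_inD(3)[OF Ii bI b(2)]])
      then show False using ideal(2)[OF I] by simp
    qed
    show "d * w \<in> I" if "d \<in> I" "w \<in> C" for d w
      using that ideal_inD(3)[OF Ii] ideal_inD(2)[OF C] by blast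
    show "d * v \<in> I" if "d \<in> \<Lambda>" "v \<in> I" for d v
      using that ideal_inD(4)[OF Ii] by blast
  qed (use ideal_inD[OF C] order_one[OF \<Lambda>] in \<open>auto simp: \<M>_def ideal_inD maximal_ideal_in_def\<close>)
  then obtain c where c: "c \<in> C" "\<And>I. I \<in> \<M> \<Longrightarrow> b + c \<notin> I" by auto
  have bc: "b + c \<in> \<Lambda>"
    using b(1) c(1) ideal_inD(2)[OF C] order_add_subgroup[OF \<Lambda>] by (auto intro: zmod.subspace_add)
  define J where "J = {x + y | x y. x \<in> (*) (b + c) ` \<Lambda> \<and> y \<in> (*) (of_nat N) ` \<Lambda>}"
  have Jsub: "add_subgroup J"
    unfolding J_def by (intro add_subgroup_sum add_subgroup_image_mult order_add_subgroup[OF \<Lambda>])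
  have "J \<subseteq> \<Lambda>"
    unfolding J_def using order_mult[OF \<Lambda> bc] of_nat_mult_mem zmod.subspace_add order_add_subgroup[OF \<Lambda>]
    by fastforce
  moreover have "((b + c) * \<mu> + of_nat N * l) * z \<in> J" if "\<mu> \<in> \<Lambda>" "l \<in> \<Lambda>" "z \<in> \<Lambda>" for \<mu> l z
  proof -
    have "((b + c) * \<mu> + of_nat N * l) * z = (b + c) * (\<mu> * z) + of_nat N * (l * z)"
      by (simp add: algebra_simps)
    then show ?thesis
      unfolding J_def using that order_mult[OF \<Lambda>] by blast
  qed
  ultimately have J: "ideal_in \<Lambda> J"
    using Jsub by (auto simp: ideal_in_def J_def)
  have 0: "0 \<in> \<Lambda>" using zmod.subspace_0 order_add_subgroup[OF \<Lambda>] by auto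
  have J_mem: "(b + c) * \<mu> + of_nat N * l \<in> J" if "\<mu> \<in> \<Lambda>" "l \<in> \<Lambda>" for \<mu> l
    unfolding J_def using that by blast
  have NJ: "of_nat N \<in> J" and bJ: "b + c \<in> J"
    using J_mem[OF 0 order_one[OF \<Lambda>]] J_mem[OF order_one[OF \<Lambda>] 0] by simp_all
  have "1 \<in> J"
  proof (rule ccontr)
    assume "1 \<notin> J"
    then obtain I where I: "maximal_ideal_in \<Lambda> I" "J \<subseteq> I"
      by (rule maximal_ideal_exists[OF \<Lambda> N J NJ]) (rule that)
    then show False using c(2)[of I] NJ bJ by (auto simp: \<M>_def)
  qed
  then obtain \<mu> l where "\<mu> \<in> \<Lambda>" "l \<in> \<Lambda>" "1 = (b + c) * \<mu> + of_nat N * l" unfolding J_def by auto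
  then show ?thesis using that c(1) by metis
qed

end

section \<open>Localizations and approximation\<close>

definition is_subring :: "'a::comm_ring_1 set \<Rightarrow> bool" where
  "is_subring S \<longleftrightarrow> add_subgroup S \<and> 1 \<in> S \<and> (\<forall>x\<in>S. \<forall>y\<in>S. x * y \<in> S)"

lemma is_subringD:
  assumes "is_subring S"
  shows "add_subgroup S" "1 \<in> S" "\<And>x y. x \<in> S \<Longrightarrow> y \<in> S \<Longrightarrow> x * y \<in> S"
  using assms by (auto simp: is_subring_def)

context fin_dim_comm_rat_algebra
begin

lemma order_is_subring: "is_order scale \<Lambda> \<Longrightarrow> is_subring \<Lambda>"
  unfolding is_subring_def using order_add_subgroup order_one order_mult by blast

text \<open>A common denominator of the finitely many terms replaces the defining sum by a single
  multiplier.\<close>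

lemma mem_loc_iff:
  assumes L: "add_subgroup L" and p: "prime p"
  shows "x \<in> loc scale p L \<longleftrightarrow> (\<exists>n. \<not> p dvd n \<and> of_nat n * x \<in> L)"
proof
  let ?P = "\<lambda>x. \<exists>n. \<not> p dvd n \<and> of_nat n * x \<in> L"
  have add: "?P (x + y)" if x: "?P x" and y: "?P y" for x y
  proof -
    obtain n m where n: "\<not> p dvd n" "of_nat n * x \<in> L" and m: "\<not> p dvd m" "of_nat m * y \<in> L"
      using x y by blast
    have "of_nat (n * m) * (x + y) = of_nat m * (of_nat n * x) + of_nat n * (of_nat m * y)"
      by (simp add: algebra_simps)
    also have "\<dots> \<in> L"
      by (rule zmod.subspace_add[OF L of_nat_mult_mem[OF L n(2)] of_nat_mult_mem[OF L m(2)]])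
    finally show ?thesis
      using n(1) m(1) prime_dvd_mult_iff[OF p] by blast
  qed
  have fraction: "?P (scale r y)" if r: "r \<in> Z_loc p" and y: "y \<in> L" for r y
  proof -
    obtain m n where r: "r = of_int m / of_int n" "\<not> int p dvd n"
      using r unfolding Z_loc_def by blast
    then have n0: "n \<noteq> 0" by auto
    have "of_int n * scale r y = of_int m * y"
      unfolding scale_of_int[symmetric] using r(1) n0 by simp
    then have "of_int (\<bar>n\<bar>) * scale r y = of_int (sgn n * m) * y"
      using n0 by (simp add: abs_if sgn_if)
    then have "of_nat (nat \<bar>n\<bar>) * scale r y = of_int (sgn n * m) * y"
      by simp
    moreover have "of_int (sgn n * m) * y \<in> L"
      by (rule zmod.subspace_scale[OF L y])
    moreover have "\<not> p dvd nat \<bar>n\<bar>"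
      using r(2) by (simp add: nat_abs_dvd_iff flip: int_dvd_int_iff)
    ultimately show ?thesis by metis
  qed
  assume "x \<in> loc scale p L"
  then obtain N :: nat and r y where x: "x = (\<Sum>i<N. scale (r i) (y i))" "\<forall>i<N. r i \<in> Z_loc p \<and> y i \<in> L"
    unfolding loc_def by blast
  have "?P (\<Sum>i<k. scale (r i) (y i))" if "k \<le> N" for k
    using that
  proof (induction k)
    case 0
    show ?case using zmod.subspace_0[OF L] p by (auto intro!: exI[of _ 1])
  next
    case (Suc k)
    then show ?case using add[of "\<Sum>i<k. scale (r i) (y i)" "scale (r k) (y k)"] fraction[of "r k" "y k"] x(2)
      by simp
  qed
  then show "?P x" using x(1) by simp
next
  assume "\<exists>n. \<not> p dvd n \<and> of_nat n * x \<in> L"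
  then obtain n where n: "\<not> p dvd n" "of_nat n * x \<in> L" by blast
  then have n0: "n > 0" by (cases n) auto
  have "x = (\<Sum>i<(1::nat). scale (1 / of_nat n) (of_nat n * x))"
    using n0 by (simp add: scale_of_nat[symmetric])
  moreover have "1 / of_nat n \<in> Z_loc p"
    unfolding Z_loc_def using n by (intro CollectI exI[of _ 1] exI[of _ "int n"]) simp
  ultimately show "x \<in> loc scale p L"
    unfolding loc_def using n(2)
    by (intro CollectI exI[of _ 1] exI[of _ "\<lambda>_. 1 / of_nat n"] exI[of _ "\<lambda>_. of_nat n * x"]) simp
qed

lemma loc_superset: "add_subgroup L \<Longrightarrow> prime p \<Longrightarrow> L \<subseteq> loc scale p L"
proof
  fix x assume L: "add_subgroup L" "prime p" and "x \<in> L"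
  moreover from L(2) have "\<not> p dvd 1" using prime_gt_1_nat[of p] by simp
  ultimately show "x \<in> loc scale p L"
    using mem_loc_iff[OF L] by (metis mult_1 of_nat_1)
qed

lemma loc_mono: "L \<subseteq> M \<Longrightarrow> loc scale p L \<subseteq> loc scale p M"
  unfolding loc_def by blast

lemma add_subgroup_loc:
  assumes L: "add_subgroup L" and p: "prime p"
  shows "add_subgroup (loc scale p L)"
proof (rule add_subgroupI)
  show "0 \<in> loc scale p L"
    using loc_superset[OF L p] zmod.subspace_0[OF L] by blast
  fix x y assume x: "x \<in> loc scale p L" and y: "y \<in> loc scale p L"
  obtain n m where n: "\<not> p dvd n" "of_nat n * x \<in> L" and m: "\<not> p dvd m" "of_nat m * y \<in> L"
    using x y mem_loc_iff[OF L p] by blast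
  have "of_nat (n * m) * (x - y) = of_nat m * (of_nat n * x) - of_nat n * (of_nat m * y)"
    by (simp add: algebra_simps)
  also have "\<dots> \<in> L"
    by (rule zmod.subspace_diff[OF L of_nat_mult_mem[OF L n(2)] of_nat_mult_mem[OF L m(2)]])
  finally show "x - y \<in> loc scale p L"
    using n(1) m(1) prime_dvd_mult_iff[OF p] mem_loc_iff[OF L p] by blast
qed

lemma loc_mult:
  assumes L: "add_subgroup L" and M: "add_subgroup M" and N: "add_subgroup N" and p: "prime p"
    and x: "x \<in> loc scale p L" and y: "y \<in> loc scale p M"
    and LMN: "\<And>a b. a \<in> L \<Longrightarrow> b \<in> M \<Longrightarrow> a * b \<in> N"
  shows "x * y \<in> loc scale p N"
proof -
  obtain n m where n: "\<not> p dvd n" "of_nat n * x \<in> L" and m: "\<not> p dvd m" "of_nat m * y \<in> M"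
    using x y mem_loc_iff[OF L p] mem_loc_iff[OF M p] by blast
  have "of_nat (n * m) * (x * y) = (of_nat n * x) * (of_nat m * y)" by (simp add: mult_ac)
  also have "\<dots> \<in> N" by (rule LMN[OF n(2) m(2)])
  finally show ?thesis
    using n(1) m(1) prime_dvd_mult_iff[OF p] mem_loc_iff[OF N p] by blast
qed

lemma loc_divide:
  assumes L: "add_subgroup L" and p: "prime p" and n: "\<not> p dvd n" and x: "of_nat n * x \<in> loc scale p L"
  shows "x \<in> loc scale p L"
proof -
  obtain m where m: "\<not> p dvd m" "of_nat m * (of_nat n * x) \<in> L"
    using x mem_loc_iff[OF L p] by blast
  then have "of_nat (m * n) * x \<in> L" by (simp add: mult.assoc)
  then show ?thesis
    using n m(1) prime_dvd_mult_iff[OF p] mem_loc_iff[OF L p] by blast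
qed

lemma is_subring_loc:
  assumes S: "is_subring S" and p: "prime p"
  shows "is_subring (loc scale p S)"
proof -
  note S' = is_subringD[OF S]
  have "x * y \<in> loc scale p S" if "x \<in> loc scale p S" "y \<in> loc scale p S" for x y
    by (rule loc_mult[OF S'(1) S'(1) S'(1) p that S'(3)])
  then show ?thesis
    unfolding is_subring_def using add_subgroup_loc[OF S'(1) p] loc_superset[OF S'(1) p] S'(2) by blast
qed

text \<open>The least positive \<open>n\<close> with \<open>n x \<in> L\<close> divides every multiplier of this kind; as there is
  one prime to \<open>p\<close> for each \<open>p\<close>, no prime divides \<open>n\<close>.\<close>

lemma local_global:
  assumes L: "add_subgroup L" and x: "\<And>p. prime p \<Longrightarrow> x \<in> loc scale p L"
  shows "x \<in> L"
proof -
  define n where "n = (LEAST n. n > 0 \<and> of_nat n * x \<in> L)"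
  obtain k where k: "\<not> 2 dvd k" "of_nat k * x \<in> L"
    using x[of 2] mem_loc_iff[OF L, of 2] by auto
  then have "k > 0 \<and> of_nat k * x \<in> L" by (cases k) auto
  then have n: "n > 0" "of_nat n * x \<in> L" and least: "\<And>k. k > 0 \<Longrightarrow> of_nat k * x \<in> L \<Longrightarrow> n \<le> k"
    unfolding n_def by (metis (mono_tags, lifting) LeastI, metis (mono_tags, lifting) LeastI, auto intro: Least_le)
  have dvd: "n dvd k" if k: "of_nat k * x \<in> L" for k
  proof -
    have "of_nat k = of_nat (k div n) * of_nat n + (of_nat (k mod n) :: 'a)"
      by (metis div_mult_mod_eq of_nat_add of_nat_mult)
    then have "of_nat (k mod n) * x = of_nat k * x - of_nat (k div n) * (of_nat n * x)"
      by (simp add: algebra_simps)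
    also have "\<dots> \<in> L"
      by (rule zmod.subspace_diff[OF L k of_nat_mult_mem[OF L n(2)]])
    finally have "of_nat (k mod n) * x \<in> L" .
    then have "k mod n = 0"
      using least[of "k mod n"] n(1) mod_less_divisor[of n k] by linarith
    then show ?thesis by auto
  qed
  have "n = 1"
  proof (rule ccontr)
    assume "n \<noteq> 1"
    then obtain p where p: "prime p" "p dvd n" using prime_factor_nat by blast
    obtain k where "\<not> p dvd k" "of_nat k * x \<in> L" using x[OF p(1)] mem_loc_iff[OF L p(1)] by blast
    then show False using dvd p(2) dvd_trans by blast
  qed
  then show ?thesis using n(2) by simp
qed

lemma loc_determines:
  assumes L: "add_subgroup L" and M: "add_subgroup M"
    and eq: "\<And>p. prime p \<Longrightarrow> loc scale p L = loc scale p M"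
  shows "L = M"
proof
  show "L \<subseteq> M"
  proof
    fix x assume "x \<in> L"
    then have "x \<in> loc scale p M" if "prime p" for p
      using loc_superset[OF L that] eq[OF that] by blast
    then show "x \<in> M" by (rule local_global[OF M])
  qed
  show "M \<subseteq> L"
  proof
    fix x assume "x \<in> M"
    then have "x \<in> loc scale p L" if "prime p" for p
      using loc_superset[OF M that] eq[OF that] by blast
    then show "x \<in> L" by (rule local_global[OF L])
  qed
qed

text \<open>The Chinese remainder theorem for elements of a lattice. Write \<open>N = m p * p ^ k p\<close> with
  \<open>m p\<close> prime to \<open>p\<close>. For \<open>q \<noteq> p\<close> the number \<open>m q\<close> is divisible by \<open>p ^ k p\<close>, so at \<open>p\<close> the
  sum of the \<open>m q * c q\<close> sees only its \<open>p\<close>-th term, and \<open>c p\<close> is \<open>a p\<close> with its denominator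
  cleared and corrected by an inverse modulo \<open>p ^ k p\<close>.\<close>

lemma strong_approximation:
  assumes \<Lambda>: "add_subgroup \<Lambda>" and N: "N > 0" and P: "finite P" "\<And>p. p \<in> P \<Longrightarrow> prime p"
    and a: "\<And>p. p \<in> P \<Longrightarrow> a p \<in> loc scale p \<Lambda>"
  shows "\<exists>b\<in>\<Lambda>. \<forall>p\<in>P. b - a p \<in> loc scale p ((*) (of_nat N) ` \<Lambda>)"
proof -
  have "\<forall>p\<in>P. \<exists>n. \<not> p dvd n \<and> of_nat n * a p \<in> \<Lambda>"
    using a P(2) mem_loc_iff[OF \<Lambda>] by blast
  then obtain n where n: "\<And>p. p \<in> P \<Longrightarrow> \<not> p dvd n p" "\<And>p. p \<in> P \<Longrightarrow> of_nat (n p) * a p \<in> \<Lambda>"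
    by metis
  have "\<forall>p\<in>P. \<exists>k m. \<not> p dvd m \<and> N = m * p ^ k"
    using prime_power_canonical N P(2) by blast
  then obtain k m where m: "\<And>p. p \<in> P \<Longrightarrow> \<not> p dvd m p" and Nm: "\<And>p. p \<in> P \<Longrightarrow> N = m p * p ^ k p"
    by metis
  \<comment> \<open>\<open>s\<close> inverts \<open>m p * n p\<close> modulo \<open>p ^ k p\<close>\<close>
  have "\<forall>p\<in>P. \<exists>s j. s * int (m p * n p) - 1 = j * int (p ^ k p)"
  proof
    fix p assume p: "p \<in> P"
    have "coprime (m p * n p) (p ^ k p)"
      using m[OF p] n(1)[OF p] P(2)[OF p] by (simp add: prime_imp_coprime coprime_commute)
    then have "gcd (int (m p * n p)) (int (p ^ k p)) = 1"
      by (metis coprime_imp_gcd_eq_1 coprime_int_iff)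
    then obtain u v where "u * int (m p * n p) + v * int (p ^ k p) = 1"
      using bezout_int[of "int (m p * n p)" "int (p ^ k p)"] by metis
    then show "\<exists>s j. s * int (m p * n p) - 1 = j * int (p ^ k p)"
      by (intro exI[of _ u] exI[of _ "- v"]) (simp add: algebra_simps)
  qed
  then obtain s j where s: "\<And>p. p \<in> P \<Longrightarrow> s p * int (m p * n p) - 1 = j p * int (p ^ k p)"
    by metis
  define c where "c p = of_int (s p) * (of_nat (n p) * a p)" for p
  have c: "c p \<in> \<Lambda>" if "p \<in> P" for p
    unfolding c_def by (rule zmod.subspace_scale[OF \<Lambda> n(2)[OF that]])
  define b where "b = (\<Sum>q\<in>P. of_nat (m q) * c q)"
  have "b \<in> \<Lambda>"
    unfolding b_def by (rule zmod.subspace_sum[OF \<Lambda>]) (rule of_nat_mult_mem[OF \<Lambda> c])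
  moreover have "b - a p \<in> loc scale p ((*) (of_nat N) ` \<Lambda>)" if p: "p \<in> P" for p
  proof -
    let ?K = "(*) (of_nat N) ` \<Lambda>"
    have K: "add_subgroup ?K" by (rule add_subgroup_image_mult[OF \<Lambda>])
    have "of_nat (m p) * c p - a p = of_int (s p * int (m p * n p) - 1) * a p"
      unfolding c_def by (simp add: algebra_simps)
    also have "\<dots> = of_int (j p) * (of_nat (p ^ k p) * a p)"
      unfolding s[OF p] by (simp add: algebra_simps)
    finally have first: "of_nat (m p * n p) * (of_nat (m p) * c p - a p)
        = of_nat (m p * p ^ k p) * (of_int (j p) * (of_nat (n p) * a p))"
      by (simp add: mult_ac)
    have "of_nat (m p * n p) * (of_nat (m p) * c p - a p) \<in> ?K"
      unfolding first Nm[OF p, symmetric]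
      by (intro imageI zmod.subspace_scale[OF \<Lambda>] n(2)[OF p])
    moreover have "of_nat (m p * n p) * (of_nat (m q) * c q) \<in> ?K" if q: "q \<in> P - {p}" for q
    proof -
      have "coprime (p ^ k p) (q ^ k q)"
        using q p P(2) primes_coprime[of p q] by auto
      moreover have "p ^ k p dvd m q * q ^ k q"
        using Nm[of q] Nm[OF p] q by (metis DiffD1 dvd_triv_right)
      ultimately have "p ^ k p dvd m q" by (simp add: coprime_dvd_mult_left_iff)
      then obtain t where t: "m q = p ^ k p * t" by (rule dvdE)
      have eq: "of_nat (m p * n p) * (of_nat (m q) * c q) = of_nat (m p * p ^ k p) * (of_nat (n p * t) * c q)"
        unfolding t by (simp add: mult_ac)
      show ?thesis
        unfolding eq Nm[OF p, symmetric] using c[of q] q by (intro imageI of_nat_mult_mem[OF \<Lambda>]) simp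
    qed
    then have "(\<Sum>q\<in>P - {p}. of_nat (m p * n p) * (of_nat (m q) * c q)) \<in> ?K"
      by (rule zmod.subspace_sum[OF K])
    ultimately have "of_nat (m p * n p) * (of_nat (m p) * c p - a p)
        + (\<Sum>q\<in>P - {p}. of_nat (m p * n p) * (of_nat (m q) * c q)) \<in> ?K"
      by (rule zmod.subspace_add[OF K])
    moreover have "b - a p = (of_nat (m p) * c p - a p) + (\<Sum>q\<in>P - {p}. of_nat (m q) * c q)"
      unfolding b_def using P(1) p by (simp add: sum.remove)
    ultimately have "of_nat (m p * n p) * (b - a p) \<in> ?K"
      by (simp only: distrib_left sum_distrib_left)
    moreover have "\<not> p dvd m p * n p"
      using m[OF p] n(1)[OF p] prime_dvd_mult_iff[OF P(2)[OF p]] by blast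
    ultimately show ?thesis
      using mem_loc_iff[OF K P(2)[OF p]] by blast
  qed
  ultimately show ?thesis by blast
qed

section \<open>Units of the algebra\<close>

lemma finite_dimensional_basis: "\<exists>B. finite_dimensional_vector_space scale B"
proof -
  obtain B where B: "finite B" "span B = UNIV" using finite_dimensional by blast
  obtain B' where B': "B' \<subseteq> B" "independent B'" "B \<subseteq> span B'"
    by (rule maximal_independent_subset)
  have "span B' = UNIV"
    using span_minimal[OF B'(3) subspace_span] B(2) by blast
  then have "finite_dimensional_vector_space scale B'"
    using B' B(1) by unfold_locales (auto intro: finite_subset)
  then show ?thesis by blast
qed

text \<open>The images of multiplication by the powers of \<open>x\<close> become stationary, so
  \<open>x ^ n = x ^ Suc n * z\<close> for some \<open>n\<close> and \<open>z\<close>, and by iteration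
  \<open>x ^ n = x ^ (2 * n + 1) * z ^ (n + 1)\<close>. Hence \<open>f = x ^ (n + 1) * z ^ (n + 1)\<close> is an
  idempotent which fixes \<open>x ^ n\<close>: \<open>x\<close> is invertible on the part cut out by \<open>f\<close> and nilpotent
  on the complement.\<close>

lemma fitting:
  fixes x :: 'a
  obtains f w n where "f * f = f" "f = x * w" "f * x ^ n = x ^ n"
proof -
  obtain B where "finite_dimensional_vector_space scale B"
    using finite_dimensional_basis by blast
  then interpret fd: finite_dimensional_vector_space scale B .
  define V where "V n = range (\<lambda>z. x ^ n * z)" for n
  have sub: "subspace (V n)" for n
  proof (rule subspaceI)
    show "0 \<in> V n" unfolding V_def by (rule range_eqI[of _ _ 0]) simp
    fix u v assume "u \<in> V n" "v \<in> V n"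
    then obtain y z where "u = x ^ n * y" "v = x ^ n * z" unfolding V_def by blast
    then show "u + v \<in> V n"
      unfolding V_def by (intro range_eqI[of _ _ "y + z"]) (simp add: distrib_left)
  next
    fix c u assume "u \<in> V n"
    then obtain y where "u = x ^ n * y" unfolding V_def by blast
    then show "scale c u \<in> V n"
      unfolding V_def by (intro range_eqI[of _ _ "scale c y"]) (simp add: scale_mult_right)
  qed
  \<comment> \<open>where the dimension is least, the descending chain of images is stationary\<close>
  obtain n where n: "\<And>m. dim (V n) \<le> dim (V m)"
    using ex_has_least_nat[of "\<lambda>_. True" 0 "\<lambda>n. dim (V n)"] by blast
  have "V (Suc n) \<subseteq> V n"
  proof
    fix u assume "u \<in> V (Suc n)"
    then obtain y where "u = x ^ Suc n * y" unfolding V_def by blast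
    then show "u \<in> V n" unfolding V_def by (intro range_eqI[of _ _ "x * y"]) (simp add: mult_ac)
  qed
  then have "V (Suc n) = V n"
    by (rule fd.subspace_dim_equal[OF sub sub]) (rule n)
  moreover have "x ^ n \<in> V n" unfolding V_def by (rule range_eqI[of _ _ 1]) simp
  ultimately obtain z where z: "x ^ n = x ^ Suc n * z" unfolding V_def by blast
  have iter: "x ^ n = x ^ (n + k) * z ^ k" for k
  proof (induction k)
    case (Suc k)
    note Suc
    also have "x ^ (n + k) * z ^ k = x ^ n * (x ^ k * z ^ k)" by (simp add: power_add mult_ac)
    also have "\<dots> = (x ^ Suc n * z) * (x ^ k * z ^ k)" by (rule arg_cong[OF z])
    also have "\<dots> = x ^ (n + Suc k) * z ^ Suc k" by (simp add: power_add mult_ac)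
    finally show ?case .
  qed simp
  define w where "w = x ^ n * z ^ Suc n"
  have fn: "(x * w) * x ^ n = x ^ n"
  proof -
    have "(x * w) * x ^ n = x ^ (n + Suc n) * z ^ Suc n"
      unfolding w_def by (simp add: power_add mult_ac)
    then show ?thesis using iter[of "Suc n"] by simp
  qed
  have "(x * w) * (x * w) = ((x * w) * x ^ n) * (x * z ^ Suc n)"
    unfolding w_def by (simp add: mult_ac)
  also have "\<dots> = x * w" unfolding fn by (simp add: w_def mult_ac)
  finally show ?thesis using that[of "x * w" w n] fn by blast
qed

text \<open>The idempotent \<open>f\<close> from \<open>fitting\<close> satisfies \<open>x ^ n * (1 - f) = 0\<close>, hence \<open>f = 1\<close>.\<close>

lemma non_zero_divisor_unit:
  fixes x :: 'a
  assumes "\<And>z. x * z = 0 \<Longrightarrow> z = 0"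
  shows "x dvd 1"
proof -
  obtain f w n where f: "f = x * w" "f * x ^ n = x ^ n" by (rule fitting[of x]) (rule that)
  have pow: "x ^ n * z = 0 \<Longrightarrow> z = 0" for n z
  proof (induction n)
    case (Suc n)
    have "x * (x ^ n * z) = 0" using Suc.prems by (simp add: mult.assoc)
    then have "x ^ n * z = 0" by (rule assms)
    then show ?case by (rule Suc.IH)
  qed simp
  have "x ^ n * (1 - f) = 0" using f(2) by (simp add: algebra_simps)
  then have "1 - f = 0" by (rule pow)
  then have "1 = x * w" using f(1) by simp
  then show ?thesis by (rule dvdI)
qed

lemma common_denominator:
  assumes "finite (X :: rat set)"
  shows "\<exists>d>0. \<forall>q\<in>X. of_nat d * q \<in> \<int>"
  using assms
proof (induction X rule: finite_induct)
  case empty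
  show ?case by (rule exI[of _ 1]) simp
next
  case (insert q X)
  then obtain d where d: "d > 0" "\<forall>q\<in>X. of_nat d * q \<in> \<int>" by blast
  obtain a b where "quotient_of q = (a, b)" by fastforce
  then have q: "q = of_int a / of_int b" "b > 0"
    by (auto simp: quotient_of_div quotient_of_denom_pos)
  then have "of_nat (nat b) * q \<in> \<int>" by simp
  then have "of_nat d * (of_nat (nat b) * q) \<in> \<int>" by (rule Ints_mult[OF Ints_of_nat])
  moreover have "of_nat (nat b) * (of_nat d * r) \<in> \<int>" if "r \<in> X" for r
    by (rule Ints_mult[OF Ints_of_nat]) (use d(2) that in blast)
  ultimately show ?case
    using d(1) q(2) by (intro exI[of _ "d * nat b"]) (auto simp: mult_ac)
qed

text \<open>It suffices to clear the denominators of the values at finitely many generators of \<open>L\<close>.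
  The lemma is meant for coordinates and matrix entries.\<close>

lemma full_bounded_denominators:
  assumes L: "full_lattice scale L" and I: "finite I"
    and \<phi>: "\<And>i x y. i \<in> I \<Longrightarrow> \<phi> i (x - y) = \<phi> i x - (\<phi> i y :: rat)"
  obtains d where "d > 0" "\<And>i x. i \<in> I \<Longrightarrow> x \<in> L \<Longrightarrow> of_nat d * \<phi> i x \<in> \<int>"
proof -
  obtain S where S: "finite S" "L = int_span S"
    using L unfolding full_lattice_def by auto
  obtain d where d: "d > 0" "\<forall>q\<in>(\<lambda>(i, s). \<phi> i s) ` (I \<times> S). of_nat d * q \<in> \<int>"
    using common_denominator[of "(\<lambda>(i, s). \<phi> i s) ` (I \<times> S)"] I S(1) by blast
  have "of_nat d * \<phi> i x \<in> \<int>" if i: "i \<in> I" and x: "x \<in> L" for i x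
  proof -
    have "add_subgroup {x. of_nat d * \<phi> i x \<in> \<int>}"
    proof (rule add_subgroupI)
      have "\<phi> i 0 = 0" using \<phi>[OF i, of 0 0] by simp
      then show "0 \<in> {x. of_nat d * \<phi> i x \<in> \<int>}" by simp
      fix x y assume "x \<in> {x. of_nat d * \<phi> i x \<in> \<int>}" "y \<in> {x. of_nat d * \<phi> i x \<in> \<int>}"
      then show "x - y \<in> {x. of_nat d * \<phi> i x \<in> \<int>}"
        using Ints_diff[of "of_nat d * \<phi> i x" "of_nat d * \<phi> i y"] \<phi>[OF i, of x y]
        by (simp add: right_diff_distrib)
    qed
    moreover have "S \<subseteq> {x. of_nat d * \<phi> i x \<in> \<int>}" using d(2) i by auto
    ultimately have "int_span S \<subseteq> {x. of_nat d * \<phi> i x \<in> \<int>}" by (rule zmod.span_minimal[rotated])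
    then show ?thesis using x S(2) by blast
  qed
  then show ?thesis using that d(1) by blast
qed

text \<open>On \<open>L\<close> the coordinates have a common denominator \<open>d\<close>, and the integer \<open>d\<close> times a
  coordinate of \<open>x\<close> is divisible by all powers of \<open>N\<close>.\<close>

lemma full_no_divisible:
  assumes L: "full_lattice scale L" and N: "N \<ge> 2" and x: "\<And>k. \<exists>y\<in>L. x = of_nat (N ^ k) * y"
  shows "x = 0"
proof -
  obtain B where "finite_dimensional_vector_space scale B"
    using finite_dimensional_basis by blast
  then interpret fd: finite_dimensional_vector_space scale B .
  let ?r = "\<lambda>b x. representation B x b"
  note ind = fd.independent_Basis
  have UN: "x \<in> span B" for x using fd.span_Basis by simp
  obtain d where d: "d > 0" "\<And>b x. b \<in> B \<Longrightarrow> x \<in> L \<Longrightarrow> of_nat d * ?r b x \<in> \<int>"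
    by (rule full_bounded_denominators[OF L fd.finite_Basis, of ?r])
      (simp add: representation_diff[OF ind UN UN], rule that)
  have "?r b x = 0" if b: "b \<in> B" for b
  proof (rule ccontr)
    assume nz: "?r b x \<noteq> 0"
    have coord: "\<exists>z::int. of_nat d * ?r b x = of_nat (N ^ k) * of_int z" for k
    proof -
      obtain y where y: "y \<in> L" "x = of_nat (N ^ k) * y" using x by blast
      obtain z where z: "of_nat d * ?r b y = of_int z" using d(2)[OF b y(1)] by (auto elim: Ints_cases)
      have "?r b x = of_nat (N ^ k) * ?r b y"
        unfolding y(2) scale_of_nat[symmetric] by (simp add: representation_scale[OF ind UN])
      then have "of_nat d * ?r b x = of_nat (N ^ k) * (of_nat d * ?r b y)" by simp
      then show ?thesis using z by auto
    qed
    obtain z0 where z0: "of_nat d * ?r b x = of_int z0" using coord[of 0] by auto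
    then have "z0 \<noteq> 0" using nz d(1) by auto
    obtain z where "of_int z0 = (of_nat (N ^ nat \<bar>z0\<bar>) * of_int z :: rat)"
      using coord[of "nat \<bar>z0\<bar>"] z0 by auto
    then have z: "z0 = int (N ^ nat \<bar>z0\<bar>) * z"
      by (metis of_int_eq_iff of_int_mult of_int_of_nat_eq)
    then have "z \<noteq> 0" using \<open>z0 \<noteq> 0\<close> by auto
    then have "int (N ^ nat \<bar>z0\<bar>) * 1 \<le> int (N ^ nat \<bar>z0\<bar>) * \<bar>z\<bar>"
      by (intro mult_left_mono) auto
    also have "\<dots> = \<bar>int (N ^ nat \<bar>z0\<bar>) * z\<bar>" by (simp add: abs_mult)
    also have "\<dots> = \<bar>z0\<bar>" by (simp only: z[symmetric])
    finally have "N ^ nat \<bar>z0\<bar> \<le> nat \<bar>z0\<bar>" by linarith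
    moreover have "nat \<bar>z0\<bar> < 2 ^ nat \<bar>z0\<bar>" by (rule less_exp)
    moreover have "(2::nat) ^ nat \<bar>z0\<bar> \<le> N ^ nat \<bar>z0\<bar>" using N by (intro power_mono) auto
    ultimately show False by linarith
  qed
  then have "(\<Sum>b | ?r b x \<noteq> 0. scale (?r b x) b) = 0"
    using representation_ne_zero[of B x] by (intro sum.neutral) auto
  then show ?thesis using sum_nonzero_representation_eq[OF ind UN] by simp
qed

text \<open>If \<open>z = N l z\<close>, then \<open>z = N ^ k l ^ k z\<close> for all \<open>k\<close>, so a multiple of \<open>z\<close> is divisible
  by all powers of \<open>N\<close> within \<open>\<Lambda>\<close> and \<open>z = 0\<close>.\<close>

lemma one_minus_multiple_unit:
  assumes \<Lambda>: "is_order scale \<Lambda>" and l: "l \<in> \<Lambda>" and N: "N \<ge> 2"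
  shows "(1 - of_nat N * l) dvd 1"
proof (rule non_zero_divisor_unit)
  fix z assume z0: "(1 - of_nat N * l) * z = 0"
  have "z = (1 - of_nat N * l) * z + of_nat N * l * z" by (simp add: left_diff_distrib)
  also have "\<dots> = of_nat N * l * z" unfolding z0 by simp
  finally have z: "z = of_nat N * l * z" .
  obtain m where m: "m > 0" "of_nat m * z \<in> \<Lambda>" using full_multiple[OF order_full[OF \<Lambda>]] by blast
  have "l ^ k \<in> \<Lambda>" for k by (induction k) (auto intro: order_one[OF \<Lambda>] order_mult[OF \<Lambda> l])
  then have mem: "l ^ k * (of_nat m * z) \<in> \<Lambda>" for k by (rule order_mult[OF \<Lambda> _ m(2)])
  have "of_nat m * z = of_nat m * (of_nat N * l * z)" by (rule arg_cong[OF z])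
  also have "\<dots> = of_nat N * l * (of_nat m * z)" by (simp only: ac_simps)
  finally have mz: "of_nat m * z = of_nat N * l * (of_nat m * z)" .
  have "of_nat m * z = of_nat (N ^ k) * (l ^ k * (of_nat m * z))" for k
  proof (induction k)
    case (Suc k)
    note Suc
    also have "of_nat (N ^ k) * (l ^ k * (of_nat m * z))
        = of_nat (N ^ k) * (l ^ k * (of_nat N * l * (of_nat m * z)))"
      by (rule arg_cong[OF mz])
    also have "\<dots> = of_nat (N ^ Suc k) * (l ^ Suc k * (of_nat m * z))"
      by (simp add: mult_ac)
    finally show ?case .
  qed simp
  then have "of_nat m * z = 0"
    using mem by (intro full_no_divisible[OF order_full[OF \<Lambda>] N]) blast
  then show "z = 0" using of_nat_mult_cancel[OF m(1), of z 0] by simp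
qed

text \<open>The inverse \<open>w = 1 + N l w\<close> is expanded into \<open>k\<close> terms of the geometric series. The
  remainder is divisible by \<open>N ^ k\<close>, which removes the \<open>p\<close>-part \<open>p ^ k\<close> of a denominator of
  \<open>w\<close>.\<close>

lemma loc_one_minus_multiple_inverse:
  assumes \<Lambda>: "is_order scale \<Lambda>" and l: "l \<in> \<Lambda>" and p: "prime p" "p dvd N" and N: "N > 0"
  shows "\<exists>w\<in>loc scale p \<Lambda>. (1 - of_nat N * l) * w = 1"
proof -
  have "N \<ge> 2" using p N prime_ge_2_nat[of p] dvd_imp_le[of p N] by linarith
  then obtain w where w: "(1 - of_nat N * l) * w = 1"
    using unit_inverse_exists[OF one_minus_multiple_unit[OF \<Lambda> l]] by blast
  obtain M where M: "M > 0" "of_nat M * w \<in> \<Lambda>" using full_multiple[OF order_full[OF \<Lambda>]] by blast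
  obtain k m where m: "\<not> p dvd m" "M = m * p ^ k" using prime_power_canonical[OF p(1) M(1)] by blast
  obtain N' where N': "N = p * N'" using p(2) by (rule dvdE)
  note sub = order_add_subgroup[OF \<Lambda>]
  have pow: "l ^ k \<in> \<Lambda>" for k by (induction k) (auto intro: order_one[OF \<Lambda>] order_mult[OF \<Lambda> l])
  have geo: "w = (\<Sum>i<k. of_nat (N ^ i) * l ^ i) + of_nat (N ^ k) * (l ^ k * w)" for k
  proof (induction k)
    case (Suc k)
    have "w = (1 - of_nat N * l) * w + of_nat N * l * w" by (simp add: left_diff_distrib)
    also have "\<dots> = 1 + of_nat N * l * w" unfolding w ..
    finally have w': "w = 1 + of_nat N * l * w" .
    have "of_nat (N ^ k) * (l ^ k * w) = of_nat (N ^ k) * (l ^ k * (1 + of_nat N * l * w))"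
      by (rule arg_cong[OF w'])
    also have "\<dots> = of_nat (N ^ k) * l ^ k + of_nat (N ^ Suc k) * (l ^ Suc k * w)"
      by (simp add: algebra_simps)
    finally have "of_nat (N ^ k) * (l ^ k * w) = of_nat (N ^ k) * l ^ k + of_nat (N ^ Suc k) * (l ^ Suc k * w)" .
    then show ?case using Suc by (simp only: sum.lessThan_Suc add.assoc)
  qed simp
  have "of_nat m * w = of_nat m * ((\<Sum>i<k. of_nat (N ^ i) * l ^ i) + of_nat (N ^ k) * (l ^ k * w))"
    using geo[of k] by (rule arg_cong)
  also have "\<dots> = of_nat m * (\<Sum>i<k. of_nat (N ^ i) * l ^ i) + of_nat (N' ^ k) * (l ^ k * (of_nat M * w))"
    unfolding N' m(2) by (simp add: algebra_simps)
  also have "\<dots> \<in> \<Lambda>"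
    by (intro zmod.subspace_add[OF sub] of_nat_mult_mem[OF sub] zmod.subspace_sum[OF sub]
        order_mult[OF \<Lambda>] pow M(2))
  finally have "w \<in> loc scale p \<Lambda>"
    using m(1) mem_loc_iff[OF sub p(1)] by blast
  then show ?thesis using w by blast
qed

end

section \<open>The conductor of a pair of orders\<close>

locale order_pair = fin_dim_comm_rat_algebra scale
  for scale :: "rat \<Rightarrow> 'a::comm_ring_1 \<Rightarrow> 'a" +
  fixes \<Lambda>1 \<Lambda>2 :: "'a set"
  assumes order1: "is_order scale \<Lambda>1" and order2: "is_order scale \<Lambda>2" and sub: "\<Lambda>2 \<subseteq> \<Lambda>1"
begin

abbreviation C :: "'a set" where
  "C \<equiv> colon \<Lambda>2 \<Lambda>1"

definition P0 :: "nat set" where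
  "P0 = {p. prime p \<and> loc scale p \<Lambda>1 \<noteq> loc scale p \<Lambda>2}"

lemmas sub1 = order_add_subgroup[OF order1]
lemmas sub2 = order_add_subgroup[OF order2]

lemma C_subset2: "C \<subseteq> \<Lambda>2"
proof
  fix x assume "x \<in> C"
  then have "x * 1 \<in> \<Lambda>2" unfolding colon_iff using order_one[OF order1] by blast
  then show "x \<in> \<Lambda>2" by simp
qed

lemma C_ideal: "ideal_in \<Lambda>1 C"
proof -
  have "x * y \<in> C" if x: "x \<in> C" and y: "y \<in> \<Lambda>1" for x y
    unfolding colon_iff
  proof
    fix z assume "z \<in> \<Lambda>1"
    then have "x * (y * z) \<in> \<Lambda>2" using x order_mult[OF order1 y] unfolding colon_iff by blast
    then show "x * y * z \<in> \<Lambda>2" by (simp add: mult.assoc)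
  qed
  then show ?thesis
    unfolding ideal_in_def using add_subgroup_colon[OF sub2] C_subset2 sub by blast
qed

lemma C_sub: "add_subgroup C"
  by (rule ideal_inD(1)[OF C_ideal])

lemma C_mult: "x \<in> C \<Longrightarrow> y \<in> \<Lambda>1 \<Longrightarrow> x * y \<in> C"
  by (rule ideal_inD(3)[OF C_ideal])

lemma C_mult': "x \<in> \<Lambda>1 \<Longrightarrow> y \<in> C \<Longrightarrow> x * y \<in> C"
  by (rule ideal_inD(4)[OF C_ideal])

lemma C_subset1: "C \<subseteq> \<Lambda>1"
  using C_subset2 sub by blast

lemma C_ideal2: "ideal_in \<Lambda>2 C"
  unfolding ideal_in_def using C_sub C_subset2 C_mult sub by blast

lemma C_multiple:
  obtains N where "N > 0" "\<And>x. x \<in> \<Lambda>1 \<Longrightarrow> of_nat N * x \<in> C"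
proof -
  obtain N where N: "N > 0" "\<And>x. x \<in> \<Lambda>1 \<Longrightarrow> of_nat N * x \<in> \<Lambda>2"
    by (rule full_common_multiple[OF order_full[OF order1] order_full[OF order2]]) (rule that)
  have "of_nat N * x \<in> C" if x: "x \<in> \<Lambda>1" for x
    unfolding colon_iff
  proof
    fix y assume "y \<in> \<Lambda>1"
    then show "of_nat N * x * y \<in> \<Lambda>2"
      using N(2)[OF order_mult[OF order1 x]] by (simp add: mult.assoc)
  qed
  then show ?thesis using that N(1) by blast
qed

lemma full_between:
  assumes L: "add_subgroup L" "C \<subseteq> L" "L \<subseteq> \<Lambda>1"
  shows "full_lattice scale L"
proof -
  obtain N where N: "N > 0" "\<And>x. x \<in> \<Lambda>1 \<Longrightarrow> of_nat N * x \<in> C"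
    by (rule C_multiple) (rule that)
  show ?thesis
    by (rule full_commensurable[OF order_full[OF order1] L(1) N(1) _ less_one[THEN iffD2, OF refl]])
      (use N(2) L in auto)
qed

lemma full_C: "full_lattice scale C"
  by (rule full_between[OF C_sub subset_refl C_subset1])

lemma order_of_C: "\<Lambda>1 \<subseteq> order_of C"
  unfolding order_of_def using C_mult' by (auto simp: colon_iff[of _ C])

lemma C_greatest:
  assumes "lat_ideal scale \<Lambda>1 L" "L \<subseteq> \<Lambda>2"
  shows "L \<subseteq> C"
proof
  fix x assume x: "x \<in> L"
  show "x \<in> C"
    unfolding colon_iff
  proof
    fix y assume "y \<in> \<Lambda>1"
    then have "y * x \<in> L"
      using assms(1) x unfolding lat_ideal_def order_of_def by (auto simp: colon_iff)
    then show "x * y \<in> \<Lambda>2" using assms(2) by (auto simp: mult.commute)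
  qed
qed

lemma P0_prime: "p \<in> P0 \<Longrightarrow> prime p"
  by (simp add: P0_def)

text \<open>Where \<open>p\<close> does not divide \<open>N\<close>, the factor \<open>N\<close> is invertible, and \<open>N \<Lambda>1 \<subseteq> \<Lambda>2\<close>.\<close>

lemma P0_dvd:
  assumes N: "\<And>x. x \<in> \<Lambda>1 \<Longrightarrow> of_nat N * x \<in> C" and p: "p \<in> P0"
  shows "p dvd N"
proof (rule ccontr)
  assume n: "\<not> p dvd N"
  have "loc scale p \<Lambda>1 \<subseteq> loc scale p \<Lambda>2"
  proof
    fix x assume "x \<in> loc scale p \<Lambda>1"
    then obtain n where "\<not> p dvd n" "of_nat n * x \<in> \<Lambda>1" using mem_loc_iff[OF sub1 P0_prime[OF p]] by blast
    then have "of_nat N * (of_nat n * x) \<in> \<Lambda>2" "\<not> p dvd n" using N C_subset2 by auto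
    then have "of_nat n * x \<in> loc scale p \<Lambda>2" using mem_loc_iff[OF sub2 P0_prime[OF p]] n by blast
    then show "x \<in> loc scale p \<Lambda>2" by (rule loc_divide[OF sub2 P0_prime[OF p] \<open>\<not> p dvd n\<close>])
  qed
  then show False using p loc_mono[OF sub, of p] by (auto simp: P0_def)
qed

lemma finite_P0: "finite P0"
proof -
  obtain N where N: "N > 0" "\<And>x. x \<in> \<Lambda>1 \<Longrightarrow> of_nat N * x \<in> C"
    by (rule C_multiple) (rule that)
  have "P0 \<subseteq> {..N}" using P0_dvd[OF N(2)] dvd_imp_le[OF _ N(1)] by blast
  then show ?thesis by (rule finite_subset) simp
qed

text \<open>If the localizations at \<open>p\<close> agree, finite generation yields one \<open>n\<close> prime to \<open>p\<close> with
  \<open>n \<Lambda>1 \<subseteq> \<Lambda>2\<close>. Such an \<open>n\<close> lies in the conductor.\<close>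

lemma loc_C_outside:
  assumes p: "prime p" "p \<notin> P0"
  shows "loc scale p C = loc scale p \<Lambda>1" "loc scale p \<Lambda>1 = loc scale p \<Lambda>2"
proof -
  show eq: "loc scale p \<Lambda>1 = loc scale p \<Lambda>2" using p by (simp add: P0_def)
  have "\<exists>n. \<not> p dvd n \<and> of_nat n * x \<in> \<Lambda>2" if "x \<in> \<Lambda>1" for x
    using loc_superset[OF sub1 p(1)] that eq mem_loc_iff[OF sub2 p(1)] by blast
  then obtain n where n: "\<not> p dvd n" "\<And>x. x \<in> \<Lambda>1 \<Longrightarrow> of_nat n * x \<in> \<Lambda>2"
    using full_uniform_multiple[OF order_full[OF order1] sub2, of "\<lambda>n. \<not> p dvd n"]
      prime_dvd_mult_iff[OF p(1)] prime_gt_1_nat[OF p(1)] by auto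
  have "of_nat n * x \<in> C" if x: "x \<in> \<Lambda>1" for x
    unfolding colon_iff
  proof
    fix y assume "y \<in> \<Lambda>1"
    then show "of_nat n * x * y \<in> \<Lambda>2"
      using n(2)[OF order_mult[OF order1 x]] by (simp add: mult.assoc)
  qed
  then have "\<Lambda>1 \<subseteq> loc scale p C" using n(1) mem_loc_iff[OF C_sub p(1)] by blast
  have "loc scale p \<Lambda>1 \<subseteq> loc scale p C"
  proof
    fix x assume "x \<in> loc scale p \<Lambda>1"
    then obtain k where k: "\<not> p dvd k" "of_nat k * x \<in> \<Lambda>1" using mem_loc_iff[OF sub1 p(1)] by blast
    then have "of_nat k * x \<in> loc scale p C" using \<open>\<Lambda>1 \<subseteq> loc scale p C\<close> by blast
    then show "x \<in> loc scale p C" by (rule loc_divide[OF C_sub p(1) k(1)])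
  qed
  then show "loc scale p C = loc scale p \<Lambda>1" using loc_mono[OF C_subset1, of p] by blast
qed

section \<open>Lattices between the conductor and the larger order\<close>

definition unit_mod_C :: "'a \<Rightarrow> bool" where
  "unit_mod_C b \<longleftrightarrow> b \<in> \<Lambda>1 \<and> (\<exists>b'\<in>\<Lambda>1. b * b' - 1 \<in> C)"

text \<open>These lattices make up the kernel of the extension map from \<open>\<Lambda>2\<close>-lattices to
  \<open>\<Lambda>1\<close>-lattices.\<close>

definition K :: "'a \<Rightarrow> 'a set" where
  "K b = {c + b * x | c x. c \<in> C \<and> x \<in> \<Lambda>2}"

lemma K_memI: "c \<in> C \<Longrightarrow> x \<in> \<Lambda>2 \<Longrightarrow> c + b * x \<in> K b"
  unfolding K_def by blast

lemma K_sub: "add_subgroup (K b)"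
proof -
  have "K b = {c + y | c y. c \<in> C \<and> y \<in> (*) b ` \<Lambda>2}" unfolding K_def by blast
  then show ?thesis
    using add_subgroup_sum[OF C_sub add_subgroup_image_mult[OF sub2]] by simp
qed

lemma C_subset_K: "C \<subseteq> K b"
proof
  fix c assume "c \<in> C"
  from K_memI[OF this zmod.subspace_0[OF sub2], of b] show "c \<in> K b" by simp
qed

lemma mult_mem_K: "x \<in> \<Lambda>2 \<Longrightarrow> b * x \<in> K b"
  using K_memI[OF zmod.subspace_0[OF C_sub], of x b] by simp

lemma self_mem_K: "b \<in> K b"
  using mult_mem_K[OF order_one[OF order2], of b] by simp

lemma K_least:
  assumes L: "add_subgroup L" "C \<subseteq> L" "\<And>x. x \<in> \<Lambda>2 \<Longrightarrow> b * x \<in> L"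
  shows "K b \<subseteq> L"
proof
  fix y assume "y \<in> K b"
  then obtain c x where y: "y = c + b * x" "c \<in> C" "x \<in> \<Lambda>2" unfolding K_def by blast
  have "c \<in> L" using L(2) y(2) by blast
  then show "y \<in> L" unfolding y(1) by (rule zmod.subspace_add[OF L(1) _ L(3)[OF y(3)]])
qed

lemma K_subset: "b \<in> \<Lambda>1 \<Longrightarrow> K b \<subseteq> \<Lambda>1"
  by (rule K_least[OF sub1 C_subset1]) (use sub order_mult[OF order1] in blast)

lemma K_full: "b \<in> \<Lambda>1 \<Longrightarrow> full_lattice scale (K b)"
  by (rule full_between[OF K_sub C_subset_K K_subset])

lemma K_one: "K 1 = \<Lambda>2"
proof
  show "K 1 \<subseteq> \<Lambda>2" by (rule K_least[OF sub2 C_subset2]) simp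
  show "\<Lambda>2 \<subseteq> K 1" using mult_mem_K[of _ 1] by auto
qed

lemma K_cong:
  assumes "a - b \<in> C"
  shows "K a = K b"
proof -
  have "K a \<subseteq> K b" if ab: "a - b \<in> C" for a b
  proof (rule K_least[OF K_sub C_subset_K])
    fix x assume x: "x \<in> \<Lambda>2"
    have "(a - b) * x \<in> C" using C_mult[OF ab] x sub by blast
    from K_memI[OF this x, of b] show "a * x \<in> K b" by (simp add: algebra_simps)
  qed
  from this[OF assms] this[of b a] show ?thesis
    using zmod.subspace_neg[OF C_sub assms] by auto
qed

lemma unit_mod_CE:
  assumes "unit_mod_C b"
  obtains b' g where "b \<in> \<Lambda>1" "b' \<in> \<Lambda>1" "g \<in> C" "b * b' = 1 + g"
  using assms unfolding unit_mod_C_def by (metis add.commute diff_add_cancel)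

lemma unit_mod_CI: "b \<in> \<Lambda>1 \<Longrightarrow> b' \<in> \<Lambda>1 \<Longrightarrow> b * b' - 1 \<in> C \<Longrightarrow> unit_mod_C b"
  unfolding unit_mod_C_def by blast

text \<open>That \<open>b\<close> is a unit modulo \<open>C\<close> matters for \<open>C \<subseteq> K a K b\<close>: from \<open>b b' = 1 + g\<close> with
  \<open>g \<in> C\<close> one gets \<open>c = (c b') b - c g\<close>.\<close>

lemma K_mult:
  assumes a: "a \<in> \<Lambda>1" and b: "unit_mod_C b"
  shows "lat_mult (K a) (K b) = K (a * b)"
proof
  obtain b' g where b': "b \<in> \<Lambda>1" "b' \<in> \<Lambda>1" "g \<in> C" "b * b' = 1 + g" by (rule unit_mod_CE[OF b])
  show "lat_mult (K a) (K b) \<subseteq> K (a * b)"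
  proof (rule lat_mult_subset[OF K_sub])
    fix u v assume u: "u \<in> K a" and "v \<in> K b"
    then obtain c x d y where uv: "u = c + a * x" "v = d + b * y" and x: "c \<in> C" "x \<in> \<Lambda>2" "d \<in> C" "y \<in> \<Lambda>2"
      unfolding K_def by blast
    have ax: "a * x \<in> \<Lambda>1" and by1: "b * y \<in> \<Lambda>1" and c: "c \<in> \<Lambda>1"
      using order_mult[OF order1] a b'(1) x sub C_subset1 by blast+
    have "c * d + c * (b * y) + a * x * d \<in> C"
      by (intro zmod.subspace_add[OF C_sub] C_mult[OF x(1) by1] C_mult'[OF ax x(3)] C_mult'[OF c x(3)])
    from K_memI[OF this order_mult[OF order2 x(2,4)], of "a * b"] show "u * v \<in> K (a * b)"
      unfolding uv by (simp add: algebra_simps)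
  qed
  show "K (a * b) \<subseteq> lat_mult (K a) (K b)"
  proof (rule K_least[OF add_subgroup_lat_mult[OF K_sub]])
    fix x assume "x \<in> \<Lambda>2"
    then have "a * (b * x) \<in> lat_mult (K a) (K b)" by (intro lat_mult_mem self_mem_K mult_mem_K)
    then show "a * b * x \<in> lat_mult (K a) (K b)" by (simp add: mult.assoc)
  next
    show "C \<subseteq> lat_mult (K a) (K b)"
    proof
      fix c assume c: "c \<in> C"
      have "(c * b') * b - c * g \<in> lat_mult (K a) (K b)"
        using C_mult[OF c b'(2)] c b'(3) C_subset_K self_mem_K
        by (intro zmod.subspace_diff[OF add_subgroup_lat_mult[OF K_sub]] lat_mult_mem) auto
      moreover have "(c * b') * b - c * g = c * (b * b' - g)" by (simp add: algebra_simps)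
      ultimately show "c \<in> lat_mult (K a) (K b)" using b'(4) by simp
    qed
  qed
qed

lemma unit_mod_C_one: "unit_mod_C 1"
  by (rule unit_mod_CI[OF order_one[OF order1] order_one[OF order1]]) (simp add: zmod.subspace_0[OF C_sub])

text \<open>An inverse \<open>b'\<close> of \<open>b\<close> modulo \<open>C\<close> provides the inverse lattice:
  \<open>K b K b' = K (b b') = K 1 = \<Lambda>2\<close>.\<close>

lemma K_in_group:
  assumes b: "unit_mod_C b"
  shows "K b \<in> carrier (lat_group scale \<Lambda>2)"
proof -
  obtain b' g where b': "b \<in> \<Lambda>1" "b' \<in> \<Lambda>1" "g \<in> C" "b * b' = 1 + g" by (rule unit_mod_CE[OF b])
  have ub': "unit_mod_C b'"
    by (rule unit_mod_CI[OF b'(2,1)]) (use b'(3,4) in \<open>simp add: mult.commute\<close>)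
  have "lat_mult (K b) (K b') = K 1"
    unfolding K_mult[OF b'(1) ub'] by (rule K_cong) (use b'(3,4) in simp)
  moreover have "lat_mult (K b) (K 1) = K b"
    unfolding K_mult[OF b'(1) unit_mod_C_one] by simp
  ultimately show ?thesis
    unfolding lat_group_carrier[OF order2] using K_full b' K_one by auto
qed

text \<open>Writing \<open>1 \<in> K b\<close> as \<open>1 = c + b x\<close> exhibits an inverse \<open>x \<in> \<Lambda>2\<close> of \<open>b\<close> modulo \<open>C\<close>.\<close>

lemma K_eq_order_iff:
  assumes b: "unit_mod_C b"
  shows "K b = \<Lambda>2 \<longleftrightarrow> b \<in> \<Lambda>2 \<and> (\<exists>b'\<in>\<Lambda>2. b * b' - 1 \<in> C)"
proof
  assume eq: "K b = \<Lambda>2"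
  then have "1 \<in> K b" using order_one[OF order2] by simp
  then obtain c x where "1 = c + b * x" "c \<in> C" "x \<in> \<Lambda>2" unfolding K_def by blast
  then have "b * x - 1 = - c" by (simp add: algebra_simps)
  also have "\<dots> \<in> C" by (rule zmod.subspace_neg[OF C_sub \<open>c \<in> C\<close>])
  finally show "b \<in> \<Lambda>2 \<and> (\<exists>b'\<in>\<Lambda>2. b * b' - 1 \<in> C)"
    using self_mem_K[of b] eq \<open>x \<in> \<Lambda>2\<close> by blast
next
  assume "b \<in> \<Lambda>2 \<and> (\<exists>b'\<in>\<Lambda>2. b * b' - 1 \<in> C)"
  then obtain b' where b': "b \<in> \<Lambda>2" "b' \<in> \<Lambda>2" "b * b' - 1 \<in> C" by blast
  show "K b = \<Lambda>2"
  proof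
    show "K b \<subseteq> \<Lambda>2" by (rule K_least[OF sub2 C_subset2 order_mult[OF order2 b'(1)]])
    show "\<Lambda>2 \<subseteq> K b"
    proof
      fix x assume x: "x \<in> \<Lambda>2"
      have "(b * b' - 1) * x \<in> C" using C_mult[OF b'(3)] x sub by blast
      then have "- ((b * b' - 1) * x) + b * (b' * x) \<in> K b"
        by (intro K_memI zmod.subspace_neg[OF C_sub] order_mult[OF order2 b'(2) x])
      then show "x \<in> K b" by (simp add: algebra_simps)
    qed
  qed
qed

lemma K_extension:
  assumes b: "unit_mod_C b"
  shows "lat_mult \<Lambda>1 (K b) = \<Lambda>1"
proof
  obtain b' g where b': "b \<in> \<Lambda>1" "b' \<in> \<Lambda>1" "g \<in> C" "b * b' = 1 + g" by (rule unit_mod_CE[OF b])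
  show "lat_mult \<Lambda>1 (K b) \<subseteq> \<Lambda>1"
    by (rule lat_mult_subset[OF sub1]) (use K_subset[OF b'(1)] order_mult[OF order1] in blast)
  show "\<Lambda>1 \<subseteq> lat_mult \<Lambda>1 (K b)"
  proof
    fix x assume x: "x \<in> \<Lambda>1"
    have "(b' * x) * b - x * g \<in> lat_mult \<Lambda>1 (K b)"
      using order_mult[OF order1 b'(2) x] x self_mem_K b'(3) C_subset_K
      by (intro zmod.subspace_diff[OF add_subgroup_lat_mult[OF sub1]] lat_mult_mem) auto
    moreover have "(b' * x) * b - x * g = x * (b * b' - g)" by (simp add: algebra_simps)
    ultimately show "x \<in> lat_mult \<Lambda>1 (K b)" using b'(4) by simp
  qed
qed

lemma subset_extension: "L \<subseteq> lat_mult \<Lambda>1 L"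
proof
  fix x assume "x \<in> L"
  from lat_mult_mem[OF order_one[OF order1] this] show "x \<in> lat_mult \<Lambda>1 L" by simp
qed

text \<open>The inverse \<open>M\<close> of \<open>L\<close> also satisfies \<open>\<Lambda>1 M = \<Lambda>1\<close>, so \<open>L\<close> and \<open>M\<close> lie in \<open>\<Lambda>1\<close>; and
  \<open>C = C \<Lambda>1 L = C L \<subseteq> \<Lambda>2 L = L\<close>. If \<open>N \<Lambda>1 \<subseteq> C\<close>, a generator \<open>a\<close> of \<open>L\<close> modulo \<open>N\<close> is a unit
  modulo \<open>C\<close> and generates \<open>L\<close> modulo \<open>C\<close>.\<close>

lemma kernel_is_K:
  assumes L: "L \<in> carrier (lat_group scale \<Lambda>2)" and ext: "lat_mult \<Lambda>1 L = \<Lambda>1"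
  obtains b where "unit_mod_C b" "L = K b"
proof -
  obtain N where N: "N > 0" "\<And>x. x \<in> \<Lambda>1 \<Longrightarrow> of_nat N * x \<in> C"
    by (rule C_multiple) (rule that)
  obtain M where M: "M \<in> carrier (lat_group scale \<Lambda>2)" and LM: "lat_mult L M = \<Lambda>2" "lat_mult M L = \<Lambda>2"
    by (rule lat_group_inverse[OF order2 L])
  obtain a \<mu> l where a: "a \<in> L" and \<mu>: "\<mu> \<in> M" and l: "l \<in> \<Lambda>2" and eq: "a * \<mu> + of_nat N * l = 1"
    by (rule invertible_generator_mod[OF order2 N(1) L M LM(1)])
  note Ls = full_add_subgroup[OF lat_group_full[OF order2 L]]
  note Ms = full_add_subgroup[OF lat_group_full[OF order2 M]]
  have L1: "L \<subseteq> \<Lambda>1" using subset_extension[of L] ext by simp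
  have "lat_mult \<Lambda>1 M = lat_mult (lat_mult \<Lambda>1 L) M" using ext by simp
  also have "\<dots> = \<Lambda>1"
    unfolding lat_mult_assoc[OF sub1 Ls Ms] LM by (rule lat_mult_suborder[OF order1 order2 sub])
  finally have M1: "M \<subseteq> \<Lambda>1" using subset_extension[of M] by simp
  have "a * \<mu> - 1 = - (of_nat N * l)" unfolding eq[symmetric] by simp
  also have "\<dots> \<in> C" using l sub by (intro zmod.subspace_neg[OF C_sub] N(2)) blast
  finally have unit: "unit_mod_C a" using a \<mu> L1 M1 by (intro unit_mod_CI[of a \<mu>]) auto
  have CL: "C \<subseteq> L"
  proof
    fix c assume c: "c \<in> C"
    have "lat_mult \<Lambda>1 L \<subseteq> {x. c * x \<in> L}"
    proof (rule lat_mult_subset[OF add_subgroup_vimage_mult[OF Ls]])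
      fix y x assume y: "y \<in> \<Lambda>1" and x: "x \<in> L"
      have "x * (c * y) \<in> L"
        by (rule lat_group_mult_mem[OF order2 L x]) (use C_mult[OF c y] C_subset2 in blast)
      then show "y * x \<in> {x. c * x \<in> L}" by (simp add: mult_ac)
    qed
    then show "c \<in> L" using ext order_one[OF order1] by auto
  qed
  have "L = K a"
  proof
    show "K a \<subseteq> L" by (rule K_least[OF Ls CL lat_group_mult_mem[OF order2 L a]])
    show "L \<subseteq> K a"
    proof
      fix x assume x: "x \<in> L"
      have "\<mu> * x \<in> \<Lambda>2" using lat_mult_mem[OF \<mu> x] LM(2) by simp
      moreover have "of_nat N * (l * x) \<in> C"
        using x L1 l sub by (intro N(2) order_mult[OF order1]) auto
      ultimately have "of_nat N * (l * x) + a * (\<mu> * x) \<in> K a" by (intro K_memI)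
      moreover have "of_nat N * (l * x) + a * (\<mu> * x) = (a * \<mu> + of_nat N * l) * x"
        by (simp add: algebra_simps)
      ultimately show "x \<in> K a" unfolding eq by simp
    qed
  qed
  then show ?thesis using that unit by blast
qed

section \<open>Surjectivity of the extension map\<close>

text \<open>The preimage is \<open>L2 = l \<Lambda>2 + L C\<close>: near the conductor it looks like \<open>\<Lambda>2\<close>, elsewhere like
  \<open>L\<close>. With \<open>M\<close> the inverse of \<open>L\<close>, its inverse is \<open>M2 = \<Lambda>2 + M C\<close>. Put \<open>g = 1 - l \<in> C\<close>.
  Expanding the product shows \<open>L2 M2 \<subseteq> \<Lambda>2\<close>; it contains \<open>C\<close> because \<open>c = l c + c g\<close> with
  \<open>l c \<in> L C\<close> and \<open>c g \<in> (L C) (M C)\<close>, and then \<open>\<Lambda>2 = l \<Lambda>2 + g \<Lambda>2\<close>.\<close>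

lemma extension_surj_coprime:
  assumes L: "L \<in> carrier (lat_group scale \<Lambda>1)" and L1: "L \<subseteq> \<Lambda>1" and l: "l \<in> L" "1 - l \<in> C"
  shows "\<exists>L2\<in>carrier (lat_group scale \<Lambda>2). lat_mult \<Lambda>1 L2 = L"
proof -
  obtain N where N: "N > 0" "\<And>x. x \<in> \<Lambda>1 \<Longrightarrow> of_nat N * x \<in> C"
    by (rule C_multiple) (rule that)
  obtain M where M: "M \<in> carrier (lat_group scale \<Lambda>1)" and LM: "lat_mult L M = \<Lambda>1" "lat_mult M L = \<Lambda>1"
    by (rule lat_group_inverse[OF order1 L])
  note Ls = full_add_subgroup[OF lat_group_full[OF order1 L]]
  note Ms = full_add_subgroup[OF lat_group_full[OF order1 M]]
  define g where "g = 1 - l"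
  have g: "g \<in> C" "l + g = 1" using l(2) by (auto simp: g_def)
  have l2: "l \<in> \<Lambda>2"
  proof -
    have "1 - g \<in> \<Lambda>2" by (rule zmod.subspace_diff[OF sub2 order_one[OF order2]]) (use g C_subset2 in blast)
    then show ?thesis by (simp add: g_def)
  qed
  define LC where "LC = lat_mult L C"
  define MC where "MC = lat_mult M C"
  have LCs: "add_subgroup LC" and MCs: "add_subgroup MC"
    unfolding LC_def MC_def by (rule add_subgroup_lat_mult[OF Ls], rule add_subgroup_lat_mult[OF Ms])
  have LC_mem: "x * c \<in> LC" if "x \<in> L" "c \<in> C" for x c
    unfolding LC_def by (rule lat_mult_mem[OF that])
  have MC_mem: "x * c \<in> MC" if "x \<in> M" "c \<in> C" for x c
    unfolding MC_def by (rule lat_mult_mem[OF that])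
  have LC_L: "LC \<subseteq> L"
    unfolding LC_def by (rule lat_mult_subset[OF Ls lat_group_mult_mem[OF order1 L]]) (use C_subset1 in auto)
  have MC_M: "MC \<subseteq> M"
    unfolding MC_def by (rule lat_mult_subset[OF Ms lat_group_mult_mem[OF order1 M]]) (use C_subset1 in auto)
  have LC_C: "LC \<subseteq> C"
    unfolding LC_def by (rule lat_mult_subset[OF C_sub]) (use C_mult' L1 in blast)
  have LC_mult: "y * x \<in> LC" if y: "y \<in> LC" and x: "x \<in> \<Lambda>2" for x y
  proof -
    have "LC \<subseteq> {y. x * y \<in> LC}"
      unfolding LC_def
    proof (rule lat_mult_subset[OF add_subgroup_vimage_mult[OF LCs[unfolded LC_def]]])
      fix a b assume ab: "a \<in> L" "b \<in> C"
      have "a * (b * x) \<in> lat_mult L C"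
        by (rule lat_mult_mem[OF ab(1) C_mult[OF ab(2) subsetD[OF sub x]]])
      then show "a * b \<in> {y. x * y \<in> lat_mult L C}" by (simp add: mult_ac)
    qed
    then have "x * y \<in> LC" using y by blast
    then show ?thesis by (simp add: mult.commute)
  qed
  have LCM: "y * z \<in> C" if y: "y \<in> LC" and z: "z \<in> M" for y z
  proof -
    have "LC \<subseteq> {y. z * y \<in> C}"
      unfolding LC_def
    proof (rule lat_mult_subset[OF add_subgroup_vimage_mult[OF C_sub]])
      fix a b assume ab: "a \<in> L" "b \<in> C"
      have "a * z \<in> \<Lambda>1" using lat_mult_mem[OF ab(1) z] LM by simp
      then have "b * (a * z) \<in> C" by (rule C_mult[OF ab(2)])
      then show "a * b \<in> {y. z * y \<in> C}" by (simp add: mult_ac)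
    qed
    then have "z * y \<in> C" using y by blast
    then show ?thesis by (simp add: mult.commute)
  qed
  have LMC: "x * y \<in> C" if x: "x \<in> L" and y: "y \<in> MC" for x y
  proof -
    have "MC \<subseteq> {y. x * y \<in> C}"
      unfolding MC_def
    proof (rule lat_mult_subset[OF add_subgroup_vimage_mult[OF C_sub]])
      fix a b assume ab: "a \<in> M" "b \<in> C"
      have "x * a \<in> \<Lambda>1" using lat_mult_mem[OF x ab(1)] LM by simp
      then have "b * (x * a) \<in> C" by (rule C_mult[OF ab(2)])
      then show "a * b \<in> {y. x * y \<in> C}" by (simp add: mult_ac)
    qed
    then show ?thesis using y by auto
  qed
  have M1: "\<Lambda>1 \<subseteq> M"
  proof -
    have "lat_mult M L \<subseteq> lat_mult M \<Lambda>1" by (rule lat_mult_mono[OF subset_refl L1])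
    then show ?thesis using LM lat_group_mult_order[OF order1 M] by simp
  qed
  define L2 where "L2 = {u + y | u y. u \<in> (*) l ` \<Lambda>2 \<and> y \<in> LC}"
  define M2 where "M2 = {x + y | x y. x \<in> \<Lambda>2 \<and> y \<in> MC}"
  have L2s: "add_subgroup L2" and M2s: "add_subgroup M2"
    unfolding L2_def M2_def
    by (rule add_subgroup_sum[OF add_subgroup_image_mult[OF sub2] LCs], rule add_subgroup_sum[OF sub2 MCs])
  have L2I: "l * x + y \<in> L2" if "x \<in> \<Lambda>2" "y \<in> LC" for x y
    unfolding L2_def using that by blast
  have M2I: "x + y \<in> M2" if "x \<in> \<Lambda>2" "y \<in> MC" for x y
    unfolding M2_def using that by blast
  have lL2: "l \<in> L2" using L2I[OF order_one[OF order2] zmod.subspace_0[OF LCs]] by simp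
  have LC_L2: "LC \<subseteq> L2" using L2I[OF zmod.subspace_0[OF sub2]] by auto
  have \<Lambda>2_M2: "\<Lambda>2 \<subseteq> M2" using M2I[OF _ zmod.subspace_0[OF MCs]] by auto
  have MC_M2: "MC \<subseteq> M2" using M2I[OF zmod.subspace_0[OF sub2]] by auto
  have L2_L: "L2 \<subseteq> L"
  proof
    fix z assume "z \<in> L2"
    then obtain x y where z: "z = l * x + y" "x \<in> \<Lambda>2" "y \<in> LC" unfolding L2_def by blast
    have "l * x \<in> L" by (rule lat_group_mult_mem[OF order1 L l(1)]) (use z sub in blast)
    moreover have "y \<in> L" using z LC_L by blast
    ultimately show "z \<in> L" unfolding z(1) by (rule zmod.subspace_add[OF Ls])
  qed
  have M2_M: "M2 \<subseteq> M"
  proof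
    fix z assume "z \<in> M2"
    then obtain x y where z: "z = x + y" "x \<in> \<Lambda>2" "y \<in> MC" unfolding M2_def by blast
    have "x \<in> M" "y \<in> M" using z sub M1 MC_M by auto
    then show "z \<in> M" unfolding z(1) by (rule zmod.subspace_add[OF Ms])
  qed
  have N1: "of_nat N \<in> C" using N(2)[OF order_one[OF order1]] by simp
  have L2f: "full_lattice scale L2"
  proof (rule full_commensurable[OF lat_group_full[OF order1 L] L2s N(1) _ less_one[THEN iffD2, OF refl]])
    fix x assume "x \<in> L"
    from LC_mem[OF this N1] show "of_nat N * x \<in> L2" using LC_L2 by (auto simp: mult.commute)
  qed (use L2_L in auto)
  have M2f: "full_lattice scale M2"
  proof (rule full_commensurable[OF lat_group_full[OF order1 M] M2s N(1) _ less_one[THEN iffD2, OF refl]])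
    fix x assume "x \<in> M"
    from MC_mem[OF this N1] show "of_nat N * x \<in> M2" using MC_M2 by (auto simp: mult.commute)
  qed (use M2_M in auto)
  note LMs = add_subgroup_lat_mult[OF L2s]
  have "lat_mult L2 M2 = \<Lambda>2"
  proof
    show "lat_mult L2 M2 \<subseteq> \<Lambda>2"
    proof (rule lat_mult_subset[OF sub2])
      fix u v assume "u \<in> L2" "v \<in> M2"
      then obtain x y x' y' where uv: "u = l * x + y" "v = x' + y'"
        and x: "x \<in> \<Lambda>2" "y \<in> LC" "x' \<in> \<Lambda>2" "y' \<in> MC" unfolding L2_def M2_def by blast
      have "x * (l * y') \<in> C" using C_mult'[OF _ LMC[OF l(1) x(4)]] x(1) sub by blast
      moreover have "y * x' \<in> C" using LC_mult[OF x(2,3)] LC_C by blast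
      moreover have "y * y' \<in> C" using LCM[OF x(2)] x(4) MC_M by blast
      ultimately have "x * (l * y') + (y * x' + y * y') \<in> C"
        by (intro zmod.subspace_add[OF C_sub])
      then have "x * (l * y') + (y * x' + y * y') \<in> \<Lambda>2" using C_subset2 by blast
      moreover have "l * x * x' \<in> \<Lambda>2" by (intro order_mult[OF order2] l2 x)
      ultimately have "l * x * x' + (x * (l * y') + (y * x' + y * y')) \<in> \<Lambda>2"
        by (rule zmod.subspace_add[OF sub2, rotated])
      moreover have "u * v = l * x * x' + (x * (l * y') + (y * x' + y * y'))"
        unfolding uv by (simp add: algebra_simps)
      ultimately show "u * v \<in> \<Lambda>2" by simp
    qed
    have CLM: "C \<subseteq> lat_mult L2 M2"
    proof
      fix c assume c: "c \<in> C"
      have "lat_mult L M \<subseteq> {z. c * g * z \<in> lat_mult L2 M2}"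
      proof (rule lat_mult_subset[OF add_subgroup_vimage_mult[OF LMs]])
        fix a b assume ab: "a \<in> L" "b \<in> M"
        have "(a * c) * (b * g) \<in> lat_mult L2 M2"
          using LC_mem[OF ab(1) c] MC_mem[OF ab(2) g(1)] LC_L2 MC_M2 by (intro lat_mult_mem) auto
        then show "a * b \<in> {z. c * g * z \<in> lat_mult L2 M2}" by (simp add: mult_ac)
      qed
      then have "c * g * 1 \<in> lat_mult L2 M2" using LM order_one[OF order1] by blast
      moreover have "(l * c) * 1 \<in> lat_mult L2 M2"
        using LC_mem[OF l(1) c] LC_L2 \<Lambda>2_M2 order_one[OF order2] by (intro lat_mult_mem) auto
      ultimately have "(l * c) * 1 + c * g * 1 \<in> lat_mult L2 M2"
        by (intro zmod.subspace_add[OF LMs])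
      moreover have "(l * c) * 1 + c * g * 1 = c * (l + g)" by (simp add: algebra_simps)
      ultimately show "c \<in> lat_mult L2 M2" using g(2) by simp
    qed
    show "\<Lambda>2 \<subseteq> lat_mult L2 M2"
    proof
      fix x assume x: "x \<in> \<Lambda>2"
      have "l * x \<in> lat_mult L2 M2" using lL2 \<Lambda>2_M2 x by (intro lat_mult_mem) auto
      moreover have "g * x \<in> lat_mult L2 M2" using C_mult[OF g(1)] x sub CLM by blast
      ultimately have "l * x + g * x \<in> lat_mult L2 M2" by (rule zmod.subspace_add[OF LMs])
      moreover have "l * x + g * x = (l + g) * x" by (simp add: distrib_right)
      ultimately show "x \<in> lat_mult L2 M2" using g(2) by simp
    qed
  qed
  moreover have "lat_mult L2 \<Lambda>2 = L2"
  proof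
    show "lat_mult L2 \<Lambda>2 \<subseteq> L2"
    proof (rule lat_mult_subset[OF L2s])
      fix u x' assume "u \<in> L2" and x': "x' \<in> \<Lambda>2"
      then obtain x y where u: "u = l * x + y" "x \<in> \<Lambda>2" "y \<in> LC" unfolding L2_def by blast
      from L2I[OF order_mult[OF order2 u(2) x'] LC_mult[OF u(3) x']]
      show "u * x' \<in> L2" unfolding u(1) by (simp add: algebra_simps)
    qed
    show "L2 \<subseteq> lat_mult L2 \<Lambda>2" using lat_mult_mem[OF _ order_one[OF order2], of _ L2] by auto
  qed
  ultimately have G: "L2 \<in> carrier (lat_group scale \<Lambda>2)"
    unfolding lat_group_carrier[OF order2] using L2f M2f by blast
  have "lat_mult \<Lambda>1 L2 = L"
  proof
    show "lat_mult \<Lambda>1 L2 \<subseteq> L"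
    proof (rule lat_mult_subset[OF Ls])
      fix a b assume "a \<in> \<Lambda>1" "b \<in> L2"
      then have "b * a \<in> L" using lat_group_mult_mem[OF order1 L] L2_L by blast
      then show "a * b \<in> L" by (simp add: mult.commute)
    qed
    show "L \<subseteq> lat_mult \<Lambda>1 L2"
    proof
      fix x assume x: "x \<in> L"
      have "x * l + 1 * (x * g) \<in> lat_mult \<Lambda>1 L2"
        using x L1 lL2 LC_mem[OF x g(1)] LC_L2 order_one[OF order1]
        by (intro zmod.subspace_add[OF add_subgroup_lat_mult[OF sub1]] lat_mult_mem) auto
      moreover have "x * l + 1 * (x * g) = x * (l + g)" by (simp add: algebra_simps)
      ultimately show "x \<in> lat_mult \<Lambda>1 L2" using g(2) by simp
    qed
  qed
  with G show ?thesis by blast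
qed

text \<open>A generator \<open>a\<close> of the inverse \<open>M\<close> of \<open>L\<close> modulo \<open>2 N\<close>, where \<open>N \<Lambda>1 \<subseteq> C\<close>, is a unit of
  the algebra. Then \<open>a L \<subseteq> M L = \<Lambda>1\<close> contains \<open>a u\<close> for some \<open>u \<in> L\<close> with \<open>1 - a u \<in> C\<close>, and
  the preimage found for \<open>a L\<close> can be scaled back.\<close>

lemma extension_surj:
  assumes L: "L \<in> carrier (lat_group scale \<Lambda>1)"
  shows "\<exists>L2\<in>carrier (lat_group scale \<Lambda>2). lat_mult \<Lambda>1 L2 = L"
proof -
  obtain N where N: "N > 0" "\<And>x. x \<in> \<Lambda>1 \<Longrightarrow> of_nat N * x \<in> C"
    by (rule C_multiple) (rule that)
  obtain M where M: "M \<in> carrier (lat_group scale \<Lambda>1)" and LM: "lat_mult L M = \<Lambda>1" "lat_mult M L = \<Lambda>1"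
    by (rule lat_group_inverse[OF order1 L])
  note Ls = full_add_subgroup[OF lat_group_full[OF order1 L]]
  \<comment> \<open>the modulus \<open>2 N\<close> is at least \<open>2\<close> even if \<open>N = 1\<close>, as needed for \<open>1 - 2 N l\<close> to be a
    unit\<close>
  obtain a u l where a: "a \<in> M" and u: "u \<in> L" and l: "l \<in> \<Lambda>1" and eq: "a * u + of_nat (2 * N) * l = 1"
    by (rule invertible_generator_mod[OF order1 _ M L LM(2), of "2 * N"]) (use N in auto)
  have "a * u = 1 - of_nat (2 * N) * l" unfolding eq[symmetric] by simp
  moreover have "(1 - of_nat (2 * N) * l) dvd 1"
    by (rule one_minus_multiple_unit[OF order1 l]) (use N(1) in simp)
  ultimately have "a * u dvd 1" by simp
  then have unit: "a dvd 1" by (rule dvd_mult_left)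
  obtain b where b: "a * b = 1" "b dvd 1" by (rule unit_inverse_exists[OF unit])
  have mem: "(*) a ` L \<in> carrier (lat_group scale \<Lambda>1)"
    by (rule image_in_lat_group[OF order1 L unit])
  have "(*) a ` L \<subseteq> \<Lambda>1"
    using lat_mult_mem[OF a, of _ L] LM by auto
  moreover have "1 - a * u \<in> C"
  proof -
    have "1 - a * u = of_nat N * (of_nat 2 * l)" unfolding eq[symmetric] by simp
    then show ?thesis using N(2)[OF of_nat_mult_mem[OF sub1 l, of 2]] by simp
  qed
  ultimately obtain L2 where L2: "L2 \<in> carrier (lat_group scale \<Lambda>2)" "lat_mult \<Lambda>1 L2 = (*) a ` L"
    using extension_surj_coprime[OF mem] u by blast
  have "lat_mult \<Lambda>1 ((*) b ` L2) = (*) b ` (*) a ` L"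
    using lat_mult_image_right[OF full_add_subgroup[OF lat_group_full[OF order2 L2(1)]]] L2(2) by simp
  also have "\<dots> = L" by (rule image_mult_unit_inverse) (use b(1) in \<open>simp add: mult.commute\<close>)
  finally show ?thesis using image_in_lat_group[OF order2 L2(1) b(2)] by blast
qed

section \<open>Gluing\<close>

lemma loc_ideal:
  assumes p: "prime p"
  shows "x \<in> loc scale p C \<Longrightarrow> y \<in> loc scale p \<Lambda>1 \<Longrightarrow> x * y \<in> loc scale p C"
  by (rule loc_mult[OF C_sub sub1 C_sub p]) (auto intro: C_mult)

lemma lift_exists:
  assumes a: "\<And>p. p \<in> P0 \<Longrightarrow> a p \<in> loc scale p \<Lambda>1"
  shows "\<exists>b\<in>\<Lambda>1. \<forall>p\<in>P0. b - a p \<in> loc scale p C"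
proof -
  obtain N where N: "N > 0" "\<And>x. x \<in> \<Lambda>1 \<Longrightarrow> of_nat N * x \<in> C"
    by (rule C_multiple) (rule that)
  obtain b where b: "b \<in> \<Lambda>1" "\<forall>p\<in>P0. b - a p \<in> loc scale p ((*) (of_nat N) ` \<Lambda>1)"
    using strong_approximation[OF sub1 N(1) finite_P0 P0_prime a] by blast
  have "(*) (of_nat N) ` \<Lambda>1 \<subseteq> C" using N(2) by blast
  then have "loc scale p ((*) (of_nat N) ` \<Lambda>1) \<subseteq> loc scale p C" for p by (rule loc_mono)
  then show ?thesis using b by blast
qed

text \<open>Lifting the inverse tuple as well gives \<open>b'\<close> such that \<open>b b' - 1\<close> lies in \<open>C\<close> at every
  prime, hence globally.\<close>

lemma lift_unit_mod:
  assumes a: "\<And>p. p \<in> P0 \<Longrightarrow> a p \<in> loc scale p \<Lambda>1 \<and> (\<exists>y\<in>loc scale p \<Lambda>1. a p * y = 1)"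
    and b: "b \<in> \<Lambda>1" "\<And>p. p \<in> P0 \<Longrightarrow> b - a p \<in> loc scale p C"
  shows "unit_mod_C b"
proof -
  have "\<forall>p\<in>P0. \<exists>y\<in>loc scale p \<Lambda>1. a p * y = 1" using a by blast
  then obtain a' where a': "\<And>p. p \<in> P0 \<Longrightarrow> a' p \<in> loc scale p \<Lambda>1" "\<And>p. p \<in> P0 \<Longrightarrow> a p * a' p = 1"
    by metis
  obtain b' where b': "b' \<in> \<Lambda>1" "\<forall>p\<in>P0. b' - a' p \<in> loc scale p C"
    using lift_exists[of a'] a'(1) by blast
  have "b * b' - 1 \<in> C"
  proof (rule local_global[OF C_sub])
    fix p :: nat assume p: "prime p"
    show "b * b' - 1 \<in> loc scale p C"
    proof (cases "p \<in> P0")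
      case True
      have "(b - a p) * b' + (b' - a' p) * a p \<in> loc scale p C"
        using loc_superset[OF sub1 p] b' b(2)[OF True] a[OF True] True
        by (intro zmod.subspace_add[OF add_subgroup_loc[OF C_sub p]] loc_ideal[OF p]) auto
      moreover have "(b - a p) * b' + (b' - a' p) * a p = b * b' - a p * a' p"
        by (simp add: algebra_simps)
      ultimately show ?thesis using a'(2)[OF True] by simp
    next
      case False
      have "b * b' - 1 \<in> \<Lambda>1"
        by (intro zmod.subspace_diff[OF sub1] order_mult[OF order1] order_one[OF order1] b b')
      then show ?thesis using loc_superset[OF sub1 p] loc_C_outside(1)[OF p False] by auto
    qed
  qed
  then show ?thesis by (rule unit_mod_CI[OF b(1) b'(1)])
qed

text \<open>Once \<open>(b + c) y = 1 - N l\<close>, with \<open>N\<close> divisible by all primes of \<open>P0\<close>, the right-hand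
  side is invertible at each of these primes.\<close>

lemma unit_mod_has_local_units:
  assumes b: "unit_mod_C b"
  shows "\<exists>c\<in>C. \<forall>p\<in>P0. \<exists>y\<in>loc scale p \<Lambda>1. (b + c) * y = 1"
proof -
  obtain N where N: "N > 0" "\<And>x. x \<in> \<Lambda>1 \<Longrightarrow> of_nat N * x \<in> C"
    by (rule C_multiple) (rule that)
  obtain b' where b': "b \<in> \<Lambda>1" "b' \<in> \<Lambda>1" "b * b' - 1 \<in> C" using b unfolding unit_mod_C_def by blast
  obtain c y l where c: "c \<in> C" and y: "y \<in> \<Lambda>1" and l: "l \<in> \<Lambda>1" and eq: "(b + c) * y + of_nat N * l = 1"
    by (rule unit_lift_mod[OF order1 N(1) C_ideal b'])
  have "\<exists>y\<in>loc scale p \<Lambda>1. (b + c) * y = 1" if p: "p \<in> P0" for p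
  proof -
    note pp = P0_prime[OF p]
    obtain w where w: "w \<in> loc scale p \<Lambda>1" "(1 - of_nat N * l) * w = 1"
      using loc_one_minus_multiple_inverse[OF order1 l pp P0_dvd[OF N(2) p] N(1)] by blast
    have "(b + c) * y = 1 - of_nat N * l" unfolding eq[symmetric] by simp
    then have "(b + c) * (y * w) = 1" using w(2) by (simp add: mult.assoc[symmetric])
    moreover have "y * w \<in> loc scale p \<Lambda>1"
      using is_subringD(3)[OF is_subring_loc[OF order_is_subring[OF order1] pp]]
        loc_superset[OF sub1 pp] y w(1) by blast
    ultimately show ?thesis by blast
  qed
  then show ?thesis using c by blast
qed

text \<open>At \<open>p \<in> P0\<close>, \<open>b\<close> and the unit \<open>a p\<close> differ by an element of the localized conductor,
  which is an ideal and is therefore preserved by \<open>a p\<close>. Outside \<open>P0\<close> the localizations of \<open>C\<close>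
  and \<open>\<Lambda>1\<close> agree, and with them that of everything in between.\<close>

lemma loc_K:
  assumes a: "\<And>p. p \<in> P0 \<Longrightarrow> a p \<in> loc scale p \<Lambda>1 \<and> (\<exists>y\<in>loc scale p \<Lambda>1. a p * y = 1)"
    and b: "b \<in> \<Lambda>1" "\<And>p. p \<in> P0 \<Longrightarrow> b - a p \<in> loc scale p C" and p: "prime p"
  shows "loc scale p (K b) = (*) (ext_one P0 a p) ` loc scale p \<Lambda>2"
proof (cases "p \<in> P0")
  case False
  have "loc scale p (K b) = loc scale p \<Lambda>2"
    using loc_mono[OF K_subset[OF b(1)], of p] loc_mono[OF C_subset_K, of p b] loc_C_outside[OF p False] by blast
  then show ?thesis using False by (simp add: ext_one_def image_mult_one)
next
  case True
  obtain y where y: "y \<in> loc scale p \<Lambda>1" "a p * y = 1" and ap: "a p \<in> loc scale p \<Lambda>1"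
    using a[OF True] by blast
  note bC = b(2)[OF True]
  note s2 = add_subgroup_loc[OF sub2 p]
  have C2: "loc scale p C \<subseteq> loc scale p \<Lambda>2" by (rule loc_mono[OF C_subset2])
  let ?I = "(*) (a p) ` loc scale p \<Lambda>2"
  have Is: "add_subgroup ?I" by (rule add_subgroup_image_mult[OF s2])
  have CI: "x \<in> ?I" if x: "x \<in> loc scale p C" for x
  proof -
    have "x = a p * (x * y)" using y(2) by (metis mult.left_commute mult.right_neutral)
    moreover have "x * y \<in> loc scale p \<Lambda>2" using loc_ideal[OF p x y(1)] C2 by blast
    ultimately show ?thesis by blast
  qed
  have "loc scale p (K b) \<subseteq> ?I"
  proof
    fix x assume "x \<in> loc scale p (K b)"
    then obtain n where n: "\<not> p dvd n" "of_nat n * x \<in> K b" using mem_loc_iff[OF K_sub p] by blast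
    then obtain c z where cz: "of_nat n * x = c + b * z" "c \<in> C" "z \<in> \<Lambda>2" unfolding K_def by blast
    have z1: "z \<in> loc scale p \<Lambda>1" "z \<in> loc scale p \<Lambda>2"
      using loc_superset[OF sub1 p] loc_superset[OF sub2 p] cz(3) sub by auto
    have "c + (b - a p) * z \<in> ?I"
      using loc_superset[OF C_sub p] cz(2) loc_ideal[OF p bC z1(1)]
      by (intro zmod.subspace_add[OF Is] CI) auto
    moreover have "a p * z \<in> ?I" using z1(2) by blast
    ultimately have "c + (b - a p) * z + a p * z \<in> ?I" by (rule zmod.subspace_add[OF Is])
    then have "of_nat n * x \<in> ?I" unfolding cz(1) by (simp add: algebra_simps)
    then obtain w where w: "w \<in> loc scale p \<Lambda>2" "of_nat n * x = a p * w" by blast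
    have "of_nat n * (y * x) = y * (of_nat n * x)" by (simp only: ac_simps)
    also have "\<dots> = (a p * y) * w" unfolding w(2) by (simp only: ac_simps)
    finally have "of_nat n * (y * x) = w" unfolding y(2) by simp
    then have "of_nat n * (y * x) \<in> loc scale p \<Lambda>2" using w(1) by simp
    then have "y * x \<in> loc scale p \<Lambda>2" by (rule loc_divide[OF sub2 p n(1)])
    moreover have "x = a p * (y * x)" using y(2) by (simp add: mult.assoc[symmetric])
    ultimately show "x \<in> ?I" by blast
  qed
  moreover have "?I \<subseteq> loc scale p (K b)"
  proof
    fix x assume "x \<in> ?I"
    then obtain z where z: "z \<in> loc scale p \<Lambda>2" "x = a p * z" by blast
    have "z \<in> loc scale p \<Lambda>1" using z(1) loc_mono[OF sub, of p] by blast
    then have "(b - a p) * z \<in> loc scale p C" by (rule loc_ideal[OF p bC])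
    then have 1: "(b - a p) * z \<in> loc scale p (K b)" using loc_mono[OF C_subset_K, of p b] by blast
    have 2: "b * z \<in> loc scale p (K b)"
    proof -
      obtain n where n: "\<not> p dvd n" "of_nat n * z \<in> \<Lambda>2" using z(1) mem_loc_iff[OF sub2 p] by blast
      have "of_nat n * (b * z) \<in> K b" using mult_mem_K[OF n(2), of b] by (simp add: mult_ac)
      then show ?thesis using n(1) mem_loc_iff[OF K_sub p] by blast
    qed
    have "b * z - (b - a p) * z \<in> loc scale p (K b)"
      by (rule zmod.subspace_diff[OF add_subgroup_loc[OF K_sub p] 2 1])
    then show "x \<in> loc scale p (K b)" unfolding z(2) by (simp add: algebra_simps)
  qed
  ultimately show ?thesis using True by (simp add: ext_one_def)
qed

text \<open>A subgroup is the intersection of its localizations.\<close>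

lemma glue_eq_K:
  assumes a: "\<And>p. p \<in> P0 \<Longrightarrow> a p \<in> loc scale p \<Lambda>1 \<and> (\<exists>y\<in>loc scale p \<Lambda>1. a p * y = 1)"
    and b: "b \<in> \<Lambda>1" "\<And>p. p \<in> P0 \<Longrightarrow> b - a p \<in> loc scale p C"
  shows "glue scale P0 \<Lambda>2 a = K b"
proof -
  have "glue scale P0 \<Lambda>2 a = (\<Inter>p\<in>{p. prime p}. loc scale p (K b))"
    unfolding glue_def using loc_K[OF a b] by simp
  also have "\<dots> = K b"
  proof
    show "(\<Inter>p\<in>{p. prime p}. loc scale p (K b)) \<subseteq> K b"
    proof
      fix x assume "x \<in> (\<Inter>p\<in>{p. prime p}. loc scale p (K b))"
      then have "x \<in> loc scale p (K b)" if "prime p" for p using that by simp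
      then show "x \<in> K b" by (rule local_global[OF K_sub])
    qed
    show "K b \<subseteq> (\<Inter>p\<in>{p. prime p}. loc scale p (K b))"
      using loc_superset[OF K_sub] by blast
  qed
  finally show ?thesis .
qed

end

section \<open>Determinants of small and of integral matrices\<close>

text \<open>Each of the \<open>n!\<close> products in the Leibniz formula has at least one factor, all of them
  bounded by \<open>h \<le> 1\<close>.\<close>

lemma abs_det_le:
  fixes A :: "rat mat"
  assumes A: "A \<in> carrier_mat n n" and n: "n > 0" and h: "h \<le> 1"
    and entries: "\<And>i j. i < n \<Longrightarrow> j < n \<Longrightarrow> \<bar>A $$ (i, j)\<bar> \<le> h"
  shows "\<bar>Determinant.det A\<bar> \<le> fact n * h"
proof -
  let ?P = "{p. p permutes {0..<n}}"
  have h0: "0 \<le> h" using entries[OF n n] by (meson abs_ge_zero order_trans)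
  have "\<bar>of_int (sign p) * (\<Prod>i = 0..<n. A $$ (i, p i))\<bar> \<le> h" if p: "p \<in> ?P" for p
  proof -
    have "\<bar>of_int (sign p) * (\<Prod>i = 0..<n. A $$ (i, p i))\<bar> = (\<Prod>i = 0..<n. \<bar>A $$ (i, p i)\<bar>)"
      by (simp add: abs_mult abs_prod sign_def)
    also have "\<dots> \<le> (\<Prod>i = 0..<n. h)"
      using p permutes_in_image[of p "{0..<n}"] by (intro prod_mono) (auto intro!: entries)
    also have "\<dots> = h ^ n" by simp
    also have "\<dots> \<le> h ^ 1" by (rule power_decreasing) (use n h h0 in auto)
    finally show ?thesis by simp
  qed
  then have "\<bar>Determinant.det A\<bar> \<le> of_nat (card ?P) * h"
    unfolding Determinant.det_def'[OF A]
    by (intro order_trans[OF sum_abs] sum_bounded_above) auto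
  also have "card ?P = fact n" by (rule card_permutations) auto
  finally show ?thesis by simp
qed

lemma det_in_Ints:
  fixes A :: "rat mat"
  assumes A: "A \<in> carrier_mat n n"
    and entries: "\<And>i j. i < n \<Longrightarrow> j < n \<Longrightarrow> A $$ (i, j) \<in> \<int>"
  shows "Determinant.det A \<in> \<int>"
  unfolding Determinant.det_def'[OF A]
proof (intro Ints_sum Ints_mult Ints_of_int Ints_prod)
  fix p i assume "p \<in> {p. p permutes {0..<n}}" "i \<in> {0..<n}"
  then show "A $$ (i, p i) \<in> \<int>" using permutes_in_image[of p "{0..<n}"] by (auto intro!: entries)
qed

text \<open>Dirichlet's theorem for real numbers, read for rational ones.\<close>

lemma rat_simultaneous_approximation:
  fixes a :: "nat \<Rightarrow> rat"
  assumes "Q > 0"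
  obtains t :: nat and m :: "nat \<Rightarrow> int" where "t > 0" "t \<le> Q ^ n"
    "\<And>i. i < n \<Longrightarrow> \<bar>of_nat t * a i - of_int (m i)\<bar> < 1 / of_nat Q"
proof -
  obtain q p where q: "0 < q" "q \<le> int (Q ^ n)"
    and p: "\<And>i. i < n \<Longrightarrow> \<bar>of_int q * real_of_rat (a i) - of_int (p i)\<bar> < 1 / Q"
    by (rule Dirichlet_approx_simult[OF assms, of n "\<lambda>i. of_rat (a i)"]) (rule that)
  have "\<bar>of_nat (nat q) * a i - of_int (p i)\<bar> < 1 / of_nat Q" if i: "i < n" for i
  proof -
    let ?x = "of_nat (nat q) * a i - of_int (p i)"
    have x: "real_of_rat ?x = of_int q * real_of_rat (a i) - of_int (p i)"
      using q(1) by (simp add: of_rat_diff of_rat_mult)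
    have "real_of_rat \<bar>?x\<bar> = \<bar>real_of_rat ?x\<bar>" by simp
    also have "\<dots> < 1 / Q" unfolding x by (rule p[OF i])
    also have "1 / Q = real_of_rat (1 / of_nat Q)" by (simp add: of_rat_divide)
    finally show ?thesis by (simp only: of_rat_less)
  qed
  then show ?thesis using that[of "nat q" p] q by (simp add: nat_le_iff)
qed

section \<open>Nilpotent elements\<close>

definition nilradical :: "'a::comm_ring_1 set" where
  "nilradical = {r. \<exists>k. r ^ k = 0}"

lemma nilradical_mult: "r \<in> nilradical \<Longrightarrow> x * r \<in> nilradical"
  and nilradical_mult': "r \<in> nilradical \<Longrightarrow> r * x \<in> nilradical"
  unfolding nilradical_def mem_Collect_eq power_mult_distrib
  by (metis mult_zero_right, metis mult_zero_left)

lemma nilradical_add: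
  assumes "r \<in> nilradical" "s \<in> nilradical"
  shows "r + s \<in> nilradical"
proof -
  obtain k l where k: "r ^ k = 0" and l: "s ^ l = 0" using assms unfolding nilradical_def by auto
  have "of_nat (k + l choose i) * r ^ i * s ^ (k + l - i) = 0" if "i \<le> k + l" for i
  proof (cases "i \<ge> k")
    case True
    then have "r ^ i = r ^ k * r ^ (i - k)" by (simp flip: power_add)
    then show ?thesis using k by simp
  next
    case False
    then have "k + l - i = l + (k - i)" by simp
    then have "s ^ (k + l - i) = s ^ l * s ^ (k - i)" by (simp only: power_add)
    then show ?thesis using l by simp
  qed
  then have "(r + s) ^ (k + l) = 0" unfolding binomial_ring by (intro sum.neutral) auto
  then show ?thesis unfolding nilradical_def by blast
qed

lemma add_subgroup_nilradical: "add_subgroup nilradical"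
proof (rule add_subgroupI)
  show "0 \<in> nilradical" unfolding nilradical_def by (auto intro: exI[of _ 1])
  fix r s :: 'a assume "r \<in> nilradical" "s \<in> nilradical"
  from nilradical_add[OF this(1) nilradical_mult[OF this(2), of "- 1"]] show "r - s \<in> nilradical" by simp
qed

text \<open>The geometric series is finite, so the inverse stays in the subring.\<close>

lemma one_minus_nilpotent_inverse:
  assumes \<Lambda>: "add_subgroup \<Lambda>" "1 \<in> \<Lambda>" "\<And>x y. x \<in> \<Lambda> \<Longrightarrow> y \<in> \<Lambda> \<Longrightarrow> x * y \<in> \<Lambda>"
    and r: "r \<in> nilradical" "r \<in> \<Lambda>"
  shows "\<exists>v\<in>\<Lambda>. (1 - r) * v = 1"
proof -
  obtain k where k: "r ^ k = 0" using r unfolding nilradical_def by auto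
  have pow: "r ^ i \<in> \<Lambda>" for i by (induction i) (auto intro: \<Lambda> r)
  have "(1 - r) * (\<Sum>i<k. r ^ i) = 1" using one_diff_power_eq[of r k] k by simp
  moreover have "(\<Sum>i<k. r ^ i) \<in> \<Lambda>" by (rule zmod.subspace_sum[OF \<Lambda>(1) pow])
  ultimately show ?thesis by blast
qed

section \<open>Generators of lattices up to bounded index and nilpotents\<close>

context fin_dim_comm_rat_algebra
begin

lemma nilradical_cancel:
  assumes "n > 0" "of_nat n * r \<in> nilradical"
  shows "(r::'a) \<in> nilradical"
proof -
  have "scale (1 / of_nat n) 1 * (of_nat n * r) \<in> nilradical" by (rule nilradical_mult[OF assms(2)])
  moreover have "scale (1 / of_nat n) 1 * (of_nat n * r) = r"
    using assms(1) by (simp add: scale_mult_left scale_of_nat[symmetric])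
  ultimately show ?thesis by simp
qed

text \<open>The assumption on \<open>e\<close> says that every element of \<open>e A\<close> is nilpotent or invertible there.
  The determinant \<open>\<nu>\<close> of multiplication on \<open>e A\<close> is multiplicative and has bounded
  denominators on \<open>L\<close>, so among the \<open>\<alpha>0 \<in> L\<close> with \<open>e \<alpha>0\<close> not nilpotent there is one of least
  norm, and it has an inverse \<open>y0\<close> in \<open>e A\<close>. For \<open>\<beta> \<in> L\<close>, Dirichlet approximation of the
  coordinates of \<open>a = e \<beta> y0\<close> gives a number \<open>t\<close>, bounded independently of \<open>L\<close>, and \<open>l \<in> \<Lambda>\<close>
  such that \<open>s = t a - l\<close> has norm less than \<open>1\<close>. Then \<open>t \<beta> - \<alpha>0 l \<in> L\<close> has smaller norm than
  \<open>\<alpha>0\<close>, so it is nilpotent on \<open>e A\<close>: up to nilpotents, \<open>t e \<beta>\<close> is a multiple of \<open>\<alpha>0\<close>.\<close>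

lemma primitive_idempotent_generator:
  assumes \<Lambda>: "is_order scale \<Lambda>" and e: "e * e = e" "e \<noteq> 0"
    and prim: "\<And>x. e * x \<in> nilradical \<or> (\<exists>y. e * x * y = e)"
  shows "\<exists>D>0. \<forall>L. full_lattice scale L \<and> (\<forall>x\<in>L. \<forall>y\<in>\<Lambda>. x * y \<in> L) \<longrightarrow>
    (\<exists>\<alpha>\<in>L. (\<exists>y. \<alpha> * y = e) \<and> e * \<alpha> = \<alpha> \<and>
      (\<forall>\<beta>\<in>L. \<exists>l\<in>\<Lambda>. \<exists>r\<in>nilradical. of_nat D * (e * \<beta>) = \<alpha> * l + r))"
proof -
  obtain Bas where "finite_dimensional_vector_space scale Bas"
    using finite_dimensional_basis by blast
  then interpret fd: finite_dimensional_vector_space scale Bas .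
  define V where "V = range (\<lambda>x. e * x)"
  obtain B where B: "B \<subseteq> V" "independent B" "V \<subseteq> span B"
    by (rule maximal_independent_subset)
  have finB: "finite B" by (rule fd.finiteI_independent[OF B(2)])
  define n where "n = card B"
  obtain b where b: "bij_betw b {0..<n} B"
    unfolding n_def using ex_bij_betw_nat_finite[OF finB] by blast
  have bB: "b k \<in> B" if "k < n" for k using b that by (auto simp: bij_betw_def)
  have b_inj: "b i = b j \<longleftrightarrow> i = j" if "i < n" "j < n" for i j
    using b that by (auto simp: bij_betw_def inj_on_def)
  have V_iff: "x \<in> V \<longleftrightarrow> e * x = x" for x
  proof
    assume "x \<in> V"
    then obtain z where "x = e * z" unfolding V_def by blast
    then show "e * x = x" using e(1) by (simp add: mult.assoc[symmetric])
  next
    assume "e * x = x"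
    then show "x \<in> V" unfolding V_def by (metis rangeI)
  qed
  have eb: "e * b k = b k" if "k < n" for k using bB[OF that] B(1) V_iff by blast
  have V_mult: "x * y \<in> V" if "y \<in> V" for x y
    using that unfolding V_iff by (simp add: mult.left_commute[of e])
  have bV: "b k \<in> V" if "k < n" for k using bB[OF that] B(1) by blast
  have xb: "x * b k \<in> span B" if "k < n" for x k using V_mult[OF bV[OF that]] B(3) by blast
  define r where "r i y = representation B y (b i)" for i y
  have expand: "(\<Sum>k<n. scale (r k y) (b k)) = y" if "y \<in> V" for y
  proof -
    have "y = (\<Sum>c\<in>B. scale (representation B y c) c)"
      by (rule sum_representation_eq[OF B(2) _ finB subset_refl, symmetric]) (use B(3) that in blast)
    also have "\<dots> = (\<Sum>k\<in>{0..<n}. scale (r k y) (b k))"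
      unfolding r_def by (rule sum.reindex_bij_betw[OF b, symmetric])
    finally show ?thesis by (simp add: atLeast0LessThan)
  qed
  have "e \<in> V" using V_iff e(1) by simp
  have n0: "n > 0"
  proof (rule ccontr)
    assume "\<not> n > 0"
    then have "e = 0" using expand[OF \<open>e \<in> V\<close>] by simp
    then show False using e(2) by simp
  qed
  have r_comb: "r i (\<Sum>k<n. scale (s k) (x k)) = (\<Sum>k<n. s k * r i (x k))"
    if "\<And>k. k < n \<Longrightarrow> x k \<in> span B" for i s x
  proof -
    have "representation B (\<Sum>k<n. scale (s k) (x k)) = (\<lambda>c. \<Sum>k<n. representation B (scale (s k) (x k)) c)"
      by (rule representation_sum[OF B(2)]) (use that in \<open>auto intro: span_scale\<close>)
    then show ?thesis
      unfolding r_def using that by (simp add: representation_scale[OF B(2)])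
  qed
  \<comment> \<open>the matrix of multiplication by \<open>x\<close> on \<open>e A\<close>\<close>
  define M where "M x = Matrix.mat n n (\<lambda>(i, j). r i (x * b j))" for x
  have M_car: "M x \<in> carrier_mat n n" for x unfolding M_def by simp
  have M_entry: "M x $$ (i, j) = r i (x * b j)" if "i < n" "j < n" for x i j
    unfolding M_def using that by simp
  have M_mult: "M (x * y) = M x * M y" for x y
  proof (rule eq_matI)
    fix i j assume ij: "i < dim_row (M x * M y)" "j < dim_col (M x * M y)"
    then have ij: "i < n" "j < n" using M_car[of x] M_car[of y] by auto
    have "x * y * b j = x * (\<Sum>k<n. scale (r k (y * b j)) (b k))"
      using expand[OF V_mult[OF bV[OF ij(2)], of y]] by (simp add: mult.assoc)
    also have "\<dots> = (\<Sum>k<n. scale (r k (y * b j)) (x * b k))"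
      by (simp add: sum_distrib_left scale_mult_right)
    finally have "r i (x * y * b j) = (\<Sum>k<n. r k (y * b j) * r i (x * b k))"
      using r_comb[of "\<lambda>k. x * b k"] xb by simp
    then show "M (x * y) $$ (i, j) = (M x * M y) $$ (i, j)"
      using ij by (simp add: M_def scalar_prod_def atLeast0LessThan mult.commute)
  qed (simp_all add: M_def)
  have M_e: "M e = 1\<^sub>m n"
  proof (rule eq_matI)
    fix i j assume "i < dim_row (1\<^sub>m n :: rat mat)" "j < dim_col (1\<^sub>m n :: rat mat)"
    then have ij: "i < n" "j < n" by auto
    have "r i (e * b j) = (if b i = b j then 1 else 0)"
      unfolding eb[OF ij(2)] r_def representation_basis[OF B(2) bB[OF ij(2)]] by simp
    then show "M e $$ (i, j) = 1\<^sub>m n $$ (i, j)"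
      using ij b_inj[OF ij] by (simp add: M_entry)
  qed (simp_all add: M_def)
  define \<nu> where "\<nu> x = Determinant.det (M x)" for x
  have \<nu>_mult: "\<nu> (x * y) = \<nu> x * \<nu> y" for x y
    unfolding \<nu>_def M_mult by (rule Determinant.det_mult[OF M_car M_car])
  have \<nu>_e: "\<nu> e = 1" unfolding \<nu>_def M_e by simp
  have \<nu>_e_mult: "\<nu> (e * x) = \<nu> x" for x unfolding \<nu>_mult \<nu>_e by simp
  \<comment> \<open>the structure constants are bounded by \<open>c\<close>\<close>
  define c where "c = Suc (nat \<lceil>\<Sum>i<n. \<Sum>j<n. \<Sum>k<n. \<bar>r i (b k * b j)\<bar>\<rceil>)"
  have c: "\<bar>r i (b k * b j)\<bar> \<le> of_nat c" if ijk: "i < n" "j < n" "k < n" for i j k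
  proof -
    have "\<bar>r i (b k * b j)\<bar> \<le> (\<Sum>k<n. \<bar>r i (b k * b j)\<bar>)"
      by (rule member_le_sum) (use ijk in auto)
    also have "\<dots> \<le> (\<Sum>j<n. \<Sum>k<n. \<bar>r i (b k * b j)\<bar>)"
      by (rule member_le_sum[of j _ "\<lambda>j. \<Sum>k<n. \<bar>r i (b k * b j)\<bar>"]) (use ijk in \<open>auto intro: sum_nonneg\<close>)
    also have "\<dots> \<le> (\<Sum>i<n. \<Sum>j<n. \<Sum>k<n. \<bar>r i (b k * b j)\<bar>)"
      by (rule member_le_sum[of i _ "\<lambda>i. \<Sum>j<n. \<Sum>k<n. \<bar>r i (b k * b j)\<bar>"])
        (use ijk in \<open>auto intro: sum_nonneg\<close>)
    also have "\<dots> \<le> of_nat c" unfolding c_def by linarith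
    finally show ?thesis .
  qed
  have c0: "c > 0" unfolding c_def by simp
  have "\<exists>m>0. \<forall>k<n. of_nat m * b k \<in> \<Lambda>"
  proof -
    have "\<exists>m>0. \<forall>k<j. of_nat m * b k \<in> \<Lambda>" for j
    proof (induction j)
      case (Suc j)
      then obtain m where m: "m > 0" "\<forall>k<j. of_nat m * b k \<in> \<Lambda>" by blast
      obtain m' where m': "m' > 0" "of_nat m' * b j \<in> \<Lambda>" using full_multiple[OF order_full[OF \<Lambda>]] by blast
      have "of_nat (m * m') * b k \<in> \<Lambda>" if "k < Suc j" for k
      proof (cases "k = j")
        case True
        then show ?thesis
          using of_nat_mult_mem[OF order_add_subgroup[OF \<Lambda>] m'(2), of m] by (simp add: mult.assoc)
      next
        case False
        then have "of_nat m * b k \<in> \<Lambda>" using m(2) that by simp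
        from of_nat_mult_mem[OF order_add_subgroup[OF \<Lambda>] this, of m'] show ?thesis by (simp add: mult_ac)
      qed
      then show ?case using m(1) m'(1) by (intro exI[of _ "m * m'"]) simp
    qed auto
    then show ?thesis .
  qed
  then obtain m where m: "m > 0" "\<And>k. k < n \<Longrightarrow> of_nat m * b k \<in> \<Lambda>" by blast
  obtain q where q: "q > 0" "of_nat q * e \<in> \<Lambda>" using full_multiple[OF order_full[OF \<Lambda>]] by blast
  \<comment> \<open>chosen so that a combination of basis vectors with coefficients at most \<open>m / Q\<close>
    multiplies \<open>e A\<close> by a matrix with entries at most \<open>1 / (2 n!)\<close>, hence with determinant
    below \<open>1\<close>\<close>
  define Q where "Q = m * n * c * fact n * 2"
  have Q0: "Q > 0" unfolding Q_def c_def using m(1) n0 by simp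
  have small: "\<bar>\<nu> s\<bar> < 1"
    if s: "s = (\<Sum>k<n. scale (\<sigma> k) (b k))" and \<sigma>: "\<And>k. k < n \<Longrightarrow> \<bar>\<sigma> k\<bar> \<le> of_nat m / of_nat Q" for s \<sigma>
  proof -
    let ?h = "1 / (2 * fact n) :: rat"
    have "\<bar>M s $$ (i, j)\<bar> \<le> ?h" if ij: "i < n" "j < n" for i j
    proof -
      have "s * b j = (\<Sum>k<n. scale (\<sigma> k) (b k * b j))"
        unfolding s by (simp add: sum_distrib_right scale_mult_left)
      then have "M s $$ (i, j) = (\<Sum>k<n. \<sigma> k * r i (b k * b j))"
        using r_comb[of "\<lambda>k. b k * b j"] xb ij by (simp add: M_entry)
      also have "\<bar>\<dots>\<bar> \<le> (\<Sum>k<n. of_nat m / of_nat Q * of_nat c)"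
      proof (rule order_trans[OF sum_abs sum_mono])
        fix k assume "k \<in> {..<n}"
        then show "\<bar>\<sigma> k * r i (b k * b j)\<bar> \<le> of_nat m / of_nat Q * of_nat c"
          unfolding abs_mult using \<sigma>[of k] c[of i j k] ij by (intro mult_mono) auto
      qed
      also have "\<dots> = ?h"
        unfolding Q_def using m(1) n0 c0 by (simp add: field_simps)
      finally show ?thesis .
    qed
    moreover have "?h \<le> 1"
    proof -
      have "(1::rat) \<le> fact n" by (rule fact_ge_1)
      then have "(1::rat) \<le> 2 * fact n" by linarith
      then show ?thesis by (simp add: divide_le_eq)
    qed
    ultimately have "\<bar>\<nu> s\<bar> \<le> fact n * ?h"
      unfolding \<nu>_def by (intro abs_det_le[OF M_car n0])
    then show ?thesis by simp
  qed
  \<comment> \<open>the factorial is divisible by every multiplier \<open>t \<le> Q ^ n\<close>\<close>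
  define D where "D = fact (Q ^ n) * q"
  have "\<exists>\<alpha>\<in>L. (\<exists>y. \<alpha> * y = e) \<and> e * \<alpha> = \<alpha> \<and>
      (\<forall>\<beta>\<in>L. \<exists>l\<in>\<Lambda>. \<exists>r\<in>nilradical. of_nat D * (e * \<beta>) = \<alpha> * l + r)"
    if Lf: "full_lattice scale L" and L\<Lambda>: "\<forall>x\<in>L. \<forall>y\<in>\<Lambda>. x * y \<in> L" for L
  proof -
    note Ls = full_add_subgroup[OF Lf]
    obtain d where d: "d > 0"
      "\<And>ij x. ij \<in> {..<n} \<times> {..<n} \<Longrightarrow> x \<in> L \<Longrightarrow> of_nat d * r (fst ij) (x * b (snd ij)) \<in> \<int>"
    proof (rule full_bounded_denominators[OF Lf, of "{..<n} \<times> {..<n}" "\<lambda>ij x. r (fst ij) (x * b (snd ij))"])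
      fix ij x y assume "ij \<in> {..<n} \<times> {..<n}"
      then have "snd ij < n" by auto
      then show "r (fst ij) ((x - y) * b (snd ij)) = r (fst ij) (x * b (snd ij)) - r (fst ij) (y * b (snd ij))"
        unfolding r_def left_diff_distrib by (simp add: representation_diff[OF B(2) xb xb])
    qed (use that in auto)
    \<comment> \<open>on \<open>L\<close> the floor is exact: \<open>h\<close> is the norm scaled to a natural number\<close>
    define h where "h x = nat \<lfloor>\<bar>of_nat d ^ n * \<nu> x\<bar>\<rfloor>" for x
    have h: "of_nat (h x) = \<bar>of_nat d ^ n * \<nu> x\<bar>" if x: "x \<in> L" for x
    proof -
      have "of_nat d ^ n * \<nu> x = Determinant.det (of_nat d \<cdot>\<^sub>m M x)"
        unfolding \<nu>_def using M_car[of x] by simp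
      also have "\<dots> \<in> \<int>"
        using d(2)[of "(_, _)", OF _ x] by (intro det_in_Ints[of _ n]) (auto simp: M_def)
      finally have "\<bar>of_nat d ^ n * \<nu> x\<bar> \<in> \<int>" by simp
      then show ?thesis unfolding h_def by (auto elim!: Ints_cases)
    qed
    obtain k where k: "k > 0" "of_nat k * 1 \<in> L" using full_multiple[OF Lf] by blast
    have "e * of_nat k \<notin> nilradical"
    proof
      assume "e * of_nat k \<in> nilradical"
      then have "e \<in> nilradical" using nilradical_cancel[OF k(1), of e] by (simp add: mult.commute)
      then obtain i where "e ^ i = 0" unfolding nilradical_def by blast
      moreover have "e ^ Suc i = e" for i by (induction i) (use e in auto)
      ultimately show False using e(2) by (metis mult_zero_right power_Suc)
    qed
    then have "of_nat k \<in> L \<and> e * of_nat k \<notin> nilradical" using k by simp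
    then obtain \<alpha>0 where \<alpha>0: "\<alpha>0 \<in> L" "e * \<alpha>0 \<notin> nilradical"
      and least: "\<And>x. x \<in> L \<Longrightarrow> e * x \<notin> nilradical \<Longrightarrow> h \<alpha>0 \<le> h x"
      using ex_has_least_nat[of "\<lambda>x. x \<in> L \<and> e * x \<notin> nilradical" "of_nat k" h] by blast
    obtain y0 where y0: "e * \<alpha>0 * y0 = e" using prim \<alpha>0(2) by blast
    have "\<nu> (e * \<alpha>0 * y0) = 1" using y0 \<nu>_e by simp
    then have \<nu>\<alpha>: "\<nu> \<alpha>0 \<noteq> 0" unfolding \<nu>_mult by auto
    \<comment> \<open>a multiple of \<open>\<alpha>0\<close> that lies in \<open>e A\<close> as well as in \<open>L\<close>\<close>
    define \<alpha> where "\<alpha> = \<alpha>0 * (of_nat q * e)"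
    have "\<alpha> \<in> L" unfolding \<alpha>_def using L\<Lambda> \<alpha>0(1) q(2) by blast
    moreover have "\<exists>y. \<alpha> * y = e"
    proof -
      have "\<alpha> * (scale (1 / of_nat q) 1 * y0) = (of_nat q * scale (1 / of_nat q) 1) * (e * \<alpha>0 * y0)"
        unfolding \<alpha>_def by (simp only: ac_simps)
      also have "\<dots> = e" unfolding y0 of_nat_mult_scale_inverse[OF q(1)] by simp
      finally show ?thesis by blast
    qed
    moreover have "e * \<alpha> = \<alpha>" unfolding \<alpha>_def using e(1) by (metis mult.assoc mult.commute)
    moreover have "\<exists>l\<in>\<Lambda>. \<exists>r\<in>nilradical. of_nat D * (e * \<beta>) = \<alpha> * l + r" if \<beta>: "\<beta> \<in> L" for \<beta>
    proof -
      define a where "a = e * \<beta> * y0"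
      have aV: "a \<in> V" unfolding a_def V_def by (simp add: mult.assoc)
      obtain t and z :: "nat \<Rightarrow> int" where t: "t > 0" "t \<le> Q ^ n"
        and z: "\<And>i. i < n \<Longrightarrow> \<bar>of_nat t * (r i a / of_nat m) - of_int (z i)\<bar> < 1 / of_nat Q"
        by (rule rat_simultaneous_approximation[OF Q0, of n "\<lambda>i. r i a / of_nat m"]) (rule that)
      define l where "l = (\<Sum>i<n. of_int (z i) * (of_nat m * b i))"
      have l: "l \<in> \<Lambda>"
        unfolding l_def
        by (intro zmod.subspace_sum[OF order_add_subgroup[OF \<Lambda>]] zmod.subspace_scale[OF order_add_subgroup[OF \<Lambda>]] m)
          simp
      have el: "e * l = l"
        unfolding l_def sum_distrib_left by (rule sum.cong) (auto simp: mult.left_commute[of e] eb)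
      define s where "s = of_nat t * a - l"
      have "s = of_nat t * (\<Sum>i<n. scale (r i a) (b i)) - l"
        unfolding s_def expand[OF aV] ..
      also have "\<dots> = (\<Sum>i<n. scale (of_nat t * r i a - of_int (z i) * of_nat m) (b i))"
        unfolding l_def
        by (simp add: sum_distrib_left scale_left_diff_distrib scale_of_nat[symmetric] scale_of_int[symmetric]
            sum_subtractf mult.assoc)
      finally have s_eq: "s = (\<Sum>i<n. scale (of_nat t * r i a - of_int (z i) * of_nat m) (b i))" .
      have "\<bar>of_nat t * r i a - of_int (z i) * of_nat m\<bar> \<le> of_nat m / of_nat Q" if i: "i < n" for i
      proof -
        have "of_nat t * r i a - of_int (z i) * of_nat m
            = of_nat m * (of_nat t * (r i a / of_nat m) - of_int (z i))"
          using m(1) by (simp add: field_simps)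
        also have "\<bar>\<dots>\<bar> \<le> of_nat m * (1 / of_nat Q)"
          unfolding abs_mult using z[OF i] by (intro mult_mono) auto
        finally show ?thesis by simp
      qed
      then have \<nu>s: "\<bar>\<nu> s\<bar> < 1" by (rule small[OF s_eq])
      \<comment> \<open>on \<open>e A\<close> this is \<open>\<alpha>0 s\<close>, of smaller norm than \<open>\<alpha>0\<close>\<close>
      define g where "g = of_nat t * \<beta> - \<alpha>0 * l"
      have gL: "g \<in> L"
        unfolding g_def by (intro zmod.subspace_diff[OF Ls] of_nat_mult_mem[OF Ls \<beta>]) (use L\<Lambda> \<alpha>0(1) l in blast)
      have eg: "e * g = \<alpha>0 * s"
      proof -
        have "\<alpha>0 * s = of_nat t * (\<beta> * (e * \<alpha>0 * y0)) - \<alpha>0 * l"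
          unfolding s_def a_def by (simp add: right_diff_distrib mult_ac)
        also have "\<dots> = e * (of_nat t * \<beta>) - \<alpha>0 * (e * l)"
          unfolding y0 el by (simp add: mult_ac)
        also have "\<dots> = e * g"
          unfolding g_def by (simp add: right_diff_distrib mult_ac)
        finally show ?thesis ..
      qed
      have "\<nu> g = \<nu> \<alpha>0 * \<nu> s" using \<nu>_e_mult[of g] unfolding eg \<nu>_mult by simp
      then have "\<bar>of_nat d ^ n * \<nu> g\<bar> = \<bar>of_nat d ^ n * \<nu> \<alpha>0\<bar> * \<bar>\<nu> s\<bar>" by (simp add: abs_mult)
      also have "\<dots> < \<bar>of_nat d ^ n * \<nu> \<alpha>0\<bar> * 1"
        using \<nu>s \<nu>\<alpha> d(1) by (intro mult_strict_left_mono) auto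
      finally have "rat_of_nat (h g) < of_nat (h \<alpha>0)" unfolding h[OF gL] h[OF \<alpha>0(1)] by simp
      then have nil: "e * g \<in> nilradical" using least[OF gL] by (auto simp: not_le[symmetric])
      have "t dvd fact (Q ^ n)" by (rule dvd_fact) (use t in auto)
      then obtain u where u: "fact (Q ^ n) = t * u" by (rule dvdE)
      have teb: "of_nat t * (e * \<beta>) = \<alpha>0 * l + e * g"
      proof -
        have "e * g = of_nat t * (e * \<beta>) - \<alpha>0 * (e * l)"
          unfolding g_def by (simp add: right_diff_distrib mult_ac)
        then show ?thesis unfolding el by simp
      qed
      have "of_nat D * (e * \<beta>) = of_nat (u * q) * (of_nat t * (e * \<beta>))"
        unfolding D_def u by (simp add: mult_ac)
      also have "\<dots> = of_nat (u * q) * (\<alpha>0 * (e * l)) + of_nat (u * q) * (e * g)"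
        unfolding teb el by (simp add: distrib_left)
      also have "of_nat (u * q) * (\<alpha>0 * (e * l)) = \<alpha> * (of_nat u * l)"
        unfolding \<alpha>_def by (simp add: mult_ac)
      finally have "of_nat D * (e * \<beta>) = \<alpha> * (of_nat u * l) + of_nat (u * q) * (e * g)" .
      then show ?thesis
        using of_nat_mult_mem[OF order_add_subgroup[OF \<Lambda>] l] nilradical_mult[OF nil] by blast
    qed
    ultimately show ?thesis by blast
  qed
  moreover have "D > 0" unfolding D_def using q(1) by simp
  ultimately show ?thesis by blast
qed

text \<open>Induction on the dimension of \<open>e A\<close>. If some \<open>e x\<close> is neither nilpotent nor invertible
  in \<open>e A\<close>, Fitting's idempotent \<open>f\<close> of \<open>e x\<close> splits \<open>e\<close> into the proper orthogonal
  idempotents \<open>f\<close> and \<open>g = e - f\<close>. Generators for the two parts are added. Their coefficients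
  \<open>l1\<close>, \<open>l2\<close> are combined into one with the help of \<open>q f\<close> and \<open>q g\<close>, which lie in \<open>\<Lambda>\<close> for a
  suitable \<open>q\<close>.\<close>

lemma idempotent_generator:
  assumes \<Lambda>: "is_order scale \<Lambda>"
  shows "e * e = e \<Longrightarrow> \<exists>D>0. \<forall>L. full_lattice scale L \<and> (\<forall>x\<in>L. \<forall>y\<in>\<Lambda>. x * y \<in> L) \<longrightarrow>
    (\<exists>\<alpha>\<in>L. (\<exists>y. \<alpha> * y = e) \<and> e * \<alpha> = \<alpha> \<and>
      (\<forall>\<beta>\<in>L. \<exists>l\<in>\<Lambda>. \<exists>r\<in>nilradical. of_nat D * (e * \<beta>) = \<alpha> * l + r))"
proof (induction "dim (range ((*) e))" arbitrary: e rule: less_induct)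
  case less
  note e = less.prems
  note \<Lambda>s = order_add_subgroup[OF \<Lambda>]
  have nil0: "0 \<in> nilradical" by (rule zmod.subspace_0[OF add_subgroup_nilradical])
  consider "e = 0" | "e \<noteq> 0" "\<And>x. e * x \<in> nilradical \<or> (\<exists>y. e * x * y = e)"
    | x where "e * x \<notin> nilradical" "\<And>y. e * x * y \<noteq> e"
    by blast
  then show ?case
  proof cases
    case 1
    then show ?thesis
      using nil0 zmod.subspace_0[OF \<Lambda>s] zmod.subspace_0[OF full_add_subgroup] by (intro exI[of _ 1]) auto
  next
    case 2
    then show ?thesis by (intro primitive_idempotent_generator[OF \<Lambda> e])
  next
    case 3
    obtain Bas where "finite_dimensional_vector_space scale Bas"
      using finite_dimensional_basis by blast
    then interpret fd: finite_dimensional_vector_space scale Bas .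
    obtain f w n where f: "f * f = f" "f = e * x * w" "f * (e * x) ^ n = (e * x) ^ n"
      by (rule fitting[of "e * x"]) (rule that)
    have ef: "e * f = f" unfolding f(2) using e by (simp add: mult.assoc[symmetric])
    have f0: "f \<noteq> 0"
    proof
      assume "f = 0"
      then have "(e * x) ^ n = 0" using f(3) by simp
      then show False using 3(1) unfolding nilradical_def by blast
    qed
    have fe: "f \<noteq> e" using f(2) 3(2) by metis
    define g where "g = e - f"
    have g: "g * g = g" "e * g = g" "f * g = 0" "g * f = 0"
      unfolding g_def using e f(1) ef by (simp_all add: algebra_simps)
    have smaller: "dim (range ((*) f)) < dim (range ((*) e))"
      if f: "f * f = f" "e * f = f" "f \<noteq> e" for f
    proof (rule ccontr)
      have sub: "subspace (range ((*) z))" for z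
        by (rule subspaceI) (auto simp: distrib_left[symmetric] scale_mult_right[symmetric] intro: range_eqI[of _ _ 0])
      assume "\<not> ?thesis"
      moreover have "range ((*) f) \<subseteq> range ((*) e)"
      proof
        fix u assume "u \<in> range ((*) f)"
        then obtain v where "u = f * v" by blast
        then have "u = e * (f * v)" using f(2) by (simp add: mult.assoc[symmetric])
        then show "u \<in> range ((*) e)" by blast
      qed
      ultimately have "range ((*) f) = range ((*) e)"
        by (intro fd.subspace_dim_equal[OF sub sub]) auto
      moreover have "e \<in> range ((*) e)" by (rule range_eqI[of _ _ 1]) simp
      ultimately obtain v where "e = f * v" by blast
      then have "f * e = e" using f(1) by (simp add: mult.assoc[symmetric])
      then show False using f(2,3) by (simp add: mult.commute)
    qed
    have ge: "g \<noteq> e" using f0 unfolding g_def by simp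
    obtain D1 where D1: "D1 > 0" and f_gen: "\<And>L. full_lattice scale L \<and> (\<forall>x\<in>L. \<forall>y\<in>\<Lambda>. x * y \<in> L) \<Longrightarrow>
      \<exists>\<alpha>\<in>L. (\<exists>y. \<alpha> * y = f) \<and> f * \<alpha> = \<alpha> \<and>
      (\<forall>\<beta>\<in>L. \<exists>l\<in>\<Lambda>. \<exists>r\<in>nilradical. of_nat D1 * (f * \<beta>) = \<alpha> * l + r)"
      using less.hyps[OF smaller[OF f(1) ef fe] f(1)] by blast
    obtain D2 where D2: "D2 > 0" and g_gen: "\<And>L. full_lattice scale L \<and> (\<forall>x\<in>L. \<forall>y\<in>\<Lambda>. x * y \<in> L) \<Longrightarrow>
      \<exists>\<alpha>\<in>L. (\<exists>y. \<alpha> * y = g) \<and> g * \<alpha> = \<alpha> \<and>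
      (\<forall>\<beta>\<in>L. \<exists>l\<in>\<Lambda>. \<exists>r\<in>nilradical. of_nat D2 * (g * \<beta>) = \<alpha> * l + r)"
      using less.hyps[OF smaller[OF g(1,2) ge] g(1)] by blast
    obtain q1 where q1: "q1 > 0" "of_nat q1 * f \<in> \<Lambda>" using full_multiple[OF order_full[OF \<Lambda>]] by blast
    obtain q2 where q2: "q2 > 0" "of_nat q2 * g \<in> \<Lambda>" using full_multiple[OF order_full[OF \<Lambda>]] by blast
    define q where "q = q1 * q2"
    have q: "of_nat q * f \<in> \<Lambda>" "of_nat q * g \<in> \<Lambda>" "q > 0"
      unfolding q_def using of_nat_mult_mem[OF \<Lambda>s q1(2), of q2] of_nat_mult_mem[OF \<Lambda>s q2(2), of q1] q1(1) q2(1)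
      by (simp_all add: mult_ac)
    have "\<exists>\<alpha>\<in>L. (\<exists>y. \<alpha> * y = e) \<and> e * \<alpha> = \<alpha> \<and>
      (\<forall>\<beta>\<in>L. \<exists>l\<in>\<Lambda>. \<exists>r\<in>nilradical. of_nat (D1 * D2 * q) * (e * \<beta>) = \<alpha> * l + r)"
      if L: "full_lattice scale L \<and> (\<forall>x\<in>L. \<forall>y\<in>\<Lambda>. x * y \<in> L)" for L
    proof -
      obtain \<alpha>1 y1 where \<alpha>1: "\<alpha>1 \<in> L" "\<alpha>1 * y1 = f" "f * \<alpha>1 = \<alpha>1"
        "\<forall>\<beta>\<in>L. \<exists>l\<in>\<Lambda>. \<exists>r\<in>nilradical. of_nat D1 * (f * \<beta>) = \<alpha>1 * l + r"
        using f_gen[OF L] by blast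
      obtain \<alpha>2 y2 where \<alpha>2: "\<alpha>2 \<in> L" "\<alpha>2 * y2 = g" "g * \<alpha>2 = \<alpha>2"
        "\<forall>\<beta>\<in>L. \<exists>l\<in>\<Lambda>. \<exists>r\<in>nilradical. of_nat D2 * (g * \<beta>) = \<alpha>2 * l + r"
        using g_gen[OF L] by blast
      have orth: "\<alpha>1 * g = 0" "\<alpha>2 * f = 0"
        using \<alpha>1(3) \<alpha>2(3) g(3,4) by (metis mult.commute mult.left_commute mult_zero_right)+
      have id: "\<alpha>1 * f = \<alpha>1" "\<alpha>2 * g = \<alpha>2" using \<alpha>1(3) \<alpha>2(3) by (simp_all add: mult.commute)
      have "\<alpha>1 + \<alpha>2 \<in> L"
        using L \<alpha>1(1) \<alpha>2(1) by (intro zmod.subspace_add[OF full_add_subgroup]) auto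
      moreover have "(\<alpha>1 + \<alpha>2) * (f * y1 + g * y2) = e"
      proof -
        have "(\<alpha>1 + \<alpha>2) * (f * y1 + g * y2)
            = (\<alpha>1 * f) * y1 + (\<alpha>1 * g) * y2 + (\<alpha>2 * f) * y1 + (\<alpha>2 * g) * y2"
          by (simp add: algebra_simps)
        also have "\<dots> = f + g" unfolding orth id using \<alpha>1(2) \<alpha>2(2) by simp
        finally show ?thesis unfolding g_def by simp
      qed
      moreover have "e * (\<alpha>1 + \<alpha>2) = \<alpha>1 + \<alpha>2"
      proof -
        have "e * (f * \<alpha>1) = f * \<alpha>1" "e * (g * \<alpha>2) = g * \<alpha>2"
          using ef g(2) by (simp_all add: mult.assoc[symmetric])
        then show ?thesis unfolding \<alpha>1(3) \<alpha>2(3) by (simp add: distrib_left)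
      qed
      moreover have "\<exists>l\<in>\<Lambda>. \<exists>r\<in>nilradical. of_nat (D1 * D2 * q) * (e * \<beta>) = (\<alpha>1 + \<alpha>2) * l + r"
        if \<beta>: "\<beta> \<in> L" for \<beta>
      proof -
        obtain l1 r1 where l1: "l1 \<in> \<Lambda>" "r1 \<in> nilradical" "of_nat D1 * (f * \<beta>) = \<alpha>1 * l1 + r1"
          using \<alpha>1(4) \<beta> by blast
        obtain l2 r2 where l2: "l2 \<in> \<Lambda>" "r2 \<in> nilradical" "of_nat D2 * (g * \<beta>) = \<alpha>2 * l2 + r2"
          using \<alpha>2(4) \<beta> by blast
        define l where "l = (of_nat q * f) * (of_nat D2 * l1) + (of_nat q * g) * (of_nat D1 * l2)"
        have "l \<in> \<Lambda>"
          unfolding l_def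
          by (intro zmod.subspace_add[OF \<Lambda>s] order_mult[OF \<Lambda>] q of_nat_mult_mem[OF \<Lambda>s] l1 l2)
        moreover have "of_nat (q * D2) * r1 + of_nat (q * D1) * r2 \<in> nilradical"
          by (intro nilradical_add nilradical_mult l1 l2)
        moreover have "of_nat (D1 * D2 * q) * (e * \<beta>)
            = (\<alpha>1 + \<alpha>2) * l + (of_nat (q * D2) * r1 + of_nat (q * D1) * r2)"
        proof -
          have "of_nat (D1 * D2 * q) * (e * \<beta>)
              = of_nat (q * D2) * (of_nat D1 * (f * \<beta>)) + of_nat (q * D1) * (of_nat D2 * (g * \<beta>))"
            unfolding g_def by (simp add: algebra_simps)
          also have "\<dots> = of_nat (q * D2) * (\<alpha>1 * l1) + of_nat (q * D1) * (\<alpha>2 * l2)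
              + (of_nat (q * D2) * r1 + of_nat (q * D1) * r2)"
            unfolding l1(3) l2(3) by (simp add: algebra_simps)
          also have "of_nat (q * D2) * (\<alpha>1 * l1) + of_nat (q * D1) * (\<alpha>2 * l2) = (\<alpha>1 + \<alpha>2) * l"
          proof -
            have "(\<alpha>1 + \<alpha>2) * l = of_nat (q * D2) * ((\<alpha>1 * f) * l1) + of_nat (q * D1) * ((\<alpha>1 * g) * l2)
                + of_nat (q * D2) * ((\<alpha>2 * f) * l1) + of_nat (q * D1) * ((\<alpha>2 * g) * l2)"
              unfolding l_def by (simp add: algebra_simps)
            then show ?thesis unfolding orth id by simp
          qed
          finally show ?thesis .
        qed
        ultimately show ?thesis by blast
      qed
      ultimately show ?thesis by blast
    qed
    then show ?thesis using D1 D2 q(3) by (intro exI[of _ "D1 * D2 * q"]) auto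
  qed
qed

section \<open>Finiteness of the class groups\<close>

text \<open>Let \<open>M'\<close> be the inverse of \<open>L'\<close>. The invertible lattice \<open>K = L M'\<close> equals \<open>\<Lambda>\<close> modulo
  nilpotents, so \<open>K\<close> and its inverse contain elements \<open>u\<close> and \<open>m\<close> that are \<open>1\<close> modulo
  nilpotents. Then \<open>u m \<in> \<Lambda>\<close> is a unit of \<open>\<Lambda>\<close>, hence \<open>K = u \<Lambda>\<close> and \<open>L = K L' = u L'\<close>.\<close>

lemma lattices_equal_mod_nilradical:
  assumes \<Lambda>: "is_order scale \<Lambda>" and L: "L \<in> carrier (lat_group scale \<Lambda>)"
    and L': "L' \<in> carrier (lat_group scale \<Lambda>)"
    and sub: "\<forall>x\<in>L. \<exists>y\<in>L'. x - y \<in> nilradical"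
    and sub': "\<forall>x\<in>L'. \<exists>y\<in>L. x - y \<in> nilradical"
  shows "eps_class scale L = eps_class scale L'"
proof -
  obtain M where M: "M \<in> carrier (lat_group scale \<Lambda>)" "lat_mult L M = \<Lambda>" "lat_mult M L = \<Lambda>"
    by (rule lat_group_inverse[OF \<Lambda> L])
  obtain M' where M': "M' \<in> carrier (lat_group scale \<Lambda>)" "lat_mult L' M' = \<Lambda>" "lat_mult M' L' = \<Lambda>"
    by (rule lat_group_inverse[OF \<Lambda> L'])
  note s = full_add_subgroup[OF lat_group_full[OF \<Lambda>]]
  note \<Lambda>s = order_add_subgroup[OF \<Lambda>]
  note Ls = s[OF L] and L's = s[OF L'] and Ms = s[OF M(1)] and M's = s[OF M'(1)]
  have approx: "\<exists>y\<in>lat_mult X' Y. z - y \<in> nilradical"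
    if X': "add_subgroup X'" and XX': "\<forall>x\<in>X. \<exists>y\<in>X'. x - y \<in> nilradical" and z: "z \<in> lat_mult X Y"
    for X X' Y z
  proof -
    have "lat_mult X Y \<subseteq> {y + r | y r. y \<in> lat_mult X' Y \<and> r \<in> nilradical}"
    proof (rule lat_mult_subset[OF add_subgroup_sum[OF add_subgroup_lat_mult[OF X'] add_subgroup_nilradical]])
      fix a b assume ab: "a \<in> X" "b \<in> Y"
      then obtain y where y: "y \<in> X'" "a - y \<in> nilradical" using XX' by blast
      have "a * b = y * b + (a - y) * b" by (simp add: algebra_simps)
      then show "a * b \<in> {y + r | y r. y \<in> lat_mult X' Y \<and> r \<in> nilradical}"
        using lat_mult_mem[OF y(1) ab(2)] nilradical_mult'[OF y(2)] by blast
    qed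
    then obtain y r where "z = y + r" "y \<in> lat_mult X' Y" "r \<in> nilradical" using z by blast
    then show ?thesis by (intro bexI[of _ y]) simp_all
  qed
  define K where "K = lat_mult L M'"
  define J where "J = lat_mult L' M"
  have Ks: "add_subgroup K" and Js: "add_subgroup J"
    unfolding K_def J_def by (rule add_subgroup_lat_mult[OF Ls], rule add_subgroup_lat_mult[OF L's])
  have KJ: "lat_mult K J = \<Lambda>"
  proof -
    have "lat_mult K J = lat_mult L (lat_mult M' (lat_mult L' M))"
      unfolding K_def J_def using lat_mult_assoc[OF Ls M's] add_subgroup_lat_mult[OF L's] by blast
    also have "lat_mult M' (lat_mult L' M) = lat_mult (lat_mult M' L') M"
      by (rule lat_mult_assoc[OF M's L's Ms, symmetric])
    also have "\<dots> = M"
      unfolding M'(3) using lat_group_mult_order[OF \<Lambda> M(1)] lat_mult_commute[of \<Lambda> M] by simp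
    finally show ?thesis using M(2) by simp
  qed
  \<comment> \<open>\<open>K\<close> contains a unipotent element, and so does its inverse \<open>J\<close>\<close>
  have "1 \<in> lat_mult L' M'" unfolding M'(2) by (rule order_one[OF \<Lambda>])
  then have "\<exists>y\<in>lat_mult L M'. 1 - y \<in> nilradical" by (rule approx[OF Ls sub'])
  then obtain u where u: "u \<in> K" "1 - u \<in> nilradical" unfolding K_def by blast
  have K\<Lambda>: "\<forall>x\<in>K. \<exists>y\<in>\<Lambda>. x - y \<in> nilradical"
    using approx[OF L's sub] unfolding K_def M'(2)[symmetric] by blast
  have "1 \<in> lat_mult K J" unfolding KJ by (rule order_one[OF \<Lambda>])
  then have "\<exists>y\<in>lat_mult \<Lambda> J. 1 - y \<in> nilradical" by (rule approx[OF \<Lambda>s K\<Lambda>])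
  then obtain m where m: "m \<in> lat_mult \<Lambda> J" "1 - m \<in> nilradical" by blast
  have "lat_mult \<Lambda> J = J"
  proof -
    have "lat_mult \<Lambda> J = lat_mult (lat_mult \<Lambda> L') M"
      unfolding J_def by (rule lat_mult_assoc[OF \<Lambda>s L's Ms, symmetric])
    then show ?thesis
      unfolding J_def using lat_group_mult_order[OF \<Lambda> L'] lat_mult_commute[of \<Lambda> L'] by simp
  qed
  then have mJ: "m \<in> J" using m(1) by simp
  have um: "u * m \<in> \<Lambda>" using lat_mult_mem[OF u(1) mJ] KJ by simp
  have um_eq: "1 - u * m = (1 - u) * m + (1 - m)" by (simp add: algebra_simps)
  have nil: "1 - u * m \<in> nilradical"
    unfolding um_eq by (intro nilradical_add nilradical_mult' u(2) m(2))
  have "1 - u * m \<in> \<Lambda>" by (rule zmod.subspace_diff[OF \<Lambda>s order_one[OF \<Lambda>] um])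
  then obtain v where v: "v \<in> \<Lambda>" "(1 - (1 - u * m)) * v = 1"
    using one_minus_nilpotent_inverse[OF \<Lambda>s order_one[OF \<Lambda>] order_mult[OF \<Lambda>] nil] by blast
  have v': "u * (m * v) = 1" using v(2) by (simp add: mult.assoc)
  have K_eq: "K = (*) u ` \<Lambda>"
  proof
    show "K \<subseteq> (*) u ` \<Lambda>"
    proof
      fix x assume x: "x \<in> K"
      have "x * m \<in> \<Lambda>" using lat_mult_mem[OF x mJ] KJ by simp
      then have "x * m * v \<in> \<Lambda>" by (rule order_mult[OF \<Lambda> _ v(1)])
      moreover have "x = u * (x * m * v)"
      proof -
        have "u * (x * m * v) = x * (u * (m * v))" by (simp only: ac_simps)
        then show ?thesis unfolding v' by simp
      qed
      ultimately show "x \<in> (*) u ` \<Lambda>" by blast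
    qed
    have "lat_mult K \<Lambda> = lat_mult L (lat_mult M' \<Lambda>)"
      unfolding K_def by (rule lat_mult_assoc[OF Ls M's \<Lambda>s])
    then have "lat_mult K \<Lambda> = K"
      unfolding K_def using lat_group_mult_order[OF \<Lambda> M'(1)] by simp
    then show "(*) u ` \<Lambda> \<subseteq> K" using lat_mult_mem[OF u(1), of _ \<Lambda>] by blast
  qed
  have "L = lat_mult L (lat_mult M' L')"
    unfolding M'(3) using lat_group_mult_order[OF \<Lambda> L] by simp
  also have "\<dots> = lat_mult K L'"
    unfolding K_def by (rule lat_mult_assoc[OF Ls M's L's, symmetric])
  also have "\<dots> = (*) u ` lat_mult \<Lambda> L'"
    unfolding K_eq by (rule lat_mult_image_left[OF \<Lambda>s])
  also have "lat_mult \<Lambda> L' = L'"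
    using lat_group_mult_order[OF \<Lambda> L'] lat_mult_commute[of \<Lambda> L'] by simp
  finally have "(*) u ` L' = L" ..
  moreover have "u dvd 1" using v' by (metis dvd_triv_left)
  ultimately have "eps_class scale L' = eps_class scale L"
    using eps_class_eq_iff[OF lat_group_full[OF \<Lambda> L'] lat_group_full[OF \<Lambda> L]] by blast
  then show ?thesis ..
qed

text \<open>Scaling by the inverse of a generator from \<open>idempotent_generator\<close>, every class is
  represented by a lattice \<open>L\<close> with \<open>1 \<in> L\<close> and \<open>D L \<subseteq> \<Lambda> + R\<close>, where \<open>R\<close> is the nilradical and
  \<open>D\<close> does not depend on \<open>L\<close>. The group \<open>H L = D L + R\<close> lies between \<open>D \<Lambda> + R\<close> and \<open>\<Lambda> + R\<close>, so
  that there are finitely many of them, and it determines the class of \<open>L\<close>.\<close>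

lemma finite_class_group:
  assumes \<Lambda>: "is_order scale \<Lambda>"
  shows "finite (carrier (class_group scale \<Lambda>))"
proof -
  note \<Lambda>s = order_add_subgroup[OF \<Lambda>]
  obtain D where D: "D > 0" and gen: "\<And>L. full_lattice scale L \<and> (\<forall>x\<in>L. \<forall>y\<in>\<Lambda>. x * y \<in> L) \<Longrightarrow>
    \<exists>\<alpha>\<in>L. (\<exists>y. \<alpha> * y = 1) \<and> 1 * \<alpha> = \<alpha> \<and>
      (\<forall>\<beta>\<in>L. \<exists>l\<in>\<Lambda>. \<exists>r\<in>nilradical. of_nat D * (1 * \<beta>) = \<alpha> * l + r)"
    using idempotent_generator[OF \<Lambda>, of 1] by auto
  define reps where "reps = {L \<in> carrier (lat_group scale \<Lambda>). 1 \<in> L \<and>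
    (\<forall>x\<in>L. \<exists>l\<in>\<Lambda>. of_nat D * x - l \<in> nilradical)}"
  have "\<exists>L\<in>reps. X = eps_class scale L" if X: "X \<in> carrier (class_group scale \<Lambda>)" for X
  proof -
    obtain L where L: "L \<in> carrier (lat_group scale \<Lambda>)" "X = eps_class scale L"
      using X carrier_class_group[OF \<Lambda>] by blast
    have "full_lattice scale L \<and> (\<forall>x\<in>L. \<forall>y\<in>\<Lambda>. x * y \<in> L)"
      using lat_group_full[OF \<Lambda> L(1)] lat_group_mult_mem[OF \<Lambda> L(1)] by blast
    from gen[OF this] obtain \<alpha> y where \<alpha>: "\<alpha> \<in> L" "\<alpha> * y = 1"
      and g: "\<forall>\<beta>\<in>L. \<exists>l\<in>\<Lambda>. \<exists>r\<in>nilradical. of_nat D * \<beta> = \<alpha> * l + r"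
      by auto
    have y: "y dvd 1" "y * \<alpha> = 1" using \<alpha>(2) by (metis dvd_triv_right, simp add: mult.commute)
    have G: "(*) y ` L \<in> carrier (lat_group scale \<Lambda>)" by (rule image_in_lat_group[OF \<Lambda> L(1) y(1)])
    have "eps_class scale L = eps_class scale ((*) y ` L)"
      using eps_class_eq_iff[OF lat_group_full[OF \<Lambda> L(1)] lat_group_full[OF \<Lambda> G]] y(1) by blast
    moreover have "1 \<in> (*) y ` L" using y(2) \<alpha>(1) by (metis imageI)
    moreover have "\<exists>l\<in>\<Lambda>. of_nat D * x - l \<in> nilradical" if x: "x \<in> (*) y ` L" for x
    proof -
      obtain \<beta> where \<beta>: "\<beta> \<in> L" "x = y * \<beta>" using x by blast
      obtain l r where l: "l \<in> \<Lambda>" "r \<in> nilradical" "of_nat D * \<beta> = \<alpha> * l + r" using g \<beta>(1) by blast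
      have "of_nat D * x = y * (of_nat D * \<beta>)" unfolding \<beta>(2) by (simp only: ac_simps)
      also have "\<dots> = (y * \<alpha>) * l + y * r" unfolding l(3) by (simp add: algebra_simps)
      finally have "of_nat D * x - l = y * r" unfolding y(2) by simp
      then show ?thesis using nilradical_mult[OF l(2), of y] l(1) by metis
    qed
    ultimately show ?thesis unfolding reps_def using G L(2) by blast
  qed
  then have surj: "carrier (class_group scale \<Lambda>) \<subseteq> eps_class scale ` reps" by blast
  define H :: "'a set \<Rightarrow> 'a set" where "H L = {x + r | x r. x \<in> (*) (of_nat D) ` L \<and> r \<in> nilradical}" for L
  have H_memI: "of_nat D * x \<in> H L" if "x \<in> L" for x L
    unfolding H_def using that zmod.subspace_0[OF add_subgroup_nilradical] by force
  obtain T where T: "finite T" "T \<subseteq> \<Lambda>" "\<And>x. x \<in> \<Lambda> \<Longrightarrow> \<exists>t\<in>T. \<exists>y\<in>\<Lambda>. x = t + of_nat D * y"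
    by (rule finite_residues[OF order_full[OF \<Lambda>] D]) (rule that)
  let ?F = "{x + r | x r. x \<in> \<Lambda> \<and> r \<in> nilradical}"
  have "finite {K. add_subgroup K \<and> H \<Lambda> \<subseteq> K \<and> K \<subseteq> ?F}"
  proof (rule finite_intermediate_subgroups[OF T(1)])
    fix x assume "x \<in> ?F"
    then obtain l r where l: "x = l + r" "l \<in> \<Lambda>" "r \<in> nilradical" by blast
    obtain t y where t: "t \<in> T" "y \<in> \<Lambda>" "l = t + of_nat D * y" using T(3)[OF l(2)] by blast
    have "x - t = of_nat D * y + r" unfolding l(1) t(3) by simp
    then have "x - t \<in> H \<Lambda>" unfolding H_def using t(2) l(3) by blast
    then show "\<exists>t\<in>T. x - t \<in> H \<Lambda>" using t(1) by blast
  qed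
  moreover have "H ` reps \<subseteq> {K. add_subgroup K \<and> H \<Lambda> \<subseteq> K \<and> K \<subseteq> ?F}"
  proof (rule image_subsetI)
    fix L assume "L \<in> reps"
    then have L: "L \<in> carrier (lat_group scale \<Lambda>)" "1 \<in> L"
      and close: "\<And>x. x \<in> L \<Longrightarrow> \<exists>l\<in>\<Lambda>. of_nat D * x - l \<in> nilradical" unfolding reps_def by auto
    have "add_subgroup (H L)"
      unfolding H_def
      by (intro add_subgroup_sum add_subgroup_image_mult add_subgroup_nilradical
          full_add_subgroup[OF lat_group_full[OF \<Lambda> L(1)]])
    moreover have "\<Lambda> \<subseteq> L" using lat_group_mult_mem[OF \<Lambda> L] by auto
    then have "H \<Lambda> \<subseteq> H L" unfolding H_def by blast
    moreover have "H L \<subseteq> ?F"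
    proof
      fix z assume "z \<in> H L"
      then obtain x r where z: "z = of_nat D * x + r" "x \<in> L" "r \<in> nilradical" unfolding H_def by blast
      obtain l where l: "l \<in> \<Lambda>" "of_nat D * x - l \<in> nilradical" using close[OF z(2)] by blast
      have "z = l + ((of_nat D * x - l) + r)" unfolding z(1) by simp
      then show "z \<in> ?F" using l(1) nilradical_add[OF l(2) z(3)] by blast
    qed
    ultimately show "H L \<in> {K. add_subgroup K \<and> H \<Lambda> \<subseteq> K \<and> K \<subseteq> ?F}" by simp
  qed
  ultimately have fin: "finite (H ` reps)" by (rule rev_finite_subset)
  have H_eq: "eps_class scale L = eps_class scale L'"
    if L: "L \<in> reps" "L' \<in> reps" and eq: "H L = H L'" for L L'
  proof -
    have sub: "\<forall>x\<in>L. \<exists>y\<in>L'. x - y \<in> nilradical" if eq: "H L = H L'" for L L'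
    proof
      fix x assume x: "x \<in> L"
      have "of_nat D * x \<in> H L'" using H_memI[OF x] eq by simp
      then obtain y r where y: "of_nat D * x = of_nat D * y + r" "y \<in> L'" "r \<in> nilradical"
        unfolding H_def by blast
      then have "of_nat D * (x - y) = r" by (simp add: algebra_simps)
      then have "x - y \<in> nilradical" using nilradical_cancel[OF D, of "x - y"] y(3) by simp
      then show "\<exists>y\<in>L'. x - y \<in> nilradical" using y(2) by blast
    qed
    have "L \<in> carrier (lat_group scale \<Lambda>)" "L' \<in> carrier (lat_group scale \<Lambda>)"
      using L unfolding reps_def by auto
    then show ?thesis
      by (rule lattices_equal_mod_nilradical[OF \<Lambda> _ _ sub[OF eq] sub[OF eq[symmetric]]])
  qed
  have "\<exists>\<psi>. \<forall>L\<in>reps. eps_class scale L = \<psi> (H L)"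
    by (rule exI[of _ "\<lambda>K. eps_class scale (SOME L. L \<in> reps \<and> H L = K)"])
      (metis (mono_tags, lifting) H_eq someI_ex)
  then obtain \<psi> where "\<forall>L\<in>reps. eps_class scale L = \<psi> (H L)" by blast
  then have "eps_class scale ` reps \<subseteq> \<psi> ` H ` reps" by blast
  then show ?thesis using surj fin by (meson finite_imageI finite_subset subset_trans)
qed

end

section \<open>Unit groups and their quotients\<close>

lemma group_hom_intro:
  "group G \<Longrightarrow> group H \<Longrightarrow> h \<in> hom G H \<Longrightarrow> group_hom G H h"
  by (intro group_hom.intro group_hom_axioms.intro)

lemma (in group_hom) induced_map_coset:
  assumes "x \<in> carrier G"
  shows "the_elem (h ` (kernel G H h #>\<^bsub>G\<^esub> x)) = h x"
proof -
  have "x \<in> kernel G H h #>\<^bsub>G\<^esub> x" by (rule G.rcos_self[OF assms subgroup_kernel])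
  moreover have "h y = h x" if y: "y \<in> kernel G H h #>\<^bsub>G\<^esub> x" for y
  proof -
    obtain k where "k \<in> carrier G" "h k = \<one>\<^bsub>H\<^esub>" "y = k \<otimes>\<^bsub>G\<^esub> x"
      using y unfolding r_coset_def kernel_def by blast
    then show ?thesis using assms by simp
  qed
  ultimately have "h ` (kernel G H h #>\<^bsub>G\<^esub> x) = {h x}" by blast
  then show ?thesis by simp
qed

lemma (in group_hom) onto_image:
  shows "group_hom G (H\<lparr>carrier := h ` carrier G\<rparr>) h"
    and "kernel G (H\<lparr>carrier := h ` carrier G\<rparr>) h = kernel G H h"
proof -
  have "subgroup (h ` carrier G) H" by (rule img_is_subgroup)
  then have "group (H\<lparr>carrier := h ` carrier G\<rparr>)" by (rule subgroup.subgroup_is_group[OF _ H.is_group])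
  then show "group_hom G (H\<lparr>carrier := h ` carrier G\<rparr>) h"
    using homh by (intro group_hom_intro) (auto simp: hom_def)
qed (simp add: kernel_def)

text \<open>The isomorphism theorem with the target cut down to the image.\<close>

lemma (in group_hom) induced_iso:
  "(\<lambda>X. the_elem (h ` X)) \<in> iso (G Mod kernel G H h) (H\<lparr>carrier := h ` carrier G\<rparr>)"
  using group_hom.FactGroup_iso_set[OF onto_image(1)] unfolding onto_image(2) by simp

lemma (in group_hom) card_rcosets_kernel:
  "card (rcosets\<^bsub>G\<^esub> kernel G H h) = card (h ` carrier G)"
  "finite (h ` carrier G) \<Longrightarrow> finite (rcosets\<^bsub>G\<^esub> kernel G H h)"
proof -
  have b: "bij_betw (\<lambda>X. the_elem (h ` X)) (rcosets\<^bsub>G\<^esub> kernel G H h) (h ` carrier G)"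
    using induced_iso unfolding iso_def FactGroup_def by simp
  then show "card (rcosets\<^bsub>G\<^esub> kernel G H h) = card (h ` carrier G)" by (rule bij_betw_same_card)
  show "finite (h ` carrier G) \<Longrightarrow> finite (rcosets\<^bsub>G\<^esub> kernel G H h)"
    using bij_betw_finite[OF b] by simp
qed

lemma (in group_hom) card_image_kernel:
  "card (h ` carrier G) * card (kernel G H h) = order G"
  using G.lagrange[OF subgroup_kernel] card_rcosets_kernel(1) by simp

lemma subring_of_simps [simp]:
  "carrier (subring_of S) = S" "monoid.mult (subring_of S) = (*)" "\<one>\<^bsub>subring_of S\<^esub> = 1"
  "\<zero>\<^bsub>subring_of S\<^esub> = 0" "add (subring_of S) = (+)"
  by (simp_all add: subring_of_def)

lemma cring_subring_of:
  assumes S: "is_subring S"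
  shows "cring (subring_of S)"
proof (rule cringI)
  note S' = is_subringD[OF S]
  show "abelian_group (subring_of S)"
  proof (rule abelian_groupI)
    fix x assume "x \<in> carrier (subring_of S)"
    then show "\<exists>y\<in>carrier (subring_of S). y \<oplus>\<^bsub>subring_of S\<^esub> x = \<zero>\<^bsub>subring_of S\<^esub>"
      using zmod.subspace_neg[OF S'(1)] by (intro bexI[of _ "- x"]) simp_all
  qed (simp_all add: zmod.subspace_add[OF S'(1)] zmod.subspace_0[OF S'(1)] algebra_simps)
  show "comm_monoid (subring_of S)"
    by (rule comm_monoidI) (simp_all add: S' mult_ac)
qed (simp add: distrib_right)

lemma unit_group_carrier: "x \<in> carrier (unit_group S) \<longleftrightarrow> x \<in> S \<and> (\<exists>y\<in>S. x * y = 1)"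
  by (auto simp: units_of_def Units_def mult.commute)

lemma unit_group_simps [simp]:
  "monoid.mult (unit_group S) = (*)" "\<one>\<^bsub>unit_group S\<^esub> = 1"
  by (simp_all add: units_of_def)

lemma comm_group_unit_group:
  assumes "is_subring S"
  shows "comm_group (unit_group S)"
proof -
  interpret cring "subring_of S" by (rule cring_subring_of[OF assms])
  show ?thesis by (rule units_comm_group)
qed

lemma unit_group_subgroup:
  assumes S: "is_subring S" and T: "is_subring T" and ST: "S \<subseteq> T"
  shows "subgroup (carrier (unit_group S)) (unit_group T)"
proof -
  interpret T: comm_group "unit_group T" by (rule comm_group_unit_group[OF T])
  interpret S: comm_group "unit_group S" by (rule comm_group_unit_group[OF S])
  have sub: "carrier (unit_group S) \<subseteq> carrier (unit_group T)"
    unfolding subset_iff unit_group_carrier using ST by blast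
  show ?thesis
  proof (rule T.subgroupI[OF sub])
    show "carrier (unit_group S) \<noteq> {}" using S.one_closed by blast
    fix x assume x: "x \<in> carrier (unit_group S)"
    have "inv\<^bsub>unit_group T\<^esub> x = inv\<^bsub>unit_group S\<^esub> x"
      by (rule T.inv_equality) (use S.l_inv[OF x] S.inv_closed[OF x] x sub in auto)
    then show "inv\<^bsub>unit_group T\<^esub> x \<in> carrier (unit_group S)" using S.inv_closed[OF x] by simp
    fix y assume "y \<in> carrier (unit_group S)"
    from S.m_closed[OF x this] show "x \<otimes>\<^bsub>unit_group T\<^esub> y \<in> carrier (unit_group S)" by simp
  qed
qed

lemma image_unit_subring:
  assumes S: "is_subring S" and u: "u \<in> carrier (unit_group S)"
  shows "(*) u ` S = S"
proof -
  obtain v where v: "u \<in> S" "v \<in> S" "u * v = 1" using u unfolding unit_group_carrier by blast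
  have "x \<in> (*) u ` S" if "x \<in> S" for x
  proof -
    have "x = u * (v * x)" using v(3) by (simp add: mult.assoc[symmetric])
    then show ?thesis using is_subringD(3)[OF S v(2) that] by blast
  qed
  then show ?thesis using is_subringD(3)[OF S v(1)] by blast
qed

lemma image_eq_subring_unit:
  assumes S: "is_subring S" and eq: "(*) u ` S = S"
  shows "u \<in> carrier (unit_group S)"
proof -
  have "u * 1 \<in> S" "1 \<in> (*) u ` S" using eq is_subringD(2)[OF S] by blast+
  then show ?thesis unfolding unit_group_carrier by auto
qed

lemma a_r_coset_subring_of: "I +>\<^bsub>subring_of S\<^esub> a = {c + a | c. c \<in> I}"
  unfolding a_r_coset_def' by auto

lemma residue_class_eq_iff:
  assumes I: "add_subgroup I"
  shows "{c + a | c. c \<in> I} = {c + b | c. c \<in> I} \<longleftrightarrow> a - b \<in> I"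
proof
  assume eq: "{c + a | c. c \<in> I} = {c + b | c. c \<in> I}"
  have "0 + a \<in> {c + a | c. c \<in> I}" using zmod.subspace_0[OF I] by blast
  then obtain c where "a = c + b" "c \<in> I" using eq by auto
  then show "a - b \<in> I" by simp
next
  have sub: "{c + a | c. c \<in> I} \<subseteq> {c + b | c. c \<in> I}" if "a - b \<in> I" for a b
  proof
    fix x assume "x \<in> {c + a | c. c \<in> I}"
    then obtain c where "x = c + a" "c \<in> I" by blast
    moreover from this have "x = (c + (a - b)) + b" by simp
    moreover have "c + (a - b) \<in> I" using zmod.subspace_add[OF I \<open>c \<in> I\<close> that] .
    ultimately show "x \<in> {c + b | c. c \<in> I}" by blast
  qed
  assume "a - b \<in> I"
  with sub[of a b] sub[of b a] zmod.subspace_neg[OF I this]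
  show "{c + a | c. c \<in> I} = {c + b | c. c \<in> I}" by auto
qed

lemma ideal_subring_of:
  assumes S: "is_subring S" and I: "ideal_in S I"
  shows "ideal I (subring_of S)"
proof (rule idealI)
  interpret cring "subring_of S" by (rule cring_subring_of[OF S])
  show "ring (subring_of S)" by (rule ring_axioms)
  note I' = ideal_inD[OF I]
  show "subgroup I (add_monoid (subring_of S))"
  proof (rule add.subgroupI)
    show "I \<noteq> {}" using zmod.subspace_0[OF I'(1)] by blast
    fix a assume a: "a \<in> I"
    have "\<ominus>\<^bsub>subring_of S\<^esub> a = - a"
      by (rule minus_equality) (use a I'(2) zmod.subspace_neg[OF is_subringD(1)[OF S]] in auto)
    then show "\<ominus>\<^bsub>subring_of S\<^esub> a \<in> I"
      using zmod.subspace_neg[OF I'(1) a] by simp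
  qed (use I' zmod.subspace_add[OF I'(1)] in auto)
qed (use ideal_inD[OF I] in auto)

context
  fixes S I :: "'a::comm_ring_1 set"
  assumes S: "is_subring S" and I: "ideal_in S I"
begin

lemma comm_group_quot_unit_group: "comm_group (quot_unit_group S I)"
proof -
  interpret cring "subring_of S Quot I"
    by (rule ideal.quotient_is_cring[OF ideal_subring_of[OF S I] cring_subring_of[OF S]])
  show ?thesis by (rule units_comm_group)
qed

lemma quot_mult:
  "a \<in> S \<Longrightarrow> b \<in> S \<Longrightarrow>
    {c + a | c. c \<in> I} \<otimes>\<^bsub>quot_unit_group S I\<^esub> {c + b | c. c \<in> I} = {c + a * b | c. c \<in> I}"
  using ideal.rcoset_mult_add[OF ideal_subring_of[OF S I], of a b]
  by (simp add: units_of_def FactRing_def a_r_coset_subring_of)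

lemma quot_one: "\<one>\<^bsub>quot_unit_group S I\<^esub> = {c + 1 | c. c \<in> I}"
  by (simp add: units_of_def FactRing_def a_r_coset_subring_of)

lemma quot_carrier:
  "X \<in> carrier (quot_unit_group S I) \<longleftrightarrow>
    (\<exists>a\<in>S. X = {c + a | c. c \<in> I} \<and> (\<exists>b\<in>S. a * b - 1 \<in> I))"
proof -
  have mult: "{c + a | c. c \<in> I} \<otimes>\<^bsub>subring_of S Quot I\<^esub> {c + b | c. c \<in> I} = {c + a * b | c. c \<in> I}"
    if "a \<in> S" "b \<in> S" for a b
    using quot_mult[OF that] by (simp add: units_of_def)
  have one: "\<one>\<^bsub>subring_of S Quot I\<^esub> = {c + 1 | c. c \<in> I}"
    using quot_one by (simp add: units_of_def)
  have car: "carrier (subring_of S Quot I) = (\<lambda>a. {c + a | c. c \<in> I}) ` S"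
    by (auto simp: FactRing_def A_RCOSETS_def' a_r_coset_subring_of)
  have inverse: "{c + a | c. c \<in> I} \<otimes>\<^bsub>subring_of S Quot I\<^esub> {c + b | c. c \<in> I} = \<one>\<^bsub>subring_of S Quot I\<^esub>
      \<longleftrightarrow> a * b - 1 \<in> I" if "a \<in> S" "b \<in> S" for a b
    unfolding mult[OF that] one by (rule residue_class_eq_iff[OF ideal_inD(1)[OF I]])
  show ?thesis
  proof
    assume "X \<in> carrier (quot_unit_group S I)"
    then have X: "X \<in> carrier (subring_of S Quot I)"
      "\<exists>Y\<in>carrier (subring_of S Quot I). X \<otimes>\<^bsub>subring_of S Quot I\<^esub> Y = \<one>\<^bsub>subring_of S Quot I\<^esub>"
      by (auto simp: units_of_def Units_def)
    obtain a where a: "a \<in> S" "X = {c + a | c. c \<in> I}" using X(1) unfolding car by blast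
    obtain b where "b \<in> S"
      "X \<otimes>\<^bsub>subring_of S Quot I\<^esub> {c + b | c. c \<in> I} = \<one>\<^bsub>subring_of S Quot I\<^esub>"
      using X(2) unfolding car by blast
    then show "\<exists>a\<in>S. X = {c + a | c. c \<in> I} \<and> (\<exists>b\<in>S. a * b - 1 \<in> I)"
      using a inverse[OF a(1), of b] by blast
  next
    assume "\<exists>a\<in>S. X = {c + a | c. c \<in> I} \<and> (\<exists>b\<in>S. a * b - 1 \<in> I)"
    then obtain a b where a: "a \<in> S" "X = {c + a | c. c \<in> I}" and b: "b \<in> S" "a * b - 1 \<in> I" by blast
    have "X \<otimes>\<^bsub>subring_of S Quot I\<^esub> {c + b | c. c \<in> I} = \<one>\<^bsub>subring_of S Quot I\<^esub>"
      unfolding a(2) inverse[OF a(1) b(1)] by (rule b(2))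
    moreover have "{c + b | c. c \<in> I} \<otimes>\<^bsub>subring_of S Quot I\<^esub> X = \<one>\<^bsub>subring_of S Quot I\<^esub>"
      unfolding a(2) inverse[OF b(1) a(1)] using b(2) by (simp add: mult.commute)
    moreover have "X \<in> carrier (subring_of S Quot I)" "{c + b | c. c \<in> I} \<in> carrier (subring_of S Quot I)"
      unfolding car using a b(1) by blast+
    ultimately show "X \<in> carrier (quot_unit_group S I)"
      unfolding units_of_def Units_def by auto
  qed
qed

end

section \<open>The exact sequences\<close>

context order_pair
begin

text \<open>In the following names, \<open>U\<close>, \<open>Q\<close>, \<open>G\<close>, \<open>E\<close> stand for the unit groups of localizations,
  the unit groups of residue rings, the groups of lattices and the groups of lattice classes,
  and the digit for the order. The set \<open>cst p b\<close> is the coset of the local unit \<open>b\<close>, and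
  \<open>cl a\<close> is the residue class of \<open>a\<close> modulo the conductor.\<close>

abbreviation "U1 p \<equiv> unit_group (loc scale p \<Lambda>1)"
abbreviation "U2 p \<equiv> unit_group (loc scale p \<Lambda>2)"
abbreviation "Q1 \<equiv> quot_unit_group \<Lambda>1 C"
abbreviation "Q2 \<equiv> quot_unit_group \<Lambda>2 C"
abbreviation "G1 \<equiv> lat_group scale \<Lambda>1"
abbreviation "G2 \<equiv> lat_group scale \<Lambda>2"
abbreviation "E1 \<equiv> class_group scale \<Lambda>1"
abbreviation "E2 \<equiv> class_group scale \<Lambda>2"
abbreviation "cst p b \<equiv> carrier (U2 p) #>\<^bsub>U1 p\<^esub> b"
abbreviation "PU1 \<equiv> product_group P0 U1"
abbreviation "PU2 \<equiv> product_group P0 U2"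
abbreviation "PQ \<equiv> product_group P0 (\<lambda>p. U1 p Mod carrier (U2 p))"
abbreviation "Ker \<equiv> kernel G2 G1 (lat_mult \<Lambda>1)"
abbreviation "cl a \<equiv> {c + a | c. c \<in> C}"

lemmas subring1 = order_is_subring[OF order1]
lemmas subring2 = order_is_subring[OF order2]

lemma group_G1: "group G1" and group_G2: "group G2" and group_E1: "group E1" and group_E2: "group E2"
  using comm_group_lat_group comm_group_class_group order1 order2 by (auto intro: comm_group.axioms(2))

lemma comm_U1: "prime p \<Longrightarrow> comm_group (U1 p)"
  by (rule comm_group_unit_group[OF is_subring_loc[OF subring1]])

lemma comm_U2: "prime p \<Longrightarrow> comm_group (U2 p)"
  by (rule comm_group_unit_group[OF is_subring_loc[OF subring2]])

lemma group_PU1: "group PU1" and group_PU2: "group PU2"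
  by (rule product_group, use comm_U1 comm_U2 P0_prime in \<open>auto intro: comm_group.axioms(2)\<close>)+

lemma U2_subgroup: "prime p \<Longrightarrow> subgroup (carrier (U2 p)) (U1 p)"
  by (rule unit_group_subgroup[OF is_subring_loc[OF subring2] is_subring_loc[OF subring1] loc_mono[OF sub]])

lemma U2_normal: "prime p \<Longrightarrow> carrier (U2 p) \<lhd> U1 p"
  by (rule comm_group.normal_iff_subgroup[THEN iffD2, OF comm_U1 U2_subgroup])

lemma group_UQ: "p \<in> P0 \<Longrightarrow> group (U1 p Mod carrier (U2 p))"
  by (rule normal.factorgroup_is_group[OF U2_normal[OF P0_prime]])

lemma group_PQ: "group PQ"
  by (rule product_group[OF group_UQ])

lemma PU1_D:
  assumes "a \<in> carrier PU1" "p \<in> P0"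
  shows "a p \<in> loc scale p \<Lambda>1 \<and> (\<exists>y\<in>loc scale p \<Lambda>1. a p * y = 1)"
  using assms unit_group_carrier[of "a p"] by (auto simp: PiE_iff)

lemma glue_lift:
  assumes a: "a \<in> carrier PU1" and b: "b \<in> \<Lambda>1" "\<And>p. p \<in> P0 \<Longrightarrow> b - a p \<in> loc scale p C"
  shows "unit_mod_C b" "glue scale P0 \<Lambda>2 a = K b"
proof -
  show "unit_mod_C b" by (rule lift_unit_mod[OF PU1_D[OF a] b])
  show "glue scale P0 \<Lambda>2 a = K b" by (rule glue_eq_K[OF PU1_D[OF a] b])
qed

lemma glue_obtain_lift:
  assumes a: "a \<in> carrier PU1"
  obtains b where "b \<in> \<Lambda>1" "\<And>p. p \<in> P0 \<Longrightarrow> b - a p \<in> loc scale p C"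
    "unit_mod_C b" "glue scale P0 \<Lambda>2 a = K b"
proof -
  have "\<exists>b\<in>\<Lambda>1. \<forall>p\<in>P0. b - a p \<in> loc scale p C"
    by (rule lift_exists) (use PU1_D[OF a] in blast)
  then obtain b where b: "b \<in> \<Lambda>1" "\<And>p. p \<in> P0 \<Longrightarrow> b - a p \<in> loc scale p C" by blast
  show ?thesis by (rule that[OF b glue_lift[OF a b]])
qed

lemma kernel_ext_iff: "L \<in> Ker \<longleftrightarrow> L \<in> carrier G2 \<and> lat_mult \<Lambda>1 L = \<Lambda>1"
  by (simp add: kernel_def)

lemma K_in_Ker: "unit_mod_C b \<Longrightarrow> K b \<in> Ker"
  by (simp add: kernel_ext_iff K_in_group K_extension)

lemma Ker_eq: "Ker = K ` {b. unit_mod_C b}"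
proof
  show "Ker \<subseteq> K ` {b. unit_mod_C b}"
  proof
    fix L assume "L \<in> Ker"
    then have "L \<in> carrier G2" "lat_mult \<Lambda>1 L = \<Lambda>1" by (simp_all add: kernel_ext_iff)
    then obtain b where "unit_mod_C b" "L = K b" by (rule kernel_is_K)
    then show "L \<in> K ` {b. unit_mod_C b}" by blast
  qed
qed (use K_in_Ker in blast)

lemma mult_lift:
  assumes a: "a \<in> carrier PU1" "a' \<in> carrier PU1" and p: "p \<in> P0" and b: "b \<in> \<Lambda>1" "b' \<in> \<Lambda>1"
    and l: "b - a p \<in> loc scale p C" "b' - a' p \<in> loc scale p C"
  shows "b * b' - a p * a' p \<in> loc scale p C"
proof -
  note pp = P0_prime[OF p]
  have "(b - a p) * b' + (b' - a' p) * a p \<in> loc scale p C"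
    using loc_superset[OF sub1 pp] b PU1_D[OF a(1) p]
    by (intro zmod.subspace_add[OF add_subgroup_loc[OF C_sub pp]] loc_ideal[OF pp] l) auto
  moreover have "(b - a p) * b' + (b' - a' p) * a p = b * b' - a p * a' p" by (simp add: algebra_simps)
  ultimately show ?thesis by simp
qed

text \<open>A product of lifts is a lift of the product, so multiplicativity is that of \<open>K\<close>.\<close>

lemma group_hom_glue: "group_hom PU1 G2 (glue scale P0 \<Lambda>2)"
proof (rule group_hom_intro[OF group_PU1 group_G2 homI])
  fix a assume a: "a \<in> carrier PU1"
  obtain b where b: "b \<in> \<Lambda>1" "\<And>p. p \<in> P0 \<Longrightarrow> b - a p \<in> loc scale p C"
    "unit_mod_C b" "glue scale P0 \<Lambda>2 a = K b" by (rule glue_obtain_lift[OF a]) (rule that)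
  show "glue scale P0 \<Lambda>2 a \<in> carrier G2" unfolding b(4) by (rule K_in_group[OF b(3)])
  fix a' assume a': "a' \<in> carrier PU1"
  obtain b' where b': "b' \<in> \<Lambda>1" "\<And>p. p \<in> P0 \<Longrightarrow> b' - a' p \<in> loc scale p C"
    "unit_mod_C b'" "glue scale P0 \<Lambda>2 a' = K b'" by (rule glue_obtain_lift[OF a']) (rule that)
  have "a \<otimes>\<^bsub>PU1\<^esub> a' \<in> carrier PU1" using group.is_monoid[OF group_PU1] a a' by (rule monoid.m_closed)
  then have "glue scale P0 \<Lambda>2 (a \<otimes>\<^bsub>PU1\<^esub> a') = K (b * b')"
  proof (rule glue_lift(2)[OF _ order_mult[OF order1 b(1) b'(1)]])
    fix p assume p: "p \<in> P0"
    then show "b * b' - (a \<otimes>\<^bsub>PU1\<^esub> a') p \<in> loc scale p C"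
      using mult_lift[OF a a' p b(1) b'(1) b(2)[OF p] b'(2)[OF p]] by simp
  qed
  then show "glue scale P0 \<Lambda>2 (a \<otimes>\<^bsub>PU1\<^esub> a') = glue scale P0 \<Lambda>2 a \<otimes>\<^bsub>G2\<^esub> glue scale P0 \<Lambda>2 a'"
    unfolding b(4) b'(4) using K_mult[OF b(1) b'(3)] by simp
qed

lemma glue_is_glued:
  assumes a: "a \<in> carrier PU1"
  shows "full_lattice scale (glue scale P0 \<Lambda>2 a)"
    and "prime p \<Longrightarrow> loc scale p (glue scale P0 \<Lambda>2 a) = (*) (ext_one P0 a p) ` loc scale p \<Lambda>2"
proof -
  obtain b where b: "b \<in> \<Lambda>1" "\<And>p. p \<in> P0 \<Longrightarrow> b - a p \<in> loc scale p C"
    "unit_mod_C b" "glue scale P0 \<Lambda>2 a = K b" by (rule glue_obtain_lift[OF a]) (rule that)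
  show "full_lattice scale (glue scale P0 \<Lambda>2 a)" unfolding b(4) by (rule K_full[OF b(1)])
  show "prime p \<Longrightarrow> loc scale p (glue scale P0 \<Lambda>2 a) = (*) (ext_one P0 a p) ` loc scale p \<Lambda>2"
    unfolding b(4) by (rule loc_K[OF PU1_D[OF a] b(1,2)])
qed

lemma PU2_subset: "carrier PU2 \<subseteq> carrier PU1"
  unfolding carrier_product_group
  by (rule PiE_mono) (use subgroup.subset[OF U2_subgroup[OF P0_prime]] in blast)

text \<open>The glued lattice is determined by its localizations, and \<open>a p\<close> maps the localization of
  \<open>\<Lambda>2\<close> onto itself exactly when it is a unit of it.\<close>

lemma glue_kernel: "kernel PU1 G2 (glue scale P0 \<Lambda>2) = carrier PU2"
proof
  show "kernel PU1 G2 (glue scale P0 \<Lambda>2) \<subseteq> carrier PU2"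
  proof
    fix a assume "a \<in> kernel PU1 G2 (glue scale P0 \<Lambda>2)"
    then have a: "a \<in> carrier PU1" and eq: "glue scale P0 \<Lambda>2 a = \<Lambda>2" by (auto simp: kernel_def)
    have "a p \<in> carrier (U2 p)" if p: "p \<in> P0" for p
    proof (rule image_eq_subring_unit[OF is_subring_loc[OF subring2 P0_prime[OF p]]])
      show "(*) (a p) ` loc scale p \<Lambda>2 = loc scale p \<Lambda>2"
        using glue_is_glued(2)[OF a P0_prime[OF p]] p unfolding eq by (simp add: ext_one_def)
    qed
    then show "a \<in> carrier PU2" using a by (simp add: PiE_iff)
  qed
  show "carrier PU2 \<subseteq> kernel PU1 G2 (glue scale P0 \<Lambda>2)"
  proof
    fix a assume a2: "a \<in> carrier PU2"
    then have a: "a \<in> carrier PU1" using PU2_subset by blast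
    have "glue scale P0 \<Lambda>2 a = \<Lambda>2"
    proof (rule loc_determines[OF full_add_subgroup[OF glue_is_glued(1)[OF a]] sub2])
      fix p :: nat assume p: "prime p"
      show "loc scale p (glue scale P0 \<Lambda>2 a) = loc scale p \<Lambda>2"
      proof (cases "p \<in> P0")
        case True
        then have "a p \<in> carrier (U2 p)" using a2 by (simp add: PiE_iff)
        then show ?thesis
          using glue_is_glued(2)[OF a p] image_unit_subring[OF is_subring_loc[OF subring2 p]] True
          by (simp add: ext_one_def)
      next
        case False
        then show ?thesis using glue_is_glued(2)[OF a p] by (simp add: ext_one_def image_mult_one)
      qed
    qed
    then show "a \<in> kernel PU1 G2 (glue scale P0 \<Lambda>2)" using a by (simp add: kernel_def)
  qed
qed

text \<open>One element \<open>b + c\<close> serves as the component at every prime of \<open>P0\<close>.\<close>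

lemma local_unit_lift:
  assumes b: "unit_mod_C b"
  obtains a where "a \<in> carrier PU1" "\<And>p. p \<in> P0 \<Longrightarrow> b - a p \<in> loc scale p C"
proof -
  have b1: "b \<in> \<Lambda>1" using b by (simp add: unit_mod_C_def)
  obtain c where c: "c \<in> C" "\<forall>p\<in>P0. \<exists>y\<in>loc scale p \<Lambda>1. (b + c) * y = 1"
    using unit_mod_has_local_units[OF b] by blast
  have bc: "b + c \<in> \<Lambda>1" using zmod.subspace_add[OF sub1 b1] c(1) C_subset1 by blast
  have "(\<lambda>p\<in>P0. b + c) \<in> carrier PU1"
    using c(2) loc_superset[OF sub1 P0_prime] bc by (simp add: PiE_iff unit_group_carrier) blast
  moreover have "b - (\<lambda>p\<in>P0. b + c) p \<in> loc scale p C" if p: "p \<in> P0" for p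
    using loc_superset[OF C_sub P0_prime[OF p]] zmod.subspace_neg[OF C_sub c(1)] p by auto
  ultimately show ?thesis by (rule that)
qed

lemma glue_image: "glue scale P0 \<Lambda>2 ` carrier PU1 = Ker"
proof
  show "glue scale P0 \<Lambda>2 ` carrier PU1 \<subseteq> Ker"
  proof
    fix L assume "L \<in> glue scale P0 \<Lambda>2 ` carrier PU1"
    then obtain a where a: "a \<in> carrier PU1" "L = glue scale P0 \<Lambda>2 a" by blast
    obtain b where "unit_mod_C b" "glue scale P0 \<Lambda>2 a = K b" by (rule glue_obtain_lift[OF a(1)])
    then show "L \<in> Ker" using K_in_Ker a(2) by simp
  qed
  show "Ker \<subseteq> glue scale P0 \<Lambda>2 ` carrier PU1"
  proof
    fix L assume "L \<in> Ker"
    then obtain b where b: "unit_mod_C b" "L = K b" unfolding Ker_eq by blast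
    obtain a where a: "a \<in> carrier PU1" "\<And>p. p \<in> P0 \<Longrightarrow> b - a p \<in> loc scale p C"
      by (rule local_unit_lift[OF b(1)]) (rule that)
    have "b \<in> \<Lambda>1" using b(1) by (simp add: unit_mod_C_def)
    from glue_lift(2)[OF a(1) this a(2)] show "L \<in> glue scale P0 \<Lambda>2 ` carrier PU1"
      using b(2) a(1) by blast
  qed
qed

text \<open>The map induced by gluing on the product of the quotients \<open>U1 p / U2 p\<close>, by choice of
  representatives; \<open>glue_cong\<close> shows that the choice does not matter.\<close>

definition glue_classes :: "(nat \<Rightarrow> 'a set) \<Rightarrow> 'a set" where
  "glue_classes Y = glue scale P0 \<Lambda>2 (\<lambda>p\<in>P0. SOME a. a \<in> carrier (U1 p) \<and> Y p = cst p a)"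

lemma cst_eqD:
  assumes p: "prime p" and a: "a \<in> carrier (U1 p)" and eq: "cst p a = cst p b"
  shows "\<exists>u\<in>carrier (U2 p). a = u * b"
proof -
  have "a \<in> cst p a"
    by (rule group.rcos_self[OF comm_group.axioms(2)[OF comm_U1[OF p]] a U2_subgroup[OF p]])
  then have "a \<in> cst p b" using eq by simp
  then show ?thesis unfolding r_coset_def by auto
qed

text \<open>A unit of the localization of \<open>\<Lambda>2\<close> maps this localization onto itself.\<close>

lemma glue_cong:
  assumes "\<And>p. p \<in> P0 \<Longrightarrow> a p \<in> carrier (U1 p)" "\<And>p. p \<in> P0 \<Longrightarrow> cst p (a p) = cst p (b p)"
  shows "glue scale P0 \<Lambda>2 a = glue scale P0 \<Lambda>2 b"
proof -
  have "(*) (ext_one P0 a p) ` loc scale p \<Lambda>2 = (*) (ext_one P0 b p) ` loc scale p \<Lambda>2" if p: "prime p" for p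
  proof (cases "p \<in> P0")
    case True
    obtain u where u: "u \<in> carrier (U2 p)" "a p = u * b p"
      using cst_eqD[OF p assms(1,2)[OF True]] by blast
    have "(*) (a p) ` loc scale p \<Lambda>2 = (*) (b p) ` (*) u ` loc scale p \<Lambda>2"
      unfolding image_mult_compose u(2) by (simp add: mult.commute)
    also have "(*) u ` loc scale p \<Lambda>2 = loc scale p \<Lambda>2"
      by (rule image_unit_subring[OF is_subring_loc[OF subring2 p] u(1)])
    finally show ?thesis using True by (simp add: ext_one_def)
  qed (simp add: ext_one_def)
  then show ?thesis unfolding glue_def by simp
qed

lemma glue_classes_cst:
  assumes b: "b \<in> carrier PU1"
  shows "glue_classes (\<lambda>p\<in>P0. cst p (b p)) = glue scale P0 \<Lambda>2 b"
proof -
  have some: "(SOME a. a \<in> carrier (U1 p) \<and> cst p (b p) = cst p a) \<in> carrier (U1 p) \<and>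
      cst p (b p) = cst p (SOME a. a \<in> carrier (U1 p) \<and> cst p (b p) = cst p a)" if p: "p \<in> P0" for p
    by (rule someI[of _ "b p"]) (use b p in \<open>simp add: PiE_iff\<close>)
  show ?thesis
    unfolding glue_classes_def by (rule glue_cong) (use some in auto)
qed

lemma PQ_representative:
  assumes Y: "Y \<in> carrier PQ"
  obtains b where "b \<in> carrier PU1" "Y = (\<lambda>p\<in>P0. cst p (b p))"
proof -
  have "\<forall>p\<in>P0. \<exists>a. a \<in> carrier (U1 p) \<and> Y p = cst p a"
    using Y unfolding carrier_product_group PiE_iff carrier_FactGroup by blast
  then obtain a where a: "\<forall>p\<in>P0. a p \<in> carrier (U1 p) \<and> Y p = cst p (a p)" by metis
  have "(\<lambda>p\<in>P0. a p) \<in> carrier PU1" using a by simp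
  moreover have "Y = (\<lambda>p\<in>P0. cst p ((\<lambda>p\<in>P0. a p) p))"
  proof (rule extensionalityI[of _ P0])
    show "Y \<in> extensional P0" using Y by (simp add: PiE_iff)
  qed (use a in auto)
  ultimately show ?thesis by (rule that)
qed

lemma cst_in_PQ: "b \<in> carrier PU1 \<Longrightarrow> (\<lambda>p\<in>P0. cst p (b p)) \<in> carrier PQ"
  by (auto simp: carrier_FactGroup PiE_iff)

lemma cst_mult:
  assumes "p \<in> P0" "a \<in> carrier (U1 p)" "b \<in> carrier (U1 p)"
  shows "cst p a <#>\<^bsub>U1 p\<^esub> cst p b = cst p (a * b)"
  using normal.rcos_sum[OF U2_normal[OF P0_prime[OF assms(1)]] assms(2,3)] by simp

lemma cst_one: "p \<in> P0 \<Longrightarrow> a \<in> carrier (U2 p) \<Longrightarrow> cst p a = carrier (U2 p)"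
  by (rule subgroup.rcos_const[OF U2_subgroup[OF P0_prime] comm_group.axioms(2)[OF comm_U1[OF P0_prime]]])

lemma group_hom_glue_classes: "group_hom PQ G2 glue_classes"
proof (rule group_hom_intro[OF group_PQ group_G2 homI])
  interpret glue: group_hom PU1 G2 "glue scale P0 \<Lambda>2" by (rule group_hom_glue)
  fix Y assume "Y \<in> carrier PQ"
  then obtain b where b: "b \<in> carrier PU1" "Y = (\<lambda>p\<in>P0. cst p (b p))" by (rule PQ_representative)
  show "glue_classes Y \<in> carrier G2" unfolding b(2) glue_classes_cst[OF b(1)] by (rule glue.hom_closed[OF b(1)])
  fix Y' assume "Y' \<in> carrier PQ"
  then obtain b' where b': "b' \<in> carrier PU1" "Y' = (\<lambda>p\<in>P0. cst p (b' p))" by (rule PQ_representative)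
  have bb': "b \<otimes>\<^bsub>PU1\<^esub> b' \<in> carrier PU1" by (rule glue.G.m_closed[OF b(1) b'(1)])
  have "Y \<otimes>\<^bsub>PQ\<^esub> Y' = (\<lambda>p\<in>P0. cst p ((b \<otimes>\<^bsub>PU1\<^esub> b') p))"
    unfolding b(2) b'(2) mult_product_group
    by (rule restrict_ext) (use b(1) b'(1) cst_mult in \<open>simp add: PiE_iff\<close>)
  then have "glue_classes (Y \<otimes>\<^bsub>PQ\<^esub> Y') = glue scale P0 \<Lambda>2 (b \<otimes>\<^bsub>PU1\<^esub> b')"
    using glue_classes_cst[OF bb'] by simp
  then show "glue_classes (Y \<otimes>\<^bsub>PQ\<^esub> Y') = glue_classes Y \<otimes>\<^bsub>G2\<^esub> glue_classes Y'"
    unfolding glue.hom_mult[OF b(1) b'(1)] unfolding b(2) b'(2) glue_classes_cst[OF b(1)] glue_classes_cst[OF b'(1)] .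
qed

lemma glue_classes_image: "glue_classes ` carrier PQ = Ker"
proof
  show "glue_classes ` carrier PQ \<subseteq> Ker"
  proof
    fix L assume "L \<in> glue_classes ` carrier PQ"
    then obtain Y where Y: "Y \<in> carrier PQ" "L = glue_classes Y" by blast
    obtain b where "b \<in> carrier PU1" "Y = (\<lambda>p\<in>P0. cst p (b p))" by (rule PQ_representative[OF Y(1)])
    then have "L = glue scale P0 \<Lambda>2 b" "b \<in> carrier PU1" using Y(2) glue_classes_cst by auto
    then show "L \<in> Ker" using glue_image by blast
  qed
  show "Ker \<subseteq> glue_classes ` carrier PQ"
  proof
    fix L assume "L \<in> Ker"
    then obtain b where b: "b \<in> carrier PU1" "L = glue scale P0 \<Lambda>2 b" using glue_image by blast
    then have "L = glue_classes (\<lambda>p\<in>P0. cst p (b p))" using glue_classes_cst by simp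
    then show "L \<in> glue_classes ` carrier PQ" using cst_in_PQ[OF b(1)] by blast
  qed
qed

lemma glue_classes_inj: "inj_on glue_classes (carrier PQ)"
proof (rule group_hom.trivial_ker_imp_inj[OF group_hom_glue_classes])
  interpret h: group_hom PQ G2 glue_classes by (rule group_hom_glue_classes)
  have "Y = \<one>\<^bsub>PQ\<^esub>" if Y: "Y \<in> carrier PQ" "glue_classes Y = \<Lambda>2" for Y
  proof -
    obtain b where b: "b \<in> carrier PU1" "Y = (\<lambda>p\<in>P0. cst p (b p))" by (rule PQ_representative[OF Y(1)])
    have "b \<in> kernel PU1 G2 (glue scale P0 \<Lambda>2)"
      using b Y(2) glue_classes_cst[OF b(1)] by (simp add: kernel_def)
    then have "b \<in> carrier PU2" unfolding glue_kernel .
    then show ?thesis unfolding b(2) by (auto simp: PiE_iff intro!: restrict_ext cst_one)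
  qed
  moreover have "glue_classes \<one>\<^bsub>PQ\<^esub> = \<one>\<^bsub>G2\<^esub>" by (rule h.hom_one)
  ultimately show "kernel PQ G2 glue_classes = {\<one>\<^bsub>PQ\<^esub>}"
    using h.G.one_closed unfolding kernel_def one_lat_group by blast
qed

lemma glue_classes_iso: "glue_classes \<in> iso PQ (G2\<lparr>carrier := Ker\<rparr>)"
  using group_hom.homh[OF group_hom_glue_classes] glue_classes_inj glue_classes_image
  unfolding iso_def hom_def bij_betw_def by auto

text \<open>The union of the lattices \<open>K a\<close> with \<open>a \<in> X\<close>. For a residue class \<open>X\<close> all of them
  coincide, so this is \<open>a + C \<mapsto> C + a \<Lambda>2\<close> without a choice of representatives.\<close>

definition spread :: "'a set \<Rightarrow> 'a set" where
  "spread X = {c + a * x | c a x. c \<in> C \<and> a \<in> X \<and> x \<in> \<Lambda>2}"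

lemma spread_cl: "spread (cl a) = K a"
proof
  show "spread (cl a) \<subseteq> K a"
  proof
    fix y assume "y \<in> spread (cl a)"
    then obtain c d x where y: "y = c + (d + a) * x" "c \<in> C" "d \<in> C" "x \<in> \<Lambda>2"
      unfolding spread_def by blast
    have "c + d * x \<in> C" by (rule zmod.subspace_add[OF C_sub y(2) C_mult[OF y(3) subsetD[OF sub y(4)]]])
    from K_memI[OF this y(4), of a] show "y \<in> K a" unfolding y(1) by (simp add: algebra_simps)
  qed
  show "K a \<subseteq> spread (cl a)"
  proof
    fix y assume "y \<in> K a"
    then obtain c x where y: "y = c + a * x" "c \<in> C" "x \<in> \<Lambda>2" unfolding K_def by blast
    moreover have "a \<in> cl a" using zmod.subspace_0[OF C_sub] by force
    ultimately show "y \<in> spread (cl a)" unfolding spread_def by blast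
  qed
qed

lemma Q1_carrier: "X \<in> carrier Q1 \<longleftrightarrow> (\<exists>a. unit_mod_C a \<and> X = cl a)"
  unfolding quot_carrier[OF subring1 C_ideal] unit_mod_C_def by blast

lemma Q1_cl_iff: "a \<in> \<Lambda>1 \<Longrightarrow> cl a \<in> carrier Q1 \<longleftrightarrow> unit_mod_C a"
proof
  assume a: "a \<in> \<Lambda>1" and "cl a \<in> carrier Q1"
  then obtain b where b: "unit_mod_C b" "cl a = cl b" using Q1_carrier by blast
  have ab: "a - b \<in> C" using b(2) unfolding residue_class_eq_iff[OF C_sub] .
  obtain b' g where b': "b \<in> \<Lambda>1" "b' \<in> \<Lambda>1" "g \<in> C" "b * b' = 1 + g" by (rule unit_mod_CE[OF b(1)])
  have "a * b' - 1 = (a - b) * b' + g" using b'(4) by (simp add: algebra_simps)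
  also have "\<dots> \<in> C" by (rule zmod.subspace_add[OF C_sub C_mult[OF ab b'(2)] b'(3)])
  finally show "unit_mod_C a" by (rule unit_mod_CI[OF a b'(2)])
qed (use Q1_carrier in blast)

lemma comm_Q1: "comm_group Q1"
  by (rule comm_group_quot_unit_group[OF subring1 C_ideal])

lemma group_hom_spread: "group_hom Q1 G2 spread"
proof (rule group_hom_intro[OF comm_group.axioms(2)[OF comm_Q1] group_G2 homI])
  fix X assume "X \<in> carrier Q1"
  then obtain a where a: "unit_mod_C a" "X = cl a" using Q1_carrier by blast
  show "spread X \<in> carrier G2" unfolding a(2) spread_cl by (rule K_in_group[OF a(1)])
  fix Y assume "Y \<in> carrier Q1"
  then obtain b where b: "unit_mod_C b" "Y = cl b" using Q1_carrier by blast
  have 1: "a \<in> \<Lambda>1" "b \<in> \<Lambda>1" using a b by (auto simp: unit_mod_C_def)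
  show "spread (X \<otimes>\<^bsub>Q1\<^esub> Y) = spread X \<otimes>\<^bsub>G2\<^esub> spread Y"
    unfolding a(2) b(2) quot_mult[OF subring1 C_ideal 1] spread_cl using K_mult[OF 1(1) b(1)] by simp
qed

lemma spread_kernel: "kernel Q1 G2 spread = carrier Q2"
proof
  show "kernel Q1 G2 spread \<subseteq> carrier Q2"
  proof
    fix X assume "X \<in> kernel Q1 G2 spread"
    then have X: "X \<in> carrier Q1" "spread X = \<Lambda>2" by (auto simp: kernel_def)
    then obtain a where a: "unit_mod_C a" "X = cl a" using Q1_carrier by blast
    have "K a = \<Lambda>2" using X(2) unfolding a(2) spread_cl .
    then show "X \<in> carrier Q2"
      unfolding quot_carrier[OF subring2 C_ideal2] using K_eq_order_iff[OF a(1)] a(2) by blast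
  qed
  show "carrier Q2 \<subseteq> kernel Q1 G2 spread"
  proof
    fix X assume "X \<in> carrier Q2"
    then obtain a a' where a: "a \<in> \<Lambda>2" "a' \<in> \<Lambda>2" "a * a' - 1 \<in> C" "X = cl a"
      unfolding quot_carrier[OF subring2 C_ideal2] by blast
    have u: "unit_mod_C a" using a sub by (intro unit_mod_CI[of a a']) auto
    have "K a = \<Lambda>2" using K_eq_order_iff[OF u] a by blast
    then show "X \<in> kernel Q1 G2 spread"
      using u Q1_carrier a(4) spread_cl by (auto simp: kernel_def)
  qed
qed

lemma spread_image: "spread ` carrier Q1 = Ker"
proof -
  have "carrier Q1 = cl ` {b. unit_mod_C b}" using Q1_carrier by blast
  then show ?thesis unfolding Ker_eq by (simp add: image_image spread_cl)
qed

definition spread_classes :: "'a set set \<Rightarrow> 'a set" where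
  "spread_classes = (\<lambda>Z. the_elem (spread ` Z))"

lemma spread_classes_iso: "spread_classes \<in> iso (Q1 Mod carrier Q2) (G2\<lparr>carrier := Ker\<rparr>)"
  using group_hom.induced_iso[OF group_hom_spread] unfolding spread_kernel spread_image spread_classes_def .

lemma spread_classes_coset:
  assumes "unit_mod_C a"
  shows "spread_classes (carrier Q2 #>\<^bsub>Q1\<^esub> cl a) = K a"
  using group_hom.induced_map_coset[OF group_hom_spread, of "cl a"] Q1_carrier assms
  unfolding spread_kernel spread_cl spread_classes_def by blast

text \<open>The unit groups of the residue rings and those of the localizations are compared through
  the kernel of the extension map, to which both quotients are isomorphic.\<close>

definition local_classes :: "'a set set \<Rightarrow> nat \<Rightarrow> 'a set" where
  "local_classes = inv_into (carrier PQ) glue_classes \<circ> spread_classes"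

lemma local_classes_iso: "local_classes \<in> iso (Q1 Mod carrier Q2) PQ"
  unfolding local_classes_def
  by (rule iso_set_trans[OF spread_classes_iso group.iso_set_sym[OF group_PQ glue_classes_iso]])

text \<open>\<open>P0\<close> is finite, so the direct sum is the whole product.\<close>

lemma local_classes_iso_sum:
  "local_classes \<in> iso (Q1 Mod carrier Q2) (sum_group P0 (\<lambda>p. U1 p Mod carrier (U2 p)))"
proof -
  have "carrier (sum_group P0 (\<lambda>p. U1 p Mod carrier (U2 p)))
      = {x \<in> carrier PQ. finite {p \<in> P0. x p \<noteq> \<one>\<^bsub>U1 p Mod carrier (U2 p)\<^esub>}}"
    unfolding carrier_product_group by (rule carrier_sum_group) (rule group_UQ)
  also have "\<dots> = carrier PQ" using finite_P0 by simp
  finally have "carrier (sum_group P0 (\<lambda>p. U1 p Mod carrier (U2 p))) = carrier PQ" .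
  then show ?thesis
    using local_classes_iso unfolding iso_def hom_def by simp
qed

lemma glue_local_classes_iso: "glue_classes \<circ> local_classes \<in> iso (Q1 Mod carrier Q2) (G2\<lparr>carrier := Ker\<rparr>)"
  by (rule iso_set_trans[OF local_classes_iso glue_classes_iso])

lemma glue_local_classes_coset:
  assumes a: "unit_mod_C a"
  shows "(glue_classes \<circ> local_classes) (carrier Q2 #>\<^bsub>Q1\<^esub> cl a) = K a"
proof -
  have "K a \<in> glue_classes ` carrier PQ" unfolding glue_classes_image by (rule K_in_Ker[OF a])
  then show ?thesis
    unfolding local_classes_def by (simp add: spread_classes_coset[OF a] f_inv_into_f)
qed

text \<open>The residue class of \<open>a\<close> and the tuple \<open>b\<close> correspond to the same lattice, since \<open>K a\<close>
  is glued from \<open>b\<close> when \<open>a\<close> lifts \<open>b\<close>. Thus \<open>local_classes\<close> is the map induced by reduction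
  modulo the conductor.\<close>

lemma local_classes_coset:
  assumes a: "unit_mod_C a" and b: "b \<in> carrier PU1" "\<And>p. p \<in> P0 \<Longrightarrow> a - b p \<in> loc scale p C"
  shows "local_classes (carrier Q2 #>\<^bsub>Q1\<^esub> cl a) = (\<lambda>p\<in>P0. cst p (b p))"
proof -
  have a1: "a \<in> \<Lambda>1" using a by (simp add: unit_mod_C_def)
  have "spread_classes (carrier Q2 #>\<^bsub>Q1\<^esub> cl a) = glue_classes (\<lambda>p\<in>P0. cst p (b p))"
    by (simp only: spread_classes_coset[OF a] glue_classes_cst[OF b(1)] glue_lift(2)[OF b(1) a1 b(2)])
  then show ?thesis
    unfolding local_classes_def using inv_into_f_f[OF glue_classes_inj cst_in_PQ[OF b(1)]] by simp
qed

subsection \<open>Global units and classes\<close>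

lemma global_unit_local:
  assumes u: "u \<in> carrier (unit_group \<Lambda>1)" and p: "prime p"
  shows "u \<in> carrier (U1 p)"
  using u loc_superset[OF sub1 p] unfolding unit_group_carrier by blast

lemma const_in_PU1: "u \<in> carrier (unit_group \<Lambda>1) \<Longrightarrow> (\<lambda>p\<in>P0. u) \<in> carrier PU1"
  using global_unit_local P0_prime by simp

definition diagonal :: "'a \<Rightarrow> nat \<Rightarrow> 'a set" where
  "diagonal u = (\<lambda>p\<in>P0. cst p u)"

text \<open>A global unit lifts its own diagonal tuple, and \<open>C = u C \<subseteq> u \<Lambda>2\<close>.\<close>

lemma glue_classes_diagonal:
  assumes u: "u \<in> carrier (unit_group \<Lambda>1)"
  shows "glue_classes (diagonal u) = (*) u ` \<Lambda>2"
proof -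
  obtain v where v: "u \<in> \<Lambda>1" "v \<in> \<Lambda>1" "u * v = 1" using u unfolding unit_group_carrier by blast
  note a = const_in_PU1[OF u]
  have "diagonal u = (\<lambda>p\<in>P0. cst p ((\<lambda>p\<in>P0. u) p))" unfolding diagonal_def by (rule restrict_ext) simp
  then have "glue_classes (diagonal u) = glue scale P0 \<Lambda>2 (\<lambda>p\<in>P0. u)" using glue_classes_cst[OF a] by simp
  also have "\<dots> = K u"
    by (rule glue_lift(2)[OF a v(1)]) (simp add: zmod.subspace_0[OF add_subgroup_loc[OF C_sub P0_prime]])
  also have "\<dots> = (*) u ` \<Lambda>2"
  proof
    show "K u \<subseteq> (*) u ` \<Lambda>2"
    proof (rule K_least[OF add_subgroup_image_mult[OF sub2]])
      show "C \<subseteq> (*) u ` \<Lambda>2"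
      proof
        fix c assume c: "c \<in> C"
        have "u * (c * v) = c * (u * v)" by (simp only: ac_simps)
        then have "c = u * (c * v)" unfolding v(3) by simp
        then show "c \<in> (*) u ` \<Lambda>2" using C_mult[OF c v(2)] C_subset2 by blast
      qed
    qed blast
  qed (use mult_mem_K in blast)
  finally show ?thesis .
qed

lemma diagonal_in_PQ:
  assumes u: "u \<in> carrier (unit_group \<Lambda>1)"
  shows "diagonal u \<in> carrier PQ"
proof -
  have "diagonal u = (\<lambda>p\<in>P0. cst p ((\<lambda>p\<in>P0. u) p))" unfolding diagonal_def by (rule restrict_ext) simp
  then show ?thesis using cst_in_PQ[OF const_in_PU1[OF u]] by simp
qed

lemma group_hom_diagonal: "group_hom (unit_group \<Lambda>1) PQ diagonal"
proof (rule group_hom_intro[OF comm_group.axioms(2)[OF comm_group_unit_group[OF subring1]] group_PQ homI])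
  fix u v assume u: "u \<in> carrier (unit_group \<Lambda>1)" and v: "v \<in> carrier (unit_group \<Lambda>1)"
  show "diagonal u \<in> carrier PQ" by (rule diagonal_in_PQ[OF u])
  have "cst p (u * v) = cst p u <#>\<^bsub>U1 p\<^esub> cst p v" if p: "p \<in> P0" for p
    by (rule cst_mult[OF p global_unit_local[OF u P0_prime[OF p]] global_unit_local[OF v P0_prime[OF p]], symmetric])
  then show "diagonal (u \<otimes>\<^bsub>unit_group \<Lambda>1\<^esub> v) = diagonal u \<otimes>\<^bsub>PQ\<^esub> diagonal v"
    unfolding diagonal_def by (auto intro!: restrict_ext)
qed

text \<open>As \<open>glue_classes\<close> is injective and sends \<open>diagonal u\<close> to \<open>u \<Lambda>2\<close>, the condition is
  \<open>u \<Lambda>2 = \<Lambda>2\<close>.\<close>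

lemma diagonal_kernel: "kernel (unit_group \<Lambda>1) PQ diagonal = carrier (unit_group \<Lambda>2)"
proof -
  interpret g: group_hom PQ G2 glue_classes by (rule group_hom_glue_classes)
  have "diagonal u = \<one>\<^bsub>PQ\<^esub> \<longleftrightarrow> (*) u ` \<Lambda>2 = \<Lambda>2" if u: "u \<in> carrier (unit_group \<Lambda>1)" for u
  proof -
    have "diagonal u = \<one>\<^bsub>PQ\<^esub> \<longleftrightarrow> glue_classes (diagonal u) = glue_classes \<one>\<^bsub>PQ\<^esub>"
      using inj_on_eq_iff[OF glue_classes_inj diagonal_in_PQ[OF u] g.G.one_closed] by blast
    then show ?thesis unfolding g.hom_one glue_classes_diagonal[OF u] by simp
  qed
  moreover have "carrier (unit_group \<Lambda>2) \<subseteq> carrier (unit_group \<Lambda>1)"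
    by (rule subgroup.subset[OF unit_group_subgroup[OF subring2 subring1 sub]])
  moreover have "(*) u ` \<Lambda>2 = \<Lambda>2 \<longleftrightarrow> u \<in> carrier (unit_group \<Lambda>2)" for u
    using image_unit_subring[OF subring2] image_eq_subring_unit[OF subring2] by blast
  ultimately show ?thesis unfolding kernel_def by blast
qed

lemma group_hom_class_of_glue: "group_hom PQ E2 (\<lambda>Y. eps_class scale (glue_classes Y))"
  using hom_compose[OF group_hom.homh[OF group_hom_glue_classes] group_hom.homh[OF group_hom_eps_class[OF order2]]]
  by (intro group_hom_intro[OF group_PQ group_E2]) (simp add: comp_def)

text \<open>If a lattice \<open>u \<Lambda>2\<close> in the class of \<open>\<Lambda>2\<close> lies in the kernel of the extension map, then
  \<open>u \<Lambda>1 = \<Lambda>1\<close>, so \<open>u\<close> is a unit of \<open>\<Lambda>1\<close>.\<close>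

lemma diagonal_image:
  "diagonal ` carrier (unit_group \<Lambda>1) = kernel PQ E2 (\<lambda>Y. eps_class scale (glue_classes Y))"
proof
  note f2 = order_full[OF order2]
  show "diagonal ` carrier (unit_group \<Lambda>1) \<subseteq> kernel PQ E2 (\<lambda>Y. eps_class scale (glue_classes Y))"
  proof
    fix Y assume "Y \<in> diagonal ` carrier (unit_group \<Lambda>1)"
    then obtain u where u: "u \<in> carrier (unit_group \<Lambda>1)" "Y = diagonal u" by blast
    have unit: "u dvd 1" using u(1) unfolding unit_group_carrier by (metis dvd_triv_left)
    have "eps_class scale \<Lambda>2 = eps_class scale (glue_classes Y)"
      unfolding u(2) glue_classes_diagonal[OF u(1)]
      using eps_class_eq_iff[OF f2 full_image[OF unit f2]] unit by blast
    then show "Y \<in> kernel PQ E2 (\<lambda>Y. eps_class scale (glue_classes Y))"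
      using diagonal_in_PQ[OF u(1)] u(2) unfolding kernel_def by simp
  qed
  show "kernel PQ E2 (\<lambda>Y. eps_class scale (glue_classes Y)) \<subseteq> diagonal ` carrier (unit_group \<Lambda>1)"
  proof
    fix Y assume "Y \<in> kernel PQ E2 (\<lambda>Y. eps_class scale (glue_classes Y))"
    then have Y: "Y \<in> carrier PQ" "eps_class scale (glue_classes Y) = eps_class scale \<Lambda>2"
      by (auto simp: kernel_def)
    have ker: "glue_classes Y \<in> Ker" using Y(1) glue_classes_image by blast
    then have L: "glue_classes Y \<in> carrier G2" "lat_mult \<Lambda>1 (glue_classes Y) = \<Lambda>1"
      by (simp_all add: kernel_ext_iff)
    obtain u where u: "u dvd 1" "(*) u ` \<Lambda>2 = glue_classes Y"
      using eps_class_eq_iff[OF f2 lat_group_full[OF order2 L(1)]] Y(2) by metis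
    have "\<Lambda>1 = (*) u ` lat_mult \<Lambda>1 \<Lambda>2"
      using L(2) unfolding u(2)[symmetric] lat_mult_image_right[OF sub2] by simp
    then have "(*) u ` \<Lambda>1 = \<Lambda>1" using lat_mult_suborder[OF order1 order2 sub] by simp
    then have uu: "u \<in> carrier (unit_group \<Lambda>1)" by (rule image_eq_subring_unit[OF subring1])
    have "glue_classes Y = glue_classes (diagonal u)" unfolding glue_classes_diagonal[OF uu] u(2) ..
    then have "Y = diagonal u" using inj_onD[OF glue_classes_inj _ Y(1) diagonal_in_PQ[OF uu]] by blast
    then show "Y \<in> diagonal ` carrier (unit_group \<Lambda>1)" using uu by blast
  qed
qed

text \<open>If the class of \<open>L\<close> becomes trivial over \<open>\<Lambda>1\<close>, say \<open>u \<Lambda>1 L = \<Lambda>1\<close>, then the lattice \<open>u L\<close>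
  in the same class lies in the kernel of the extension map.\<close>

lemma class_image:
  "(\<lambda>Y. eps_class scale (glue_classes Y)) ` carrier PQ = kernel E2 E1 (class_mult scale (eps_class scale \<Lambda>1))"
proof
  note f1 = order_full[OF order1]
  have E2_mem: "eps_class scale L \<in> carrier E2" if "L \<in> carrier G2" for L
    using that unfolding carrier_class_group[OF order2] by blast
  have ext: "class_mult scale (eps_class scale \<Lambda>1) (eps_class scale L) = eps_class scale (lat_mult \<Lambda>1 L)"
    if "L \<in> carrier G2" for L
    by (rule class_mult_eps_class[OF f1 lat_group_full[OF order2 that]])
  show "(\<lambda>Y. eps_class scale (glue_classes Y)) ` carrier PQ \<subseteq> kernel E2 E1 (class_mult scale (eps_class scale \<Lambda>1))"
  proof
    fix X assume "X \<in> (\<lambda>Y. eps_class scale (glue_classes Y)) ` carrier PQ"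
    then obtain L where L: "X = eps_class scale L" "L \<in> Ker" using glue_classes_image by blast
    then show "X \<in> kernel E2 E1 (class_mult scale (eps_class scale \<Lambda>1))"
      using E2_mem[of L] ext[of L] by (simp add: kernel_ext_iff) (simp add: kernel_def)
  qed
  show "kernel E2 E1 (class_mult scale (eps_class scale \<Lambda>1)) \<subseteq> (\<lambda>Y. eps_class scale (glue_classes Y)) ` carrier PQ"
  proof
    fix X assume "X \<in> kernel E2 E1 (class_mult scale (eps_class scale \<Lambda>1))"
    then have X: "X \<in> carrier E2" "class_mult scale (eps_class scale \<Lambda>1) X = eps_class scale \<Lambda>1"
      by (auto simp: kernel_def)
    obtain L where L: "L \<in> carrier G2" "X = eps_class scale L"
      using X(1) unfolding carrier_class_group[OF order2] by blast
    have Lf: "full_lattice scale L" by (rule lat_group_full[OF order2 L(1)])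
    have "eps_class scale (lat_mult \<Lambda>1 L) = eps_class scale \<Lambda>1" using X(2) unfolding L(2) ext[OF L(1)] .
    then obtain u where u: "u dvd 1" "(*) u ` lat_mult \<Lambda>1 L = \<Lambda>1"
      using eps_class_eq_iff[OF full_lat_mult[OF f1 Lf] f1] by blast
    have G: "(*) u ` L \<in> carrier G2" by (rule image_in_lat_group[OF order2 L(1) u(1)])
    have "(*) u ` L \<in> Ker"
      unfolding kernel_ext_iff lat_mult_image_right[OF full_add_subgroup[OF Lf]] using G u(2) by blast
    then obtain Y where Y: "Y \<in> carrier PQ" "(*) u ` L = glue_classes Y" using glue_classes_image by blast
    have "X = eps_class scale (glue_classes Y)"
      unfolding L(2) Y(2)[symmetric]
      using eps_class_eq_iff[OF Lf lat_group_full[OF order2 G]] u(1) by blast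
    then show "X \<in> (\<lambda>Y. eps_class scale (glue_classes Y)) ` carrier PQ" using Y(1) by blast
  qed
qed

lemma extension_image: "lat_mult \<Lambda>1 ` carrier G2 = carrier G1"
  using extension_surj group_hom.hom_closed[OF group_hom_lat_group[OF order1 order2 sub]] by blast

lemma class_extension_image: "class_mult scale (eps_class scale \<Lambda>1) ` carrier E2 = carrier E1"
proof -
  have "class_mult scale (eps_class scale \<Lambda>1) ` carrier E2 = (\<lambda>L. eps_class scale (lat_mult \<Lambda>1 L)) ` carrier G2"
    unfolding carrier_class_group[OF order2] image_image
    by (rule image_cong[OF refl]) (rule class_mult_eps_class[OF order_full[OF order1] lat_group_full[OF order2]])
  also have "\<dots> = eps_class scale ` carrier G1" unfolding extension_image[symmetric] image_image ..
  finally show ?thesis unfolding carrier_class_group[OF order1] .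
qed

subsection \<open>Counting\<close>

lemma finite_Q1: "finite (carrier Q1)"
proof -
  obtain N where N: "N > 0" "\<And>x. x \<in> \<Lambda>1 \<Longrightarrow> of_nat N * x \<in> C"
    by (rule C_multiple) (rule that)
  obtain T where T: "finite T" "T \<subseteq> \<Lambda>1" "\<And>x. x \<in> \<Lambda>1 \<Longrightarrow> \<exists>t\<in>T. \<exists>y\<in>\<Lambda>1. x = t + of_nat N * y"
    by (rule finite_residues[OF order_full[OF order1] N(1)]) (rule that)
  have "carrier Q1 \<subseteq> cl ` T"
  proof
    fix X assume "X \<in> carrier Q1"
    then obtain a where a: "a \<in> \<Lambda>1" "X = cl a" using Q1_carrier unit_mod_C_def by blast
    obtain t y where t: "t \<in> T" "y \<in> \<Lambda>1" "a = t + of_nat N * y" using T(3)[OF a(1)] by blast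
    have "a - t = of_nat N * y" unfolding t(3) by simp
    then have "a - t \<in> C" using N(2)[OF t(2)] by simp
    then have "cl a = cl t" unfolding residue_class_eq_iff[OF C_sub] .
    then show "X \<in> cl ` T" unfolding a(2) using t(1) by blast
  qed
  then show ?thesis by (rule finite_subset) (simp add: T(1))
qed

lemma Q2_subgroup: "subgroup (carrier Q2) Q1"
  using group_hom.subgroup_kernel[OF group_hom_spread] unfolding spread_kernel .

lemma finite_Q2: "finite (carrier Q2)"
  by (rule finite_subset[OF subgroup.subset[OF Q2_subgroup] finite_Q1])

lemma finite_Ker: "finite Ker"
  unfolding spread_image[symmetric] by (rule finite_imageI[OF finite_Q1])

lemma finite_PQ: "finite (carrier PQ)"
  by (rule finite_imageD[OF _ glue_classes_inj]) (simp only: glue_classes_image finite_Ker)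

lemma finite_rcosets_units: "finite (rcosets\<^bsub>unit_group \<Lambda>1\<^esub> carrier (unit_group \<Lambda>2))"
proof -
  have "diagonal ` carrier (unit_group \<Lambda>1) \<subseteq> carrier PQ" using diagonal_in_PQ by blast
  then have "finite (diagonal ` carrier (unit_group \<Lambda>1))" by (rule finite_subset[OF _ finite_PQ])
  then show ?thesis
    using group_hom.card_rcosets_kernel(2)[OF group_hom_diagonal] unfolding diagonal_kernel by blast
qed

lemma card_Q1: "order Q1 = card (carrier PQ) * order Q2"
proof -
  have "card (carrier PQ) = card Ker"
    using card_image[OF glue_classes_inj] unfolding glue_classes_image by simp
  then show ?thesis
    using group_hom.card_image_kernel[OF group_hom_spread]
    unfolding spread_image spread_kernel by (simp add: Coset.order_def)
qed

lemma card_PQ: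
  "card (carrier PQ) = card (rcosets\<^bsub>unit_group \<Lambda>1\<^esub> carrier (unit_group \<Lambda>2))
    * card (kernel E2 E1 (class_mult scale (eps_class scale \<Lambda>1)))"
  using group_hom.card_image_kernel[OF group_hom_class_of_glue]
    group_hom.card_rcosets_kernel(1)[OF group_hom_diagonal]
  unfolding class_image diagonal_image[symmetric] diagonal_kernel by (simp add: Coset.order_def mult.commute)

lemma card_E2:
  "order E2 = order E1 * card (kernel E2 E1 (class_mult scale (eps_class scale \<Lambda>1)))"
  using group_hom.card_image_kernel[OF group_hom_class_group[OF order1 order2 sub]]
  unfolding class_extension_image by (simp add: Coset.order_def)

text \<open>The common factor is the order of the kernel of \<open>E2 \<rightarrow> E1\<close>, which appears in \<open>card_PQ\<close>
  and in \<open>card_E2\<close>.\<close>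

lemma class_number_formula:
  "rat_of_nat (order E2) / rat_of_nat (order E1)
    = rat_of_nat (order Q1) / rat_of_nat (order Q2)
      * (1 / rat_of_nat (card (rcosets\<^bsub>unit_group \<Lambda>1\<^esub> carrier (unit_group \<Lambda>2))))"
proof -
  have "order Q2 \<noteq> 0"
    using finite_Q2 subgroup.one_closed[OF Q2_subgroup] by (auto simp: Coset.order_def)
  moreover have "order E1 \<noteq> 0"
    using finite_class_group[OF order1] monoid.one_closed[OF group.is_monoid[OF group_E1]]
    by (auto simp: Coset.order_def)
  moreover have "card (rcosets\<^bsub>unit_group \<Lambda>1\<^esub> carrier (unit_group \<Lambda>2)) \<noteq> 0"
  proof -
    have "carrier PQ \<noteq> {}"
      using monoid.one_closed[OF group.is_monoid[OF group_PQ]] by blast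
    then have "card (carrier PQ) \<noteq> 0"
      using finite_PQ card_0_eq by blast
    then show ?thesis unfolding card_PQ by simp
  qed
  ultimately show ?thesis
    unfolding card_Q1 card_PQ card_E2 by (simp add: field_simps)
qed

subsection \<open>Exactness\<close>

lemma exact_inclusion:
  assumes "group G" "group H" "(\<lambda>a. a) \<in> hom G H"
  shows "exact_at (singleton_group ()) (\<lambda>_. \<one>\<^bsub>G\<^esub>) G (\<lambda>a. a) H"
proof -
  interpret G: group G by fact
  have hom: "(\<lambda>_. \<one>\<^bsub>G\<^esub>) \<in> hom (singleton_group ()) G"
    by (rule homI) simp_all
  have gh: "group_hom G H (\<lambda>a. a)" by (rule group_hom_intro[OF assms])
  have "\<one>\<^bsub>G\<^esub> = \<one>\<^bsub>H\<^esub>" by (rule group_hom.hom_one[OF gh])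
  then have "kernel G H (\<lambda>a. a) = {\<one>\<^bsub>G\<^esub>}"
    unfolding kernel_def using G.one_closed by auto
  then show ?thesis
    unfolding exact_at_def using group_hom_intro[OF singleton_group assms(1) hom] gh by simp
qed

lemma exact_onto:
  assumes "group_hom G H h" "h ` carrier G = carrier H"
  shows "exact_at G h H (\<lambda>_. ()) (singleton_group ())"
proof -
  interpret group_hom G H h by fact
  have hom: "(\<lambda>_. ()) \<in> hom H (singleton_group ())"
    by (rule homI) simp_all
  show ?thesis
    unfolding exact_at_def kernel_def
    using group_hom_intro[OF H.is_group singleton_group hom] assms by simp
qed

lemma inclusion_PU: "(\<lambda>a. a) \<in> hom PU2 PU1"
  by (rule homI) (use PU2_subset in auto)

lemma inclusion_units: "(\<lambda>u. u) \<in> hom (unit_group \<Lambda>2) (unit_group \<Lambda>1)"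
  by (rule homI) (use subgroup.subset[OF unit_group_subgroup[OF subring2 subring1 sub]] in auto)

lemma group_global_units: "group (unit_group \<Lambda>1)" "group (unit_group \<Lambda>2)"
  using comm_group_unit_group[OF subring1] comm_group_unit_group[OF subring2]
  by (auto intro: comm_group.axioms(2))

lemma conductor_lat_ideal: "lat_ideal scale \<Lambda>1 C"
  unfolding lat_ideal_def using full_C order_of_C by blast

lemma conductor_greatest: "\<forall>L. lat_ideal scale \<Lambda>1 L \<and> L \<subseteq> \<Lambda>2 \<longrightarrow> L \<subseteq> C"
  using C_greatest by blast

lemma exact_at_PU2: "exact_at (singleton_group ()) (\<lambda>_. \<one>\<^bsub>PU2\<^esub>) PU2 (\<lambda>a. a) PU1"
  by (rule exact_inclusion[OF group_PU2 group_PU1 inclusion_PU])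

lemma exact_at_PU1: "exact_at PU2 (\<lambda>a. a) PU1 (glue scale P0 \<Lambda>2) G2"
  unfolding exact_at_def glue_kernel
  using group_hom_intro[OF group_PU2 group_PU1 inclusion_PU] group_hom_glue by simp

lemma exact_at_G2: "exact_at PU1 (glue scale P0 \<Lambda>2) G2 (lat_mult \<Lambda>1) G1"
  unfolding exact_at_def
  using group_hom_glue group_hom_lat_group[OF order1 order2 sub] glue_image by blast

lemma exact_at_G1: "exact_at G2 (lat_mult \<Lambda>1) G1 (\<lambda>_. ()) (singleton_group ())"
  by (rule exact_onto[OF group_hom_lat_group[OF order1 order2 sub] extension_image])

lemma extension_epi: "lat_mult \<Lambda>1 \<in> epi G2 G1"
  unfolding epi_def using group_hom.homh[OF group_hom_lat_group[OF order1 order2 sub]] extension_image by blast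

lemma glue_unique:
  "\<forall>a \<in> carrier PU1.
    let is_glued = (\<lambda>L. full_lattice scale L \<and>
          (\<forall>p. prime p \<longrightarrow> loc scale p L = (*) (ext_one P0 a p) ` loc scale p \<Lambda>2))
    in is_glued (glue scale P0 \<Lambda>2 a) \<and> (\<exists>!L. is_glued L)"
proof
  fix a assume a: "a \<in> carrier PU1"
  let ?glued = "\<lambda>L. full_lattice scale L \<and>
    (\<forall>p. prime p \<longrightarrow> loc scale p L = (*) (ext_one P0 a p) ` loc scale p \<Lambda>2)"
  have glued: "?glued (glue scale P0 \<Lambda>2 a)" by (intro conjI allI impI glue_is_glued[OF a])
  have unique: "L = glue scale P0 \<Lambda>2 a"
    if L: "full_lattice scale L" "\<forall>p. prime p \<longrightarrow> loc scale p L = (*) (ext_one P0 a p) ` loc scale p \<Lambda>2" for L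
  proof (rule loc_determines[OF full_add_subgroup[OF L(1)] full_add_subgroup[OF glue_is_glued(1)[OF a]]])
    fix p :: nat assume p: "prime p"
    show "loc scale p L = loc scale p (glue scale P0 \<Lambda>2 a)"
      unfolding glue_is_glued(2)[OF a p] using L(2) p by blast
  qed
  show "let is_glued = ?glued in is_glued (glue scale P0 \<Lambda>2 a) \<and> (\<exists>!L. is_glued L)"
    unfolding Let_def
  proof (rule conjI[OF glued ex1I[of ?glued, OF glued]])
    fix L assume "?glued L"
    then show "L = glue scale P0 \<Lambda>2 a" by (elim conjE) (rule unique)
  qed
qed

text \<open>A restatement of \<open>local_classes_coset\<close> in terms of the residue classes of the quotient
  rings: \<open>b\<close> is a tuple of lifts of the reductions of \<open>a\<close>.\<close>

lemma local_classes_lift: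
  "\<forall>a\<in>\<Lambda>1. C +>\<^bsub>subring_of \<Lambda>1\<^esub> a \<in> carrier Q1 \<longrightarrow>
    (let is_lift = (\<lambda>b. b \<in> carrier PU1 \<and>
          (\<forall>p\<in>P0. loc scale p C +>\<^bsub>subring_of (loc scale p \<Lambda>1)\<^esub> b p
                 = loc scale p C +>\<^bsub>subring_of (loc scale p \<Lambda>1)\<^esub> a))
     in (\<exists>b. is_lift b) \<and>
        (\<forall>b. is_lift b \<longrightarrow>
           local_classes (carrier Q2 #>\<^bsub>Q1\<^esub> (C +>\<^bsub>subring_of \<Lambda>1\<^esub> a)) = (\<lambda>p\<in>P0. cst p (b p))))"
proof (intro ballI impI)
  fix a assume a: "a \<in> \<Lambda>1" and "C +>\<^bsub>subring_of \<Lambda>1\<^esub> a \<in> carrier Q1"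
  then have u: "unit_mod_C a" unfolding a_r_coset_subring_of using Q1_cl_iff by blast
  have lift_iff: "(\<forall>p\<in>P0. loc scale p C +>\<^bsub>subring_of (loc scale p \<Lambda>1)\<^esub> b p
      = loc scale p C +>\<^bsub>subring_of (loc scale p \<Lambda>1)\<^esub> a) \<longleftrightarrow> (\<forall>p\<in>P0. a - b p \<in> loc scale p C)" for b
    unfolding a_r_coset_subring_of
    by (rule ball_cong[OF refl], subst eq_commute, rule residue_class_eq_iff[OF add_subgroup_loc[OF C_sub P0_prime]])
  obtain b where "b \<in> carrier PU1" "\<And>p. p \<in> P0 \<Longrightarrow> a - b p \<in> loc scale p C"
    by (rule local_unit_lift[OF u]) (rule that)
  then have ex: "\<exists>b. b \<in> carrier PU1 \<and> (\<forall>p\<in>P0. a - b p \<in> loc scale p C)" by blast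
  have eq: "local_classes (carrier Q2 #>\<^bsub>Q1\<^esub> cl a) = (\<lambda>p\<in>P0. cst p (b p))"
    if b: "b \<in> carrier PU1 \<and> (\<forall>p\<in>P0. a - b p \<in> loc scale p C)" for b
    by (rule local_classes_coset[OF u]) (use b in auto)
  show "let is_lift = (\<lambda>b. b \<in> carrier PU1 \<and>
          (\<forall>p\<in>P0. loc scale p C +>\<^bsub>subring_of (loc scale p \<Lambda>1)\<^esub> b p
                 = loc scale p C +>\<^bsub>subring_of (loc scale p \<Lambda>1)\<^esub> a))
     in (\<exists>b. is_lift b) \<and>
        (\<forall>b. is_lift b \<longrightarrow>
           local_classes (carrier Q2 #>\<^bsub>Q1\<^esub> (C +>\<^bsub>subring_of \<Lambda>1\<^esub> a)) = (\<lambda>p\<in>P0. cst p (b p)))"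
    unfolding Let_def lift_iff unfolding a_r_coset_subring_of
    by (rule conjI[OF ex]) (intro allI impI, rule eq)
qed

lemma glue_classes_induced: "\<forall>b \<in> carrier PU1. glue_classes (\<lambda>p\<in>P0. cst p (b p)) = glue scale P0 \<Lambda>2 b"
  using glue_classes_cst by blast

lemma glue_local_classes_formula:
  "\<forall>a\<in>\<Lambda>1. C +>\<^bsub>subring_of \<Lambda>1\<^esub> a \<in> carrier Q1 \<longrightarrow>
    (glue_classes \<circ> local_classes) (carrier Q2 #>\<^bsub>Q1\<^esub> (C +>\<^bsub>subring_of \<Lambda>1\<^esub> a))
      = {c + a * x | c x. c \<in> C \<and> x \<in> \<Lambda>2}"
  unfolding a_r_coset_subring_of K_def[symmetric] using glue_local_classes_coset Q1_cl_iff by blast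

lemma exact_at_units2: "exact_at (singleton_group ()) (\<lambda>_. \<one>\<^bsub>unit_group \<Lambda>2\<^esub>) (unit_group \<Lambda>2) (\<lambda>u. u) (unit_group \<Lambda>1)"
  by (rule exact_inclusion[OF group_global_units(2,1) inclusion_units])

lemma exact_at_units1: "exact_at (unit_group \<Lambda>2) (\<lambda>u. u) (unit_group \<Lambda>1) (\<lambda>u. \<lambda>p\<in>P0. cst p u) PQ"
  unfolding exact_at_def diagonal_def[abs_def, symmetric] diagonal_kernel
  using group_hom_intro[OF group_global_units(2,1) inclusion_units] group_hom_diagonal by simp

lemma exact_at_PQ: "exact_at (unit_group \<Lambda>1) (\<lambda>u. \<lambda>p\<in>P0. cst p u) PQ (\<lambda>Y. eps_class scale (glue_classes Y)) E2"
  unfolding exact_at_def diagonal_def[abs_def, symmetric]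
  using group_hom_diagonal group_hom_class_of_glue diagonal_image by blast

lemma exact_at_E2:
  "exact_at PQ (\<lambda>Y. eps_class scale (glue_classes Y)) E2 (class_mult scale (eps_class scale \<Lambda>1)) E1"
  unfolding exact_at_def
  using group_hom_class_of_glue group_hom_class_group[OF order1 order2 sub] class_image by blast

lemma exact_at_E1: "exact_at E2 (class_mult scale (eps_class scale \<Lambda>1)) E1 (\<lambda>_. ()) (singleton_group ())"
  by (rule exact_onto[OF group_hom_class_group[OF order1 order2 sub] class_extension_image])

lemma class_extension_epi: "class_mult scale (eps_class scale \<Lambda>1) \<in> epi E2 E1"
  unfolding epi_def
  using group_hom.homh[OF group_hom_class_group[OF order1 order2 sub]] class_extension_image by blast

lemma class_extension_formula:
  "\<forall>L. full_lattice scale L \<longrightarrow>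
    class_mult scale (eps_class scale \<Lambda>1) (eps_class scale L) = eps_class scale (lat_mult \<Lambda>1 L)"
  using class_mult_eps_class[OF order_full[OF order1]] by blast

end

theorem theorem8p2:
  fixes scale :: "rat \<Rightarrow> 'a::comm_ring_1 \<Rightarrow> 'a"
    and \<Lambda>1 \<Lambda>2 C :: "'a set"
    and P0 :: "nat set"
    and U1 U2 :: "nat \<Rightarrow> 'a monoid"
    and Q1 Q2 :: "'a set monoid"
    and G1 G2 :: "'a set monoid"
    and E1 E2 :: "'a set set monoid"
    and coset :: "nat \<Rightarrow> 'a \<Rightarrow> 'a set"
  assumes alg: "fin_dim_comm_rat_algebra scale"
    and ord1: "is_order scale \<Lambda>1" and ord2: "is_order scale \<Lambda>2" and sub: "\<Lambda>2 \<subset> \<Lambda>1"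
  defines "C \<equiv> colon \<Lambda>2 \<Lambda>1"
    and "P0 \<equiv> {p. prime p \<and> loc scale p \<Lambda>1 \<noteq> loc scale p \<Lambda>2}"
    and "U1 \<equiv> \<lambda>p. unit_group (loc scale p \<Lambda>1)"
    and "U2 \<equiv> \<lambda>p. unit_group (loc scale p \<Lambda>2)"
    and "Q1 \<equiv> quot_unit_group \<Lambda>1 C"
    and "Q2 \<equiv> quot_unit_group \<Lambda>2 C"
    and "G1 \<equiv> lat_group scale \<Lambda>1"
    and "G2 \<equiv> lat_group scale \<Lambda>2"
    and "E1 \<equiv> class_group scale \<Lambda>1"
    and "E2 \<equiv> class_group scale \<Lambda>2"
    and "coset \<equiv> \<lambda>p b. carrier (U2 p) #>\<^bsub>U1 p\<^esub> b"
  shows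
    "full_lattice scale C \<and> finite P0

     \<comment> \<open>(a)\<close>
     \<and> \<Lambda>1 \<subseteq> order_of C
     \<and> lat_ideal scale \<Lambda>1 C \<and> C \<subseteq> \<Lambda>2
     \<and> (\<forall>L. lat_ideal scale \<Lambda>1 L \<and> L \<subseteq> \<Lambda>2 \<longrightarrow> L \<subseteq> C)

     \<comment> \<open>(b)\<close>
     \<and> exact_at (singleton_group ()) (\<lambda>_. \<one>\<^bsub>product_group P0 U2\<^esub>)
         (product_group P0 U2) (\<lambda>a. a) (product_group P0 U1)
     \<and> exact_at (product_group P0 U2) (\<lambda>a. a) (product_group P0 U1) (glue scale P0 \<Lambda>2) G2
     \<and> exact_at (product_group P0 U1) (glue scale P0 \<Lambda>2) G2 (lat_mult \<Lambda>1) G1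
     \<and> exact_at G2 (lat_mult \<Lambda>1) G1 (\<lambda>_. ()) (singleton_group ())
     \<and> lat_mult \<Lambda>1 \<in> epi G2 G1
     \<and> (\<forall>a \<in> carrier (product_group P0 U1).
          let is_glued = (\<lambda>L. full_lattice scale L \<and>
                (\<forall>p. prime p \<longrightarrow> loc scale p L = (*) (ext_one P0 a p) ` loc scale p \<Lambda>2))
          in is_glued (glue scale P0 \<Lambda>2 a) \<and> (\<exists>!L. is_glued L))

     \<comment> \<open>\<open>\<phi>\<close> is the isomorphism in (c), \<open>\<beta>\<close> the map induced by \<open>glue\<close> on the quotients\<close>
     \<and> (\<exists>\<phi> \<beta>.
          \<comment> \<open>(c)\<close>
          \<phi> \<in> iso (Q1 Mod carrier Q2) (sum_group P0 (\<lambda>p. U1 p Mod carrier (U2 p)))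
          \<and> (\<forall>a\<in>\<Lambda>1. C +>\<^bsub>subring_of \<Lambda>1\<^esub> a \<in> carrier Q1 \<longrightarrow>
               (let is_lift = (\<lambda>b. b \<in> carrier (product_group P0 U1) \<and>
                     (\<forall>p\<in>P0. loc scale p C +>\<^bsub>subring_of (loc scale p \<Lambda>1)\<^esub> b p
                            = loc scale p C +>\<^bsub>subring_of (loc scale p \<Lambda>1)\<^esub> a))
                in (\<exists>b. is_lift b) \<and>
                   (\<forall>b. is_lift b \<longrightarrow>
                      \<phi> (carrier Q2 #>\<^bsub>Q1\<^esub> (C +>\<^bsub>subring_of \<Lambda>1\<^esub> a)) = (\<lambda>p\<in>P0. coset p (b p)))))

          \<and> (\<forall>b \<in> carrier (product_group P0 U1).
               \<beta> (\<lambda>p\<in>P0. coset p (b p)) = glue scale P0 \<Lambda>2 b)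

          \<comment> \<open>(d)\<close>
          \<and> \<beta> \<circ> \<phi> \<in> iso (Q1 Mod carrier Q2) (G2\<lparr>carrier := kernel G2 G1 (lat_mult \<Lambda>1)\<rparr>)
          \<and> (\<forall>a\<in>\<Lambda>1. C +>\<^bsub>subring_of \<Lambda>1\<^esub> a \<in> carrier Q1 \<longrightarrow>
               (\<beta> \<circ> \<phi>) (carrier Q2 #>\<^bsub>Q1\<^esub> (C +>\<^bsub>subring_of \<Lambda>1\<^esub> a))
                 = {c + a * x | c x. c \<in> C \<and> x \<in> \<Lambda>2})

          \<comment> \<open>(e)\<close>
          \<and> exact_at (singleton_group ()) (\<lambda>_. \<one>\<^bsub>unit_group \<Lambda>2\<^esub>)
              (unit_group \<Lambda>2) (\<lambda>u. u) (unit_group \<Lambda>1)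
          \<and> exact_at (unit_group \<Lambda>2) (\<lambda>u. u)
              (unit_group \<Lambda>1) (\<lambda>u. \<lambda>p\<in>P0. coset p u)
              (product_group P0 (\<lambda>p. U1 p Mod carrier (U2 p)))
          \<and> exact_at (unit_group \<Lambda>1) (\<lambda>u. \<lambda>p\<in>P0. coset p u)
              (product_group P0 (\<lambda>p. U1 p Mod carrier (U2 p))) (\<lambda>Y. eps_class scale (\<beta> Y)) E2
          \<and> exact_at (product_group P0 (\<lambda>p. U1 p Mod carrier (U2 p))) (\<lambda>Y. eps_class scale (\<beta> Y))
              E2 (class_mult scale (eps_class scale \<Lambda>1)) E1)
     \<and> exact_at E2 (class_mult scale (eps_class scale \<Lambda>1)) E1 (\<lambda>_. ()) (singleton_group ())
     \<and> class_mult scale (eps_class scale \<Lambda>1) \<in> epi E2 E1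
     \<and> (\<forall>L. full_lattice scale L \<longrightarrow>
          class_mult scale (eps_class scale \<Lambda>1) (eps_class scale L)
            = eps_class scale (lat_mult \<Lambda>1 L))

     \<comment> \<open>(f)\<close>
     \<and> subgroup (carrier (unit_group \<Lambda>2)) (unit_group \<Lambda>1)
     \<and> finite (rcosets\<^bsub>unit_group \<Lambda>1\<^esub> carrier (unit_group \<Lambda>2))
     \<and> finite (carrier E2) \<and> finite (carrier E1)
     \<and> finite (carrier Q1) \<and> finite (carrier Q2)
     \<and> rat_of_nat (order E2) / rat_of_nat (order E1)
         = rat_of_nat (order Q1) / rat_of_nat (order Q2)
           * (1 / rat_of_nat (card (rcosets\<^bsub>unit_group \<Lambda>1\<^esub> carrier (unit_group \<Lambda>2))))"
proof -
  interpret op: order_pair scale \<Lambda>1 \<Lambda>2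
    using alg ord1 ord2 sub by (intro order_pair.intro order_pair_axioms.intro) auto
  show ?thesis
    unfolding assms(5-) op.P0_def[symmetric]
    by (intro conjI exI[of _ op.local_classes] exI[of _ op.glue_classes]
        op.full_C op.finite_P0 op.order_of_C op.conductor_lat_ideal op.C_subset2 op.conductor_greatest
        op.exact_at_PU2 op.exact_at_PU1 op.exact_at_G2 op.exact_at_G1 op.extension_epi op.glue_unique
        op.local_classes_iso_sum op.local_classes_lift op.glue_classes_induced
        op.glue_local_classes_iso op.glue_local_classes_formula
        op.exact_at_units2 op.exact_at_units1 op.exact_at_PQ op.exact_at_E2 op.exact_at_E1 op.class_extension_epi op.class_extension_formula
        unit_group_subgroup[OF op.subring2 op.subring1 op.sub] op.finite_rcosets_units
        op.finite_class_group[OF ord2] op.finite_class_group[OF ord1] op.finite_Q1 op.finite_Q2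
        op.class_number_formula)
qed

end
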